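(* For every positive integer $r$ there exists a constant $C_r$ such that for every positive integer $\Delta$ and every bipartite $\Delta$-bounded graph sequence $\mathcal{F}=\{F_1,F_2,\dots\}$ we have $\tau_r(\mathcal{F})\leq \exp(C_r\Delta)$. That is, every $r$-edge coloured complete graph has a monochromatic $\mathcal{F}$-tiling of size at most $\exp(C_r\Delta)$.
   Context: A bipartite $\Delta$-bounded graph sequence is a sequence $\mathcal{F}=\{F_1,F_2,\dots\}$ of bipartite graphs such that $F_i$ has exactly $i$ vertices and maximum degree $\Delta(F_i)\leq\Delta$ for every $i\ge 1$. A monochromatic $\mathcal{F}$-tiling of size $s$ of an edge-coloured complete graph $K_n$ is a collection of $s$ monochromatic (not necessarily induced) subgraphs, each isomorphic to an element of $\mathcal{F}$, whose vertex sets partition $V(K_n)$; different members of the collection may have different colours. The $r$-colour tiling number $\tau_r(\mathcal{F})$ is the minimal $s$ such that every $r$-edge coloured complete graph (on any finite number of vertices, with an arbitrary colouring of the edges using $r$ colours) has a monochromatic $\mathcal{F}$-tiling of size at most $s$, with $\tau_r(\mathcal{F})=\infty$ if no such $s$ exists. *)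

theory Defs
  imports Complex_Main "HOL-Library.Ramsey" "HOL-Library.Disjoint_Sets"
    "HOL-Library.Extended_Nat" "HOL-Library.Extended_Real"
begin

text \<open>Finite simple graphs. All vertices are natural numbers; this is no restriction, since every
  finite graph is isomorphic to one of these. \<open>[V]\<^bsup>2\<^esup>\<close> is the set of two-element subsets of \<open>V\<close>.\<close>

record graph =
  verts :: "nat set"
  edges :: "nat set set"

definition simple_graph :: "graph \<Rightarrow> bool" where
  "simple_graph G \<longleftrightarrow> finite (verts G) \<and> edges G \<subseteq> [verts G]\<^bsup>2\<^esup>"

definition degree :: "graph \<Rightarrow> nat \<Rightarrow> nat" where
  "degree G v = card {e \<in> edges G. v \<in> e}"

text \<open>Only meaningful for graphs with at least one vertex.\<close>

definition max_degree :: "graph \<Rightarrow> nat" where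
  "max_degree G = Max (degree G ` verts G)"

definition bipartite :: "graph \<Rightarrow> bool" where
  "bipartite G \<longleftrightarrow> (\<exists>A B. A \<union> B = verts G \<and> A \<inter> B = {} \<and>
     (\<forall>e \<in> edges G. \<exists>a \<in> A. \<exists>b \<in> B. e = {a, b}))"

definition subgraph :: "graph \<Rightarrow> graph \<Rightarrow> bool" where
  "subgraph H G \<longleftrightarrow> simple_graph H \<and> verts H \<subseteq> verts G \<and> edges H \<subseteq> edges G"

definition isomorphic :: "graph \<Rightarrow> graph \<Rightarrow> bool" where
  "isomorphic G H \<longleftrightarrow> (\<exists>f. bij_betw f (verts G) (verts H) \<and>
     (\<forall>u \<in> verts G. \<forall>v \<in> verts G. {u, v} \<in> edges G \<longleftrightarrow> {f u, f v} \<in> edges H))"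

definition complete_graph :: "nat set \<Rightarrow> graph" where
  "complete_graph V = \<lparr>verts = V, edges = [V]\<^bsup>2\<^esup>\<rparr>"

text \<open>Sequences are indexed from 1; the value \<open>F 0\<close> is irrelevant here and below.\<close>

definition bipartite_bounded_seq :: "nat \<Rightarrow> (nat \<Rightarrow> graph) \<Rightarrow> bool" where
  "bipartite_bounded_seq \<Delta> F \<longleftrightarrow> (\<forall>i \<ge> 1. simple_graph (F i) \<and> bipartite (F i) \<and>
     card (verts (F i)) = i \<and> max_degree (F i) \<le> \<Delta>)"

definition edge_colouring :: "nat \<Rightarrow> graph \<Rightarrow> (nat set \<Rightarrow> nat) \<Rightarrow> bool" where
  "edge_colouring r G c \<longleftrightarrow> c \<in> edges G \<rightarrow> {..<r}"

definition monochromatic :: "(nat set \<Rightarrow> nat) \<Rightarrow> graph \<Rightarrow> bool" where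
  "monochromatic c H \<longleftrightarrow> (\<exists>k. \<forall>e \<in> edges H. c e = k)"

text \<open>Every tile has at least one vertex, so distinct tiles have distinct vertex sets, and a
  collection of tiles can be represented by a set of graphs.\<close>

definition mono_tiling :: "(nat \<Rightarrow> graph) \<Rightarrow> graph \<Rightarrow> (nat set \<Rightarrow> nat) \<Rightarrow> graph set \<Rightarrow> bool" where
  "mono_tiling F G c T \<longleftrightarrow> finite T \<and>
     (\<forall>H \<in> T. subgraph H G \<and> monochromatic c H \<and> (\<exists>i \<ge> 1. isomorphic (F i) H)) \<and>
     disjoint_family_on verts T \<and> (\<Union>H \<in> T. verts H) = verts G"

text \<open>The infimum of the empty set in \<^typ>\<open>enat\<close> is \<open>\<infinity>\<close>, and that of a nonempty set is its minimum.\<close>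

definition tiling_number :: "nat \<Rightarrow> (nat \<Rightarrow> graph) \<Rightarrow> enat" where
  "tiling_number r F = Inf {enat s | s. \<forall>V c. finite V \<and> edge_colouring r (complete_graph V) c \<longrightarrow>
     (\<exists>T. mono_tiling F (complete_graph V) c T \<and> card T \<le> s)}"

end

theory Submission
  imports Defs
begin

text \<open>Two disjoint copies of \<open>F m\<close> with interchanged parts form a bipartite graph with \<open>m\<close> vertices
  on either side. Dependent random choice finds, in a bipartite graph of constant density between
  \<open>A0\<close> and \<open>B0\<close>, a set \<open>A \<subseteq> A0\<close> losing only a factor \<open>2 ^ O(D)\<close> such that almost all pairs of
  \<open>D\<close>-tuples in \<open>A\<close> have many common neighbours in \<open>B0\<close>. This suffices to embed the double copy
  greedily. It also gives an embedding, called a template, that can absorb: if the neighbourhoods of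
  linearly many far apart vertices of one side are mapped to suitable tuples, then a new vertex \<open>v\<close>
  can replace any \<open>w\<close> among their images, since for many slots \<open>z\<close> the vertex \<open>v\<close> fits into \<open>z\<close> and
  the present occupant of \<open>z\<close> fits into the slot of \<open>w\<close>.

  To tile a coloured complete graph, set aside a template and a small set \<open>Q\<close> of vertices that can be
  exchanged into it, and cover almost everything else greedily. The few remaining vertices, together
  with about half of \<open>Q\<close>, are covered by tiles between them and the template, colour by colour; the
  vertices of the template that this uses up are replaced by the other half of \<open>Q\<close>. Covering a small
  set \<open>R\<close> at the expense of a large set \<open>A\<close> in one colour proceeds in rounds: a template absorbs those
  remaining vertices that have large degree to some \<open>A1 \<subseteq> A\<close>, and all others have larger relative
  degree to \<open>A - A1\<close>, so \<open>2 ^ O(D)\<close> rounds are enough.\<close>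

subsection \<open>Dependent random choice\<close>

text \<open>The obstacle is that placing the neighbours of a vertex one at a time costs a factor of
  order \<open>D\<close> for each, hence about \<open>D ^ D\<close> in the admissible share of bad
  tuples, while the host may shrink only by a factor \<open>2 ^ (k * D)\<close>. Dependent random
  choice reconciles the two: the threshold for common neighbourhoods lies a factor
  \<open>2 ^ D\<close> below the expected size at density \<open>2 ^ (- \<delta>)\<close>, so each
  of the \<open>t\<close> sampled vertices lowers the share of bad tuples by
  \<open>2 ^ (- D)\<close> but shrinks the host only by \<open>2 ^ (- \<delta>)\<close>. With
  \<open>t\<close> a multiple of \<open>D\<close>, the share of bad tuples is exponentially small in
  \<open>D * D\<close>, which beats \<open>D ^ D\<close>. Pairs of \<open>D\<close>-tuples are
  controlled because an exchange makes two demands on one vertex: the occupant of \<open>z\<close>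
  has to be adjacent to the neighbourhood of its own slot and to that of the slot of
  \<open>w\<close>. Replacing \<open>w\<close> by \<open>v\<close> directly would require
  \<open>v\<close> to be adjacent to one prescribed tuple, which large degree does not guarantee.
  All random choices are carried out by counting and averaging.\<close>

definition lsts :: "'a set \<Rightarrow> nat \<Rightarrow> 'a list set" where
  "lsts A n = {xs. set xs \<subseteq> A \<and> length xs = n}"

lemma card_lsts: "finite A \<Longrightarrow> card (lsts A n) = card A ^ n"
  by (simp add: lsts_def card_lists_length_eq)

lemma finite_lsts [simp]: "finite A \<Longrightarrow> finite (lsts A n)"
  by (simp add: lsts_def finite_lists_length_eq)

definition cnb :: "('a \<Rightarrow> 'b \<Rightarrow> bool) \<Rightarrow> 'b set \<Rightarrow> 'a set \<Rightarrow> 'b set" where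
  "cnb adj B S = {b \<in> B. \<forall>a \<in> S. adj a b}"

lemma finite_cnb [simp]: "finite B \<Longrightarrow> finite (cnb adj B S)"
  by (simp add: cnb_def)

lemma cnb_antimono: "S \<subseteq> T \<Longrightarrow> cnb adj B T \<subseteq> cnb adj B S"
  by (auto simp: cnb_def)

lemma cnb_subset: "cnb adj B S \<subseteq> B"
  by (auto simp: cnb_def)

lemma sum_card_swap:
  assumes "finite X" "finite Y"
  shows "(\<Sum>x\<in>X. card {y \<in> Y. R x y}) = (\<Sum>y\<in>Y. card {x \<in> X. R x y})"
  using sum_multicount_gen[OF assms(1,2), of R "\<lambda>y. card {x \<in> X. R x y}"] by simp

text \<open>The tangent line of \<open>x \<mapsto> x\<^sup>t\<close> at \<open>\<mu>\<close>.\<close>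

lemma power_tangent:
  fixes x \<mu> :: real
  assumes "x \<ge> 0" "\<mu> > 0"
  shows "x ^ t \<ge> \<mu> ^ t + real t * \<mu> ^ (t - 1) * (x - \<mu>)"
proof (cases t)
  case (Suc s)
  have "1 + real t * (x / \<mu> - 1) \<le> (1 + (x / \<mu> - 1)) ^ t"
    by (rule Bernoulli_inequality) (use assms in \<open>simp add: field_simps\<close>)
  hence "\<mu> ^ t * (1 + real t * (x / \<mu> - 1)) \<le> \<mu> ^ t * (x / \<mu>) ^ t"
    using assms by (intro mult_left_mono) auto
  also have "\<mu> ^ t * (x / \<mu>) ^ t = x ^ t"
    using assms by (simp add: power_divide)
  also have "\<mu> ^ t * (1 + real t * (x / \<mu> - 1)) = \<mu> ^ t + real t * \<mu> ^ (t - 1) * (x - \<mu>)"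
    using assms Suc by (simp add: field_simps)
  finally show ?thesis .
qed simp

text \<open>Jensen's inequality for the power function: the tangent lines at \<open>\<mu>\<close>
  are added up over \<open>I\<close>, and their linear parts contribute a nonnegative amount because
  the mean of \<open>f\<close> is at least \<open>\<mu>\<close>.\<close>

lemma sum_power_ge:
  fixes f :: "'i \<Rightarrow> real" and \<mu> :: real
  assumes "finite I" "\<And>i. i \<in> I \<Longrightarrow> f i \<ge> 0" "\<mu> > 0" "(\<Sum>i\<in>I. f i) \<ge> \<mu> * card I"
  shows "(\<Sum>i\<in>I. f i ^ t) \<ge> \<mu> ^ t * card I"
proof -
  have "\<mu> ^ t * card I \<le> \<mu> ^ t * card I + real t * \<mu> ^ (t - 1) * ((\<Sum>i\<in>I. f i) - \<mu> * card I)"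
    using assms by (auto intro!: mult_nonneg_nonneg)
  also have "\<dots> = (\<Sum>i\<in>I. \<mu> ^ t + real t * \<mu> ^ (t - 1) * (f i - \<mu>))"
    by (simp add: sum.distrib sum_subtractf sum_distrib_left sum_distrib_right algebra_simps)
  also have "\<dots> \<le> (\<Sum>i\<in>I. f i ^ t)"
    using assms by (intro sum_mono power_tangent) auto
  finally show ?thesis .
qed

text \<open>Sample \<open>t\<close> vertices of \<open>B0\<close> with repetition and let
  \<open>A\<close> be their common neighbourhood \<open>N bs\<close>. By double counting and
  convexity, on average at least a share \<open>d ^ (p * t)\<close> of all \<open>p\<close>-tuples
  lies in \<open>N bs\<close>, whereas a given tuple with few common neighbours does so with
  probability at most \<open>\<theta> ^ t\<close>. The hypothesis on \<open>\<epsilon>\<close> makes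
  the second quantity, divided by \<open>\<epsilon>\<close>, at most half of the first.\<close>

lemma dependent_random_choice:
  fixes adj :: "'a \<Rightarrow> 'b \<Rightarrow> bool" and d \<theta> \<epsilon> :: real
  assumes fin: "finite A0" "finite B0" and ne: "A0 \<noteq> {}" "B0 \<noteq> {}"
    and deg: "\<And>b. b \<in> B0 \<Longrightarrow> d * card A0 \<le> card {a \<in> A0. adj a b}"
    and par: "0 < d" "d \<le> 1" "0 \<le> \<theta>" "0 < \<epsilon>" "2 * \<theta> ^ t \<le> \<epsilon> * d ^ (p * t)" "p \<ge> 1"
  obtains A where "A \<subseteq> A0" "A \<noteq> {}" "d ^ t / 2 * card A0 \<le> card A"
    "card {as \<in> lsts A p. card (cnb adj B0 (set as)) < \<theta> * card B0} \<le> \<epsilon> * card A ^ p"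
proof -
  define N where "N = (\<lambda>bs. {a \<in> A0. \<forall>b \<in> set bs. adj a b})"
  define bad where "bad = (\<lambda>as. card (cnb adj B0 (set as)) < \<theta> * card B0)"
  define LA where "LA = lsts A0 p"
  define LB where "LB = lsts B0 t"
  have finL: "finite LA" "finite LB" using fin by (auto simp: LA_def LB_def)
  have cA: "card A0 > 0" and cB: "card B0 > 0" using fin ne by (auto simp: card_gt_0_iff)
  have finN: "finite (N bs)" for bs using fin by (simp add: N_def)
  have sub: "as \<in> lsts (N bs) p \<longleftrightarrow> as \<in> LA \<and> (\<forall>a\<in>set as. \<forall>b\<in>set bs. adj a b)" for as bs
    by (auto simp: lsts_def N_def LA_def)
  have sub2: "{bs \<in> LB. \<forall>a\<in>set as. \<forall>b\<in>set bs. adj a b} = lsts (cnb adj B0 (set as)) t" for as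
    by (auto simp: lsts_def LB_def cnb_def)
  have mean: "real (\<Sum>as\<in>LA. card (cnb adj B0 (set as))) \<ge> (d ^ p * card B0) * card LA"
  proof -
    have "(\<Sum>as\<in>LA. card (cnb adj B0 (set as))) = (\<Sum>b\<in>B0. card {as\<in>LA. \<forall>a\<in>set as. adj a b})"
      unfolding cnb_def by (rule sum_card_swap) (use fin finL in auto)
    also have "\<dots> = (\<Sum>b\<in>B0. card {a \<in> A0. adj a b} ^ p)"
    proof (rule sum.cong)
      fix b
      have "{as\<in>LA. \<forall>a\<in>set as. adj a b} = lsts {a \<in> A0. adj a b} p"
        by (auto simp: LA_def lsts_def)
      thus "card {as\<in>LA. \<forall>a\<in>set as. adj a b} = card {a \<in> A0. adj a b} ^ p"
        using fin by (simp add: card_lsts)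
    qed simp
    finally have eq: "(\<Sum>as\<in>LA. card (cnb adj B0 (set as))) = (\<Sum>b\<in>B0. card {a \<in> A0. adj a b} ^ p)" .
    have "(\<Sum>b\<in>B0. (d * card A0) ^ p) \<le> (\<Sum>b\<in>B0. real (card {a \<in> A0. adj a b}) ^ p)"
      using par deg by (intro sum_mono power_mono) auto
    thus ?thesis using fin unfolding eq by (simp add: LA_def card_lsts power_mult_distrib algebra_simps)
  qed
  have S1: "real (\<Sum>bs\<in>LB. card (N bs) ^ p) \<ge> (d ^ p * card B0) ^ t * card A0 ^ p"
  proof -
    have "(\<Sum>bs\<in>LB. card (N bs) ^ p) = (\<Sum>bs\<in>LB. card {as\<in>LA. \<forall>a\<in>set as. \<forall>b\<in>set bs. adj a b})"
    proof (rule sum.cong)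
      fix bs
      have "{as\<in>LA. \<forall>a\<in>set as. \<forall>b\<in>set bs. adj a b} = lsts (N bs) p" using sub by blast
      thus "card (N bs) ^ p = card {as\<in>LA. \<forall>a\<in>set as. \<forall>b\<in>set bs. adj a b}"
        using finN by (simp add: card_lsts)
    qed simp
    also have "\<dots> = (\<Sum>as\<in>LA. card {bs\<in>LB. \<forall>a\<in>set as. \<forall>b\<in>set bs. adj a b})"
      by (rule sum_card_swap) (use finL in auto)
    also have "\<dots> = (\<Sum>as\<in>LA. card (cnb adj B0 (set as)) ^ t)"
      unfolding sub2 using fin by (simp add: card_lsts)
    finally have eq: "(\<Sum>bs\<in>LB. card (N bs) ^ p) = (\<Sum>as\<in>LA. card (cnb adj B0 (set as)) ^ t)" .
    have "(\<Sum>as\<in>LA. real (card (cnb adj B0 (set as))) ^ t) \<ge> (d ^ p * card B0) ^ t * card LA"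
      by (rule sum_power_ge) (use finL par cB mean in auto)
    thus ?thesis unfolding eq using fin by (simp add: LA_def card_lsts)
  qed
  have S2: "real (\<Sum>bs\<in>LB. card {as \<in> lsts (N bs) p. bad as}) \<le> card A0 ^ p * (\<theta> * card B0) ^ t"
  proof -
    have "(\<Sum>bs\<in>LB. card {as \<in> lsts (N bs) p. bad as})
        = (\<Sum>bs\<in>LB. card {as\<in>{as\<in>LA. bad as}. \<forall>a\<in>set as. \<forall>b\<in>set bs. adj a b})"
      using sub by (intro sum.cong arg_cong[of _ _ card]) auto
    also have "\<dots> = (\<Sum>as\<in>{as\<in>LA. bad as}. card {bs\<in>LB. \<forall>a\<in>set as. \<forall>b\<in>set bs. adj a b})"
      by (rule sum_card_swap) (use finL in auto)
    also have "\<dots> = (\<Sum>as\<in>{as\<in>LA. bad as}. card (cnb adj B0 (set as)) ^ t)"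
      unfolding sub2 using fin by (simp add: card_lsts)
    finally have eq: "(\<Sum>bs\<in>LB. card {as \<in> lsts (N bs) p. bad as})
       = (\<Sum>as\<in>{as\<in>LA. bad as}. card (cnb adj B0 (set as)) ^ t)" .
    have "(\<Sum>as\<in>{as\<in>LA. bad as}. real (card (cnb adj B0 (set as))) ^ t)
        \<le> (\<Sum>as\<in>{as\<in>LA. bad as}. (\<theta> * card B0) ^ t)"
      by (intro sum_mono power_mono) (auto simp: bad_def)
    also have "\<dots> \<le> card LA * (\<theta> * card B0) ^ t"
      using finL par by (auto intro!: mult_right_mono card_mono)
    finally show ?thesis unfolding eq using fin by (simp add: LA_def card_lsts)
  qed
  define thr where "thr = d ^ (p * t) / 2 * card A0 ^ p"
  have cLB: "real (card LB) = card B0 ^ t" using fin by (simp add: LB_def card_lsts)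
  \<comment> \<open>One averaged quantity serves both conclusions: where it is positive, there are
    at most \<open>\<epsilon> * card (N bs) ^ p\<close> bad tuples, and its lower bound
    \<open>thr\<close> also bounds \<open>card (N bs) ^ p\<close> from below.\<close>
  have "(\<Sum>bs\<in>LB. card (N bs) ^ p - card {as \<in> lsts (N bs) p. bad as} / \<epsilon>)
     \<ge> (d ^ p * card B0) ^ t * card A0 ^ p - card A0 ^ p * (\<theta> * card B0) ^ t / \<epsilon>"
    using S1 S2 par by (simp add: sum_subtractf sum_divide_distrib[symmetric] diff_mono divide_right_mono)
  also have "(d ^ p * card B0) ^ t * card A0 ^ p - card A0 ^ p * (\<theta> * card B0) ^ t / \<epsilon>
     = card B0 ^ t * card A0 ^ p * (d ^ (p * t) - \<theta> ^ t / \<epsilon>)"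
    by (simp add: power_mult_distrib power_mult algebra_simps)
  finally have "(\<Sum>bs\<in>LB. card (N bs) ^ p - card {as \<in> lsts (N bs) p. bad as} / \<epsilon>)
     \<ge> card B0 ^ t * card A0 ^ p * (d ^ (p * t) - \<theta> ^ t / \<epsilon>)" .
  moreover have "d ^ (p * t) - \<theta> ^ t / \<epsilon> \<ge> d ^ (p * t) / 2"
    using par by (simp add: field_simps)
  hence "card B0 ^ t * card A0 ^ p * (d ^ (p * t) - \<theta> ^ t / \<epsilon>) \<ge> card B0 ^ t * card A0 ^ p * (d ^ (p * t) / 2)"
    by (intro mult_left_mono) auto
  ultimately have "(\<Sum>bs\<in>LB. card (N bs) ^ p - card {as \<in> lsts (N bs) p. bad as} / \<epsilon>) \<ge> (\<Sum>bs\<in>LB. thr)"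
    using cLB by (simp add: thr_def algebra_simps)
  moreover have "LB \<noteq> {}" using cLB cB finL by auto
  ultimately obtain bs where bs: "bs \<in> LB" "card (N bs) ^ p - card {as \<in> lsts (N bs) p. bad as} / \<epsilon> \<ge> thr"
    using finL sum_strict_mono[of LB "\<lambda>bs. card (N bs) ^ p - card {as \<in> lsts (N bs) p. bad as} / \<epsilon>" "\<lambda>_. thr"]
    by (meson not_le)
  have thr: "thr > 0" using par cA by (simp add: thr_def)
  have c1: "card {as \<in> lsts (N bs) p. bad as} \<le> \<epsilon> * card (N bs) ^ p"
  proof -
    have "card {as \<in> lsts (N bs) p. bad as} / \<epsilon> \<le> card (N bs) ^ p" using bs(2) thr by linarith
    thus ?thesis using par by (simp add: field_simps)
  qed
  have c2: "real (card (N bs)) ^ p \<ge> thr" using bs(2) thr par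
    by (smt (verit) divide_nonneg_pos of_nat_0_le_iff of_nat_power)
  have "(d ^ t / 2 * card A0) ^ p \<le> thr"
  proof -
    \<comment> \<open>The factor \<open>1/2\<close> is lowered to \<open>(1/2) ^ p\<close> so that a
      \<open>p\<close>-th root can be taken.\<close>
    have "(1/2::real) ^ p \<le> 1 / 2" using par(6) power_decreasing[of 1 p "1/2::real"] by simp
    hence "d ^ (p * t) * (1/2) ^ p * card A0 ^ p \<le> d ^ (p * t) * (1/2) * card A0 ^ p"
      using par by (intro mult_right_mono mult_left_mono) auto
    thus ?thesis
      by (simp add: thr_def power_mult_distrib power_divide power_mult[symmetric] mult.commute algebra_simps)
  qed
  with c2 have "(d ^ t / 2 * card A0) ^ p \<le> real (card (N bs)) ^ p" by linarith
  hence c3: "d ^ t / 2 * card A0 \<le> card (N bs)"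
    using par(6) by (metis Suc_pred' le_zero_eq less_one not_le of_nat_0_le_iff power_le_imp_le_base zero_less_iff_neq_zero less_le_trans zero_less_one)
  have "N bs \<noteq> {}" 
  proof
    assume "N bs = {}"
    with c3 have "d ^ t / 2 * card A0 \<le> 0" by simp
    moreover have "d ^ t / 2 * card A0 > 0" using par cA by simp
    ultimately show False by linarith
  qed
  moreover have "N bs \<subseteq> A0" by (auto simp: N_def)
  ultimately show ?thesis using that c1 c3 unfolding bad_def by blast
qed

subsection \<open>Embedding bipartite graphs of bounded degree\<close>

text \<open>Representatives can be picked one by one: whenever a set is due, fewer than
  \<open>card J\<close> elements have been used.\<close>

lemma system_of_distinct_representatives:
  assumes "finite J" "\<And>j. j \<in> J \<Longrightarrow> finite (S j)" "\<And>j. j \<in> J \<Longrightarrow> card J \<le> card (S j)"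
  obtains z where "inj_on z J" "\<And>j. j \<in> J \<Longrightarrow> z j \<in> S j"
proof -
  have "\<exists>z. inj_on z I \<and> (\<forall>j\<in>I. z j \<in> S j)" if "finite I" "I \<subseteq> J" for I
    using that
  proof (induction I)
    case (insert i I)
    then obtain z where z: "inj_on z I" "\<forall>j\<in>I. z j \<in> S j" by auto
    have "card (z ` I) < card (S i)"
      using insert.prems insert.hyps assms(3)[of i] card_image_le[OF insert.hyps(1), of z]
        card_mono[OF assms(1) insert.prems] by simp
    then obtain s where s: "s \<in> S i" "s \<notin> z ` I"
      using insert.hyps(1) by (metis card_mono finite_imageI not_le subsetI)
    have "inj_on (z(i := s)) (insert i I) \<and> (\<forall>j\<in>insert i I. (z(i := s)) j \<in> S j)"
      using z s insert.hyps by (auto simp: inj_on_def)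
    thus ?case by blast
  qed auto
  from this[OF assms(1) subset_refl] that show ?thesis by blast
qed

text \<open>The two sides have separate maps, into possibly different types. Once both types consist
  of graph vertices, disjointness of \<open>A\<close> and \<open>B\<close> keeps the two images
  apart.\<close>

definition embeds where
  "embeds h X Y adj A B f g \<longleftrightarrow> inj_on f X \<and> f ` X \<subseteq> A \<and> inj_on g Y \<and> g ` Y \<subseteq> B \<and>
     (\<forall>x\<in>X. \<forall>y\<in>Y. h x y \<longrightarrow> adj (f x) (g y))"

definition bounded_bip where
  "bounded_bip h X Y D m \<longleftrightarrow> finite X \<and> finite Y \<and> card X = m \<and> card Y = m \<and>
     (\<forall>x\<in>X. card {y\<in>Y. h x y} \<le> D) \<and> (\<forall>y\<in>Y. card {x\<in>X. h x y} \<le> D)"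

section \<open>Good partial images and greedy embedding\<close>

locale host =
  fixes adj :: "'a \<Rightarrow> 'b \<Rightarrow> bool" and A :: "'a set" and B :: "'b set" and \<delta> D :: nat
  assumes finA: "finite A" and finB: "finite B" and A_ne: "A \<noteq> {}" and D_pos: "D \<ge> 1"
begin

text \<open>The threshold is meant for up to \<open>2 * D\<close> vertices at density
  \<open>2 ^ (- \<delta>)\<close>: their expected share of common neighbours is at least
  \<open>2 ^ (- 2 * \<delta> * D)\<close>, and the remaining \<open>2 ^ (- D)\<close> is the slack
  that makes bad sets rare.\<close>

definition badset :: "'a set \<Rightarrow> bool" where
  "badset S \<longleftrightarrow> 2 ^ ((2 * \<delta> + 1) * D) * card (cnb adj B S) < card B"

definition NB :: "nat \<Rightarrow> 'a set \<Rightarrow> nat" where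
  "NB L S = card {q \<in> lsts A L. badset (S \<union> set q)}"

text \<open>A partial image \<open>S\<close> of a neighbourhood with \<open>L\<close> vertices still missing is good if few of its
  completions are bad. The factor \<open>(4 * D) ^ L\<close> leaves room for a loss of \<open>4 * D\<close> in each step.\<close>

definition good :: "nat \<Rightarrow> 'a set \<Rightarrow> bool" where
  "good L S \<longleftrightarrow> 2 * (4 * D) ^ L * NB L S \<le> card A ^ L"

lemma cardA_pos: "card A > 0"
  using finA A_ne by (simp add: card_gt_0_iff)

lemma badset_mono: "S \<subseteq> T \<Longrightarrow> badset S \<Longrightarrow> badset T"
proof -
  assume "S \<subseteq> T" "badset S"
  have "card (cnb adj B T) \<le> card (cnb adj B S)"
    using cnb_antimono[OF \<open>S \<subseteq> T\<close>, of adj B] finB by (simp add: card_mono)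
  with \<open>badset S\<close> show ?thesis unfolding badset_def
    by (meson le_less_trans mult_le_mono2)
qed

lemma NB_mono: "S \<subseteq> T \<Longrightarrow> NB L S \<le> NB L T"
  unfolding NB_def using badset_mono[of "S \<union> _" "T \<union> _"] finA
  by (intro card_mono) (auto simp: finite_lsts intro: badset_mono[rotated])

text \<open>All completions of a bad set are bad. The factor 2 in \<open>good\<close> makes this
  contradictory even for \<open>L = 0\<close>.\<close>

lemma good_not_bad:
  assumes "good L S" shows "\<not> badset S"
proof
  assume bad: "badset S"
  have "{q \<in> lsts A L. badset (S \<union> set q)} = lsts A L"
    using badset_mono[OF _ bad] by blast
  hence "NB L S = card A ^ L" by (simp add: NB_def card_lsts finA)
  with assms have "2 * (4 * D) ^ L * card A ^ L \<le> card A ^ L" by (simp add: good_def)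
  moreover have "(4 * D) ^ L \<ge> 1" using D_pos by simp
  hence "2 * card A ^ L \<le> 2 * (4 * D) ^ L * card A ^ L" by (intro mult_le_mono1) simp
  moreover have "card A ^ L > 0" using cardA_pos by simp
  ultimately show False by linarith
qed

lemma NB_Suc: "(\<Sum>a\<in>A. NB L (insert a S)) = NB (Suc L) S"
proof -
  have "{q \<in> lsts A (Suc L). badset (S \<union> set q)}
      = (\<lambda>(a, q). a # q) ` (SIGMA a:A. {q \<in> lsts A L. badset (insert a S \<union> set q)})"
    by (auto simp: lsts_def length_Suc_conv image_iff)
  hence "NB (Suc L) S = card (SIGMA a:A. {q \<in> lsts A L. badset (insert a S \<union> set q)})"
    unfolding NB_def by (simp add: card_image inj_on_def split: prod.splits)
  thus ?thesis using finA by (simp add: NB_def)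
qed

text \<open>Markov's inequality: by \<open>NB_Suc\<close> the bad completions of \<open>S\<close>
  are distributed among the choices of the next vertex \<open>a\<close>, and each \<open>a\<close>
  for which \<open>insert a S\<close> is not good takes a large share. The thresholds for
  \<open>Suc L\<close> and \<open>L\<close> differ by \<open>4 * D\<close>, which is the factor
  gained.\<close>

lemma good_step:
  assumes "good (Suc L) S"
  shows "4 * D * card {a \<in> A. \<not> good L (insert a S)} \<le> card A"
proof -
  define U where "U = {a \<in> A. \<not> good L (insert a S)}"
  have "card U * card A ^ L = (\<Sum>a\<in>U. card A ^ L)" by simp
  also have "\<dots> \<le> (\<Sum>a\<in>U. 2 * (4 * D) ^ L * NB L (insert a S))"
    by (intro sum_mono) (auto simp: U_def good_def)
  also have "\<dots> \<le> (\<Sum>a\<in>A. 2 * (4 * D) ^ L * NB L (insert a S))"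
    by (intro sum_mono2) (auto simp: U_def finA)
  also have "\<dots> = 2 * (4 * D) ^ L * NB (Suc L) S"
    by (simp add: NB_Suc sum_distrib_left[symmetric])
  finally have "4 * D * (card U * card A ^ L) \<le> 4 * D * (2 * (4 * D) ^ L * NB (Suc L) S)"
    by (rule mult_le_mono2)
  also have "\<dots> = 2 * (4 * D) ^ Suc L * NB (Suc L) S" by simp
  also have "\<dots> \<le> card A ^ Suc L" using assms by (simp add: good_def)
  finally have "(4 * D * card U) * card A ^ L \<le> card A * card A ^ L" by (simp add: mult.assoc)
  thus ?thesis using cardA_pos by (simp add: U_def)
qed

text \<open>When \<open>x\<close> is placed, each of its at most \<open>D\<close> neighbours forbids
  at most \<open>card A / (4 * D)\<close> vertices by \<open>good_step\<close>, and earlier images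
  occupy at most another \<open>card A / 4\<close>, so half of \<open>A\<close> remains. The first
  argument of \<open>good\<close> treats every neighbourhood as if it had \<open>D\<close> vertices;
  smaller ones end with a positive number of missing vertices, and \<open>good_not_bad\<close>
  applies to any number. Templates prescribe \<open>f0\<close>.\<close>

lemma extend_map:
  fixes h :: "'x \<Rightarrow> 'y \<Rightarrow> bool"
  assumes fin: "finite X" "finite Y" and X0: "X0 \<subseteq> X"
    and degX: "\<And>x. x \<in> X \<Longrightarrow> card {y\<in>Y. h x y} \<le> D"
    and degY: "\<And>y. y \<in> Y \<Longrightarrow> card {x\<in>X. h x y} \<le> D"
    and f0: "inj_on f0 X0" "f0 ` X0 \<subseteq> A"
    and g0: "\<And>y. y \<in> Y \<Longrightarrow> good (D - card {x\<in>X0. h x y}) (f0 ` {x\<in>X0. h x y})"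
    and size: "4 * card X \<le> card A"
  obtains f where "\<And>x. x \<in> X0 \<Longrightarrow> f x = f0 x" "inj_on f X" "f ` X \<subseteq> A"
    "\<And>y. y \<in> Y \<Longrightarrow> good (D - card {x\<in>X. h x y}) (f ` {x\<in>X. h x y})"
proof -
  have main: "\<exists>f. (\<forall>x\<in>X0. f x = f0 x) \<and> inj_on f (X0 \<union> Z) \<and> f ` (X0 \<union> Z) \<subseteq> A \<and>
     (\<forall>y\<in>Y. good (D - card {x\<in>X0 \<union> Z. h x y}) (f ` {x\<in>X0 \<union> Z. h x y}))"
    if "finite Z" "Z \<subseteq> X - X0" for Z
    using that
  proof (induction Z)
    case empty
    show ?case by (rule exI[of _ f0]) (use f0 g0 in auto)
  next
    case (insert x Z)
    define W where "W = X0 \<union> Z"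
    from insert obtain f where f: "\<forall>x\<in>X0. f x = f0 x" "inj_on f W" "f ` W \<subseteq> A"
      "\<forall>y\<in>Y. good (D - card {x\<in>W. h x y}) (f ` {x\<in>W. h x y})" unfolding W_def by blast
    have xW: "x \<in> X" "x \<notin> W" "W \<subseteq> X" using insert X0 by (auto simp: W_def)
    have finW: "finite W" using xW fin finite_subset by blast
    define Ny where "Ny = {y\<in>Y. h x y}"
    define L where "L = (\<lambda>y. D - card {x'\<in>insert x W. h x' y})"
    define bd where "bd = (\<lambda>y. {a \<in> A. \<not> good (L y) (insert a (f ` {x\<in>W. h x y}))})"
    have L: "D - card {x'\<in>W. h x' y} = Suc (L y)" if "y \<in> Ny" for y
    proof -
      have "{x'\<in>insert x W. h x' y} = insert x {x'\<in>W. h x' y}" using that by (auto simp: Ny_def)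
      hence "card {x'\<in>insert x W. h x' y} = Suc (card {x'\<in>W. h x' y})" using finW xW by simp
      moreover have "card {x'\<in>insert x W. h x' y} \<le> D"
        using degY[of y] that xW fin card_mono[of "{x\<in>X. h x y}" "{x'\<in>insert x W. h x' y}"]
        by (force simp: Ny_def)
      ultimately show ?thesis by (simp add: L_def)
    qed
    have bd: "4 * D * card (bd y) \<le> card A" if "y \<in> Ny" for y
      unfolding bd_def by (rule good_step) (use f(4) L[OF that] that in \<open>auto simp: Ny_def\<close>)
    have "4 * D * card (\<Union>y\<in>Ny. bd y) \<le> 4 * D * (\<Sum>y\<in>Ny. card (bd y))"
      by (intro mult_le_mono2 card_UN_le) (use fin in \<open>simp add: Ny_def\<close>)
    also have "\<dots> = (\<Sum>y\<in>Ny. 4 * D * card (bd y))" by (simp add: sum_distrib_left)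
    also have "\<dots> \<le> (\<Sum>y\<in>Ny. card A)" by (intro sum_mono bd)
    also have "\<dots> \<le> D * card A" using degX[OF xW(1)] by (simp add: Ny_def)
    finally have "4 * card (\<Union>y\<in>Ny. bd y) \<le> card A" using D_pos by simp
    moreover have "card (f ` W) \<le> card X" 
      using card_image_le[OF finW, of f] card_mono[OF fin(1) xW(3)] by simp
    ultimately have "4 * card (f ` W \<union> (\<Union>y\<in>Ny. bd y)) < 4 * card A"
      using card_Un_le[of "f ` W" "\<Union>y\<in>Ny. bd y"] size cardA_pos by linarith
    hence "\<not> A \<subseteq> f ` W \<union> (\<Union>y\<in>Ny. bd y)"
      using card_mono[of "f ` W \<union> (\<Union>y\<in>Ny. bd y)" A] finW fin finA by (auto simp: Ny_def bd_def)
    then obtain a where a: "a \<in> A" "a \<notin> f ` W" "\<And>y. y \<in> Ny \<Longrightarrow> a \<notin> bd y" by blast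
    let ?f = "f(x := a)"
    have fW: "?f ` {x'\<in>W. h x' y} = f ` {x'\<in>W. h x' y}" for y using xW by (auto simp: image_iff)
    have c4: "good (D - card {x'\<in>insert x W. h x' y}) (?f ` {x'\<in>insert x W. h x' y})" if "y \<in> Y" for y
    proof (cases "h x y")
      case True
      hence "{x'\<in>insert x W. h x' y} = insert x {x'\<in>W. h x' y}" by auto
      hence "?f ` {x'\<in>insert x W. h x' y} = insert (?f x) (?f ` {x'\<in>W. h x' y})"
        by (simp only: image_insert)
      hence "?f ` {x'\<in>insert x W. h x' y} = insert a (f ` {x\<in>W. h x y})"
        by (simp only: fW fun_upd_same)
      thus ?thesis using a True that by (simp add: bd_def Ny_def L_def)
    next
      case False
      hence "{x'\<in>insert x W. h x' y} = {x'\<in>W. h x' y}" by auto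
      thus ?thesis using f(4) that fW by simp
    qed
    have c2: "inj_on ?f (insert x W)" using f(2) a xW by (auto simp: inj_on_def)
    have c3: "?f ` insert x W \<subseteq> A" using f(3) a xW by auto
    have c1: "\<forall>x\<in>X0. ?f x = f0 x" using f(1) xW by (auto simp: W_def)
    have eqW: "X0 \<union> insert x Z = insert x W" by (auto simp: W_def)
    show ?case unfolding eqW by (intro exI[of _ ?f] conjI c1 c2 c3 ballI c4)
  qed
  have eq: "X0 \<union> (X - X0) = X" using X0 by blast
  obtain f where "\<forall>x\<in>X0. f x = f0 x" "inj_on f X" "f ` X \<subseteq> A"
     "\<forall>y\<in>Y. good (D - card {x\<in>X. h x y}) (f ` {x\<in>X. h x y})"
    using main[of "X - X0", unfolded eq, OF finite_Diff[OF fin(1)] subset_refl] by (elim exE conjE)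
  thus ?thesis by (intro that) auto
qed

text \<open>Since the image of its neighbourhood is not bad, each \<open>y\<close> has at least
  \<open>card Y\<close> candidates. Removing the values prescribed on \<open>Y1\<close> leaves at
  least \<open>card (Y - Y1)\<close> of them, enough for distinct representatives.\<close>

lemma extend_embedding:
  fixes h :: "'x \<Rightarrow> 'y \<Rightarrow> bool"
  assumes fin: "finite X" "finite Y" and Y1: "Y1 \<subseteq> Y"
    and f: "inj_on f X" "f ` X \<subseteq> A"
    and good: "\<And>y. y \<in> Y \<Longrightarrow> \<not> badset (f ` {x\<in>X. h x y})"
    and size: "2 ^ ((2 * \<delta> + 1) * D) * card Y \<le> card B"
    and g1: "inj_on g1 Y1" "\<And>y. y \<in> Y1 \<Longrightarrow> g1 y \<in> cnb adj B (f ` {x\<in>X. h x y})"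
  obtains g where "\<And>y. y \<in> Y1 \<Longrightarrow> g y = g1 y" "embeds h X Y adj A B f g"
    "\<And>y. y \<in> Y \<Longrightarrow> g y \<in> cnb adj B (f ` {x\<in>X. h x y})"
proof -
  define C where "C = (\<lambda>y. cnb adj B (f ` {x\<in>X. h x y}))"
  have Cge: "card Y \<le> card (C y)" if "y \<in> Y" for y
  proof -
    have "2 ^ ((2 * \<delta> + 1) * D) * card Y \<le> 2 ^ ((2 * \<delta> + 1) * D) * card (C y)"
      using good[OF that] size unfolding badset_def C_def by linarith
    thus ?thesis by (simp only: mult_le_cancel1) simp
  qed
  have finY1: "finite Y1" using Y1 fin finite_subset by blast
  have "card (Y - Y1) \<le> card (C y - g1 ` Y1)" if "y \<in> Y - Y1" for y
    using Cge[of y] that diff_card_le_card_Diff[of "g1 ` Y1" "C y"] finY1 card_image[OF g1(1)]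
      card_Diff_subset[OF finY1 Y1] by auto
  then obtain z where z: "inj_on z (Y - Y1)" "\<And>y. y \<in> Y - Y1 \<Longrightarrow> z y \<in> C y - g1 ` Y1"
    using system_of_distinct_representatives[of "Y - Y1" "\<lambda>y. C y - g1 ` Y1"] fin finB
    by (auto simp: C_def)
  define g where "g = (\<lambda>y. if y \<in> Y1 then g1 y else z y)"
  have gC: "g y \<in> C y" if "y \<in> Y" for y using that z g1 by (auto simp: g_def C_def)
  have "inj_on g Y"
  proof (rule inj_onI)
    fix y y' assume *: "y \<in> Y" "y' \<in> Y" "g y = g y'"
    have zg: "z u \<noteq> g1 w" if "u \<in> Y" "u \<notin> Y1" "w \<in> Y1" for u w
      using z(2)[of u] that by auto
    show "y = y'"
      using * zg[of y y'] zg[of y' y] inj_onD[OF z(1), of y y'] inj_onD[OF g1(1), of y y']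
      by (auto simp: g_def split: if_splits)
  qed
  moreover have "g ` Y \<subseteq> B" using gC cnb_subset[of adj B] unfolding C_def by blast
  moreover have "\<forall>x\<in>X. \<forall>y\<in>Y. h x y \<longrightarrow> adj (f x) (g y)"
    using gC unfolding C_def cnb_def by blast
  ultimately have "embeds h X Y adj A B f g" using f by (simp add: embeds_def)
  with gC that[of g] show ?thesis by (simp add: g_def C_def)
qed

end

text \<open>The factor is the square of \<open>2 ^ ((2 * \<delta> + 8) * D * D)\<close>. One root
  goes into the rarity of atypical \<open>D\<close>-tuples, the other into the rarity of bad
  completions of a typical one.\<close>

locale rich_host = host +
  assumes bad2: "2 ^ ((4 * \<delta> + 16) * D * D) * card {as \<in> lsts A (2 * D). badset (set as)} \<le> card A ^ (2 * D)"
begin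

text \<open>This is where the cost of order \<open>D ^ D\<close> of the greedy embedding is absorbed
  by an exponent quadratic in \<open>D\<close>.\<close>

lemma four_D_power: "2 * (4 * D) ^ D \<le> (2::nat) ^ (4 * D * D)"
proof -
  have "D \<le> 2 ^ D" by (simp add: less_imp_le)
  hence "4 * D \<le> 2 ^ (D + 2)" by simp
  hence "(4 * D) ^ D \<le> (2 ^ (D + 2)) ^ D" by (rule power_mono) simp
  hence "2 * (4 * D) ^ D \<le> 2 * 2 ^ ((D + 2) * D)" by (simp only: power_mult mult_le_mono2)
  also have "\<dots> = (2::nat) ^ ((D + 2) * D + 1)" by simp
  also have "\<dots> \<le> 2 ^ (4 * D * D)"
  proof (rule power_increasing)
    have "1 \<le> D * D" "D \<le> D * D" using D_pos by auto
    moreover have "(D + 2) * D + 1 = D * D + 2 * D + 1" "4 * D * D = 4 * (D * D)"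
      by (auto simp: algebra_simps)
    ultimately show "(D + 2) * D + 1 \<le> 4 * D * D" by linarith
  qed simp
  finally show ?thesis .
qed

lemma NB_D_sum: "(\<Sum>a\<in>lsts A D. NB D (set a)) = card {as \<in> lsts A (2 * D). badset (set as)}"
proof -
  let ?S = "(SIGMA a:lsts A D. {q \<in> lsts A D. badset (set a \<union> set q)})"
  have "{as \<in> lsts A (2 * D). badset (set as)}
     = (\<lambda>(a, q). a @ q) ` ?S"
    (is "?l = ?r")
  proof (intro equalityI subsetI)
    fix as assume "as \<in> ?l"
    hence "take D as \<in> lsts A D" "drop D as \<in> lsts A D" "set (take D as) \<union> set (drop D as) = set as"
      "badset (set as)"
      by (auto simp: lsts_def dest: in_set_takeD in_set_dropD simp flip: set_append)
    thus "as \<in> ?r" by (intro image_eqI[of _ _ "(take D as, drop D as)"]) auto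
  qed (auto simp: lsts_def)
  moreover have "inj_on (\<lambda>(a, q). a @ q) ?S"
    by (auto simp: inj_on_def lsts_def)
  ultimately have "card {as \<in> lsts A (2 * D). badset (set as)}
     = card ?S"
    by (simp add: card_image)
  thus ?thesis using finA by (simp add: NB_def finite_lsts)
qed

text \<open>A bad \<open>D\<close>-tuple spoils all its extensions to \<open>2 * D\<close> entries,
  so bad \<open>D\<close>-tuples are no more frequent than bad \<open>2 * D\<close>-tuples.\<close>

lemma bad_D: "2 ^ ((4 * \<delta> + 16) * D * D) * NB D {} \<le> card A ^ D"
proof -
  have "NB D {} * card A ^ D = (\<Sum>a\<in>{a \<in> lsts A D. badset (set a)}. card A ^ D)"
    by (simp add: NB_def)
  also have "\<dots> = (\<Sum>a\<in>{a \<in> lsts A D. badset (set a)}. NB D (set a))"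
  proof (rule sum.cong)
    fix a assume "a \<in> {a \<in> lsts A D. badset (set a)}"
    hence "{q \<in> lsts A D. badset (set a \<union> set q)} = lsts A D" using badset_mono by blast
    thus "card A ^ D = NB D (set a)" by (simp add: NB_def card_lsts finA)
  qed simp
  also have "\<dots> \<le> (\<Sum>a\<in>lsts A D. NB D (set a))"
    by (intro sum_mono2) (auto simp: finA finite_lsts)
  also note NB_D_sum
  finally have "2 ^ ((4 * \<delta> + 16) * D * D) * (NB D {} * card A ^ D) \<le> card A ^ (2 * D)"
    using bad2 by (meson le_trans mult_le_mono2)
  hence "(2 ^ ((4 * \<delta> + 16) * D * D) * NB D {}) * card A ^ D \<le> card A ^ D * card A ^ D"
    by (simp add: mult_2 power_add mult.assoc)
  thus ?thesis using cardA_pos by simp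
qed

lemma good_empty: "good D {}"
proof -
  have "2 * (4 * D) ^ D \<le> (2::nat) ^ ((4 * \<delta> + 16) * D * D)"
    using four_D_power by (rule le_trans) (intro power_increasing mult_le_mono, auto)
  hence "2 * (4 * D) ^ D * NB D {} \<le> 2 ^ ((4 * \<delta> + 16) * D * D) * NB D {}" by (rule mult_le_mono1)
  with bad_D show ?thesis unfolding good_def by (rule le_trans[rotated])
qed

end

lemma rich_host_exists:
  fixes adj :: "'a \<Rightarrow> 'b \<Rightarrow> bool"
  assumes fin: "finite A0" "finite B0" and ne: "A0 \<noteq> {}" "B0 \<noteq> {}" and D: "D \<ge> 1"
    and deg: "\<And>b. b \<in> B0 \<Longrightarrow> card A0 \<le> 2 ^ \<delta> * card {a \<in> A0. adj a b}"
  obtains A where "A \<subseteq> A0" "rich_host adj A B0 \<delta> D" "card A0 \<le> 2 ^ (\<delta> * (4 * \<delta> + 17) * D + 1) * card A"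
proof -
  \<comment> \<open>The gain over \<open>t\<close> samples is
    \<open>(2 * \<delta> + 1) * D * t - \<delta> * (2 * D * t) = D * t\<close> in the exponent. This
    choice makes it \<open>(4 * \<delta> + 16) * D * D\<close> plus a surplus \<open>D * D\<close>
    that pays for the factor 2 in \<open>par\<close>, while the host shrinks by
    \<open>2 ^ (\<delta> * t + 1)\<close>, still exponential in \<open>D\<close> only.\<close>
  define t where "t = (4 * \<delta> + 17) * D"
  define \<epsilon> :: real where "\<epsilon> = (1/2) ^ ((4 * \<delta> + 16) * D * D)"
  define \<theta> :: real where "\<theta> = (1/2) ^ ((2 * \<delta> + 1) * D)"
  have par: "2 * \<theta> ^ t \<le> \<epsilon> * ((1/2) ^ \<delta>) ^ (2 * D * t)"
  proof -
    have "(4 * \<delta> + 16) * D * D + \<delta> * (2 * D * t) + D * D = (2 * \<delta> + 1) * D * t"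
      by (simp add: t_def algebra_simps)
    moreover have "D * D \<ge> 1" using D by simp
    ultimately have "(4 * \<delta> + 16) * D * D + \<delta> * (2 * D * t) + 1 \<le> (2 * \<delta> + 1) * D * t" by linarith
    hence "(1/2::real) ^ ((2 * \<delta> + 1) * D * t) \<le> (1/2) ^ ((4 * \<delta> + 16) * D * D + \<delta> * (2 * D * t) + 1)"
      by (intro power_decreasing) auto
    hence "2 * (1/2::real) ^ ((2 * \<delta> + 1) * D * t) \<le> (1/2) ^ ((4 * \<delta> + 16) * D * D + \<delta> * (2 * D * t))"
      by simp
    thus ?thesis unfolding \<epsilon>_def \<theta>_def by (simp only: power_mult[symmetric] power_add[symmetric])
  qed
  have deg': "(1/2) ^ \<delta> * card A0 \<le> real (card {a \<in> A0. adj a b})" if "b \<in> B0" for b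
  proof -
    have "real (card A0) \<le> real (2 ^ \<delta> * card {a \<in> A0. adj a b})"
      using deg[OF that] by (simp only: of_nat_le_iff)
    thus ?thesis by (simp add: power_one_over divide_le_eq mult.commute)
  qed
  obtain A where A: "A \<subseteq> A0" "A \<noteq> {}" "((1/2) ^ \<delta>) ^ t / 2 * card A0 \<le> card A"
    "card {as \<in> lsts A (2 * D). card (cnb adj B0 (set as)) < \<theta> * card B0} \<le> \<epsilon> * card A ^ (2 * D)"
    by (rule dependent_random_choice[OF fin ne deg' _ _ _ _ par]) (use D in \<open>auto simp: \<epsilon>_def \<theta>_def intro!: power_le_one\<close>)
  interpret host adj A B0 \<delta> D
    by unfold_locales (use A fin D finite_subset in auto)
  have bad: "badset S \<longleftrightarrow> card (cnb adj B0 S) < \<theta> * card B0" for S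
  proof -
    have "badset S \<longleftrightarrow> real (2 ^ ((2 * \<delta> + 1) * D) * card (cnb adj B0 S)) < real (card B0)"
      unfolding badset_def of_nat_less_iff ..
    also have "\<dots> \<longleftrightarrow> card (cnb adj B0 S) < \<theta> * card B0"
      by (simp add: \<theta>_def power_one_over less_divide_eq mult.commute)
    finally show ?thesis .
  qed
  have "real (2 ^ ((4 * \<delta> + 16) * D * D) * card {as \<in> lsts A (2 * D). badset (set as)}) \<le> real (card A ^ (2 * D))"
    using A(4) unfolding bad by (simp add: \<epsilon>_def power_one_over le_divide_eq mult.commute)
  hence "rich_host adj A B0 \<delta> D"
    by unfold_locales (simp only: of_nat_le_iff)
  moreover have "card A0 \<le> 2 ^ (\<delta> * (4 * \<delta> + 17) * D + 1) * card A"
  proof -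
    have "real (card A0) \<le> 2 ^ (\<delta> * t + 1) * real (card A)"
      using A(3) by (simp add: power_one_over power_mult divide_le_eq mult.commute mult.left_commute)
    hence "real (card A0) \<le> real (2 ^ (\<delta> * t + 1) * card A)" by simp
    thus ?thesis unfolding of_nat_le_iff t_def by (simp add: mult.assoc)
  qed
  ultimately show ?thesis using that A(1) by blast
qed

lemma embedding_exists:
  fixes adj :: "'a \<Rightarrow> 'b \<Rightarrow> bool" and h :: "'x \<Rightarrow> 'y \<Rightarrow> bool"
  assumes fin: "finite A0" "finite B0" and D: "D \<ge> 1" and m: "m \<ge> 1"
    and deg: "\<And>b. b \<in> B0 \<Longrightarrow> card A0 \<le> 2 ^ \<delta> * card {a \<in> A0. adj a b}"
    and h: "bounded_bip h X Y D m"
    and size: "m * 2 ^ ((\<delta> * (4 * \<delta> + 17) + 2 * \<delta> + 4) * D) \<le> card A0"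
      "m * 2 ^ ((\<delta> * (4 * \<delta> + 17) + 2 * \<delta> + 4) * D) \<le> card B0"
  obtains f g where "embeds h X Y adj A0 B0 f g"
proof -
  have ne: "A0 \<noteq> {}" "B0 \<noteq> {}" using size m by auto
  obtain A where A: "A \<subseteq> A0" "rich_host adj A B0 \<delta> D"
      "card A0 \<le> 2 ^ (\<delta> * (4 * \<delta> + 17) * D + 1) * card A"
    using rich_host_exists[OF fin ne D deg] .
  interpret rich_host adj A B0 \<delta> D by fact
  note h' = h[unfolded bounded_bip_def]
  have "2 ^ (\<delta> * (4 * \<delta> + 17) * D + 1) * (4 * m) = m * 2 ^ (\<delta> * (4 * \<delta> + 17) * D + 3)"
    by (simp add: power_add)
  also have "\<dots> \<le> m * 2 ^ ((\<delta> * (4 * \<delta> + 17) + 2 * \<delta> + 4) * D)"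
  proof (intro mult_le_mono2 power_increasing)
    have "4 * 1 \<le> (2 * \<delta> + 4) * D" using D by (intro mult_le_mono) auto
    thus "\<delta> * (4 * \<delta> + 17) * D + 3 \<le> (\<delta> * (4 * \<delta> + 17) + 2 * \<delta> + 4) * D"
      by (simp add: add_mult_distrib)
  qed simp
  also have "\<dots> \<le> 2 ^ (\<delta> * (4 * \<delta> + 17) * D + 1) * card A" using size(1) A(3) by (rule le_trans)
  finally have sA: "4 * card X \<le> card A" using h' by simp
  have "2 ^ ((2 * \<delta> + 1) * D) * m \<le> 2 ^ ((\<delta> * (4 * \<delta> + 17) + 2 * \<delta> + 4) * D) * m"
    by (intro mult_le_mono1 power_increasing) auto
  also have "\<dots> = m * 2 ^ ((\<delta> * (4 * \<delta> + 17) + 2 * \<delta> + 4) * D)" by (rule mult.commute)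
  also note size(2)
  finally have sB: "2 ^ ((2 * \<delta> + 1) * D) * card Y \<le> card B0" using h' by simp
  obtain f where f: "inj_on f X" "f ` X \<subseteq> A" "\<And>y. y \<in> Y \<Longrightarrow> good (D - card {x\<in>X. h x y}) (f ` {x\<in>X. h x y})"
    by (rule extend_map[of X Y "{}" h undefined]) (use h' sA good_empty in auto)
  obtain g where "embeds h X Y adj A B0 f g"
    by (rule extend_embedding[of X Y "{}" f h undefined]) (use h' sB f good_not_bad[OF f(3)] in auto)
  hence "embeds h X Y adj A0 B0 f g" using A(1) by (auto simp: embeds_def)
  thus ?thesis by (rule that)
qed

subsection \<open>Templates that allow exchanging vertices\<close>

text \<open>Derandomised sequential sampling. If each \<open>s j\<close> were drawn uniformly from
  \<open>S U\<close>, with \<open>U\<close> the earlier draws, a weight that is halved at each hit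
  would shrink in expectation by at least the factor \<open>1 - p / 2\<close> per round. Some draw
  does at least as well as the average, so the total weight over \<open>I\<close> can be kept below
  the bound, and each single weight is at most the total.\<close>

lemma potential_choice:
  fixes S :: "'s set \<Rightarrow> 's set" and hit :: "'i \<Rightarrow> 's \<Rightarrow> bool" and p :: real
  assumes I: "finite I" and p: "p \<le> 1"
    and fin: "\<And>U. finite U \<Longrightarrow> card U < K \<Longrightarrow> finite (S U)"
    and ne: "\<And>U. finite U \<Longrightarrow> card U < K \<Longrightarrow> S U \<noteq> {}"
    and hit: "\<And>U i. finite U \<Longrightarrow> card U < K \<Longrightarrow> i \<in> I \<Longrightarrow> p * card (S U) \<le> card {s \<in> S U. hit i s}"
  obtains s where "\<And>j. j < K \<Longrightarrow> s j \<in> S (s ` {..<j})"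
    "\<And>i. i \<in> I \<Longrightarrow> (1/2) ^ card {j\<in>{..<K}. hit i (s j)} \<le> card I * (1 - p / 2) ^ K"
proof -
  have "\<exists>s. (\<forall>j<k. s j \<in> S (s ` {..<j})) \<and>
     (\<Sum>i\<in>I. (1/2::real) ^ card {j\<in>{..<k}. hit i (s j)}) \<le> card I * (1 - p / 2) ^ k" if "k \<le> K" for k
    using that
  proof (induction k)
    case 0
    show ?case by simp
  next
    case (Suc k)
    then obtain s where s: "\<forall>j<k. s j \<in> S (s ` {..<j})"
      "(\<Sum>i\<in>I. (1/2::real) ^ card {j\<in>{..<k}. hit i (s j)}) \<le> card I * (1 - p / 2) ^ k" by auto
    define U where "U = s ` {..<k}"
    have U: "finite U" "card U < K"
      using card_image_le[of "{..<k}" s] Suc.prems by (auto simp: U_def)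
    define T where "T = S U"
    note T = fin[OF U, folded T_def] ne[OF U, folded T_def] hit[OF U, folded T_def]
    define w where "w = (\<lambda>i. (1/2::real) ^ card {j\<in>{..<k}. hit i (s j)})"
    define W where "W = (\<lambda>x. \<Sum>i\<in>I. w i * (if hit i x then 1/2 else 1))"
    have inner: "(\<Sum>x\<in>T. if hit i x then 1/2 else 1) \<le> (1 - p / 2) * card T" if "i \<in> I" for i
    proof -
      have "(\<Sum>x\<in>T. if hit i x then 1/2 else 1::real) = (\<Sum>x\<in>T. 1 - (if hit i x then 1/2 else 0))"
        by (intro sum.cong) auto
      also have "\<dots> = card T - (\<Sum>x\<in>T. if hit i x then 1/2 else 0)"
        by (simp add: sum_subtractf)
      also have "(\<Sum>x\<in>T. if hit i x then 1/2 else 0::real) = (\<Sum>x\<in>{x\<in>T. hit i x}. 1/2)"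
        by (rule sum.inter_filter[symmetric, OF T(1)])
      finally show ?thesis using T(3)[OF that] by (simp add: algebra_simps)
    qed
    have "(\<Sum>x\<in>T. W x) = (\<Sum>i\<in>I. w i * (\<Sum>x\<in>T. if hit i x then 1/2 else 1))"
      unfolding W_def by (subst sum.swap) (simp add: sum_distrib_left)
    also have "\<dots> \<le> (\<Sum>i\<in>I. w i * ((1 - p / 2) * card T))"
      by (intro sum_mono mult_left_mono inner) (auto simp: w_def)
    also have "\<dots> = (1 - p / 2) * (\<Sum>i\<in>I. w i) * card T"
      by (simp add: sum_distrib_left sum_distrib_right mult_ac)
    also have "\<dots> \<le> (1 - p / 2) * (card I * (1 - p / 2) ^ k) * card T"
      using s(2) p by (intro mult_right_mono mult_left_mono) (auto simp: w_def)
    also have "\<dots> = (\<Sum>x\<in>T. card I * (1 - p / 2) ^ Suc k)" by (simp add: mult_ac)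
    finally obtain x where x: "x \<in> T" "W x \<le> card I * (1 - p / 2) ^ Suc k"
      using sum_strict_mono[OF T(1,2), of "\<lambda>_. card I * (1 - p / 2) ^ Suc k" W] by (meson not_le)
    let ?s = "s(k := x)"
    have img: "?s ` {..<j} = s ` {..<j}" if "j \<le> k" for j using that by (auto simp: image_iff)
    have "\<forall>j<Suc k. ?s j \<in> S (?s ` {..<j})"
    proof (intro allI impI)
      fix j assume "j < Suc k"
      hence "?s ` {..<j} = s ` {..<j}" "j = k \<or> j < k" using img by auto
      thus "?s j \<in> S (?s ` {..<j})" using s(1) x(1) unfolding T_def U_def by (elim disjE) simp_all
    qed
    moreover have "(1/2::real) ^ card {j\<in>{..<Suc k}. hit i (?s j)} = w i * (if hit i x then 1/2 else 1)" for i
    proof -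
      have "{j\<in>{..<Suc k}. hit i (?s j)} = (if hit i x then insert k else id) {j\<in>{..<k}. hit i (s j)}"
        by (auto simp: less_Suc_eq)
      thus ?thesis by (simp add: w_def)
    qed
    ultimately show ?case using x(2) unfolding W_def by (intro exI[of _ ?s]) simp
  qed
  from this[of K] obtain s where s: "\<forall>j<K. s j \<in> S (s ` {..<j})"
    "(\<Sum>i\<in>I. (1/2::real) ^ card {j\<in>{..<K}. hit i (s j)}) \<le> card I * (1 - p / 2) ^ K" by auto
  have "(1/2::real) ^ card {j\<in>{..<K}. hit i (s j)} \<le> card I * (1 - p / 2) ^ K" if "i \<in> I" for i
    using member_le_sum[OF that, of "\<lambda>i. (1/2::real) ^ card {j\<in>{..<K}. hit i (s j)}"] I s(2) by simp
  with s(1) that show ?thesis by blast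
qed

text \<open>All of \<open>E\<close> is replaced at once. A bijection assigns a new vertex to every
  slot \<open>s\<close> that is vacated, and \<open>hits\<close> offers at least
  \<open>card E\<close> intermediate slots to each such pair, hence distinct ones. They come from
  \<open>YII\<close>, so no intermediate slot is itself vacated by \<open>E\<close>.\<close>

lemma exchange:
  assumes emb: "embeds h X Y adj A B f g" and fin: "finite Y" "finite Q"
    and YI: "YI \<subseteq> Y" "YII \<subseteq> Y" "YI \<inter> YII = {}"
    and E: "E \<subseteq> g ` YI" "card Q = card E" "Q \<inter> g ` Y = {}"
    and hits: "\<And>q s. q \<in> Q \<Longrightarrow> s \<in> YI \<Longrightarrow> card E \<le>
      card {z\<in>YII. (\<forall>x\<in>X. h x z \<longrightarrow> adj (f x) q) \<and> (\<forall>x\<in>X. h x s \<longrightarrow> adj (f x) (g z))}"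
  obtains g' where "embeds h X Y adj A (B \<union> Q) f g'" "g' ` Y = (g ` Y - E) \<union> Q"
proof -
  note emb' = emb[unfolded embeds_def]
  define YE where "YE = {s\<in>YI. g s \<in> E}"
  have YE: "YE \<subseteq> Y" "YE \<subseteq> YI" "finite YE" using YI fin finite_subset[of YE Y] by (auto simp: YE_def)
  have gYE: "g ` YE = E" using E by (auto simp: YE_def)
  have cYE: "card YE = card E"
    using card_image[OF inj_on_subset[OF _ YE(1)], of g] emb' gYE by simp
  obtain \<phi> where \<phi>: "bij_betw \<phi> YE Q"
    using finite_same_card_bij[OF YE(3) fin(2)] cYE E by auto
  define S where "S = (\<lambda>s. {z\<in>YII. (\<forall>x\<in>X. h x z \<longrightarrow> adj (f x) (\<phi> s)) \<and> (\<forall>x\<in>X. h x s \<longrightarrow> adj (f x) (g z))})"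
  have \<phi>Q: "\<phi> s \<in> Q" if "s \<in> YE" for s using \<phi> that by (auto simp: bij_betw_def)
  obtain z where z: "inj_on z YE" "\<And>s. s \<in> YE \<Longrightarrow> z s \<in> S s"
  proof (rule system_of_distinct_representatives[of YE S])
    show "finite (S j)" for j using YI fin finite_subset[of YII Y] by (auto simp: S_def)
    show "card YE \<le> card (S j)" if "j \<in> YE" for j
      unfolding S_def cYE using hits[OF \<phi>Q[OF that], of j] that YE by auto
  qed (use YE in auto)
  have zY: "z ` YE \<subseteq> YII" using z by (auto simp: S_def)
  have disj: "y \<notin> YE" if "y \<in> z ` YE" for y using that zY YE(2) YI(3) by blast
  define g' where "g' = (\<lambda>y. if y \<in> YE then g (z y) else if y \<in> z ` YE then \<phi> (the_inv_into YE z y) else g y)"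
  have g'z: "g' (z s) = \<phi> s" if "s \<in> YE" for s
    using that disj[of "z s"] the_inv_into_f_f[OF z(1) that] by (auto simp: g'_def)
  have "g' ` YE = g ` z ` YE" by (auto simp: g'_def image_image)
  moreover have "g' ` z ` YE = Q" using g'z \<phi> by (auto simp: bij_betw_def image_iff)
  moreover have "g' ` (Y - YE - z ` YE) = g ` (Y - YE - z ` YE)" by (auto simp: g'_def)
  moreover have "Y = YE \<union> z ` YE \<union> (Y - YE - z ` YE)" using YE zY YI by auto
  ultimately have "g' ` Y = g ` z ` YE \<union> Q \<union> g ` (Y - YE - z ` YE)" by (metis image_Un)
  also have "\<dots> = g ` (Y - YE) \<union> Q" using zY YI disj by blast
  also have "g ` (Y - YE) = g ` Y - E" using emb' YE gYE inj_on_image_set_diff[of g Y Y YE] by auto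
  finally have img: "g' ` Y = (g ` Y - E) \<union> Q" .
  have EY: "E \<subseteq> g ` Y" using E(1) YI(1) by blast
  have finE: "finite E" using EY fin finite_subset by blast
  \<comment> \<open>Injectivity follows by counting: the image has as many elements as
    \<open>Y\<close>.\<close>
  have "card (g' ` Y) = card (g ` Y - E) + card Q"
    unfolding img using E fin by (intro card_Un_disjoint) auto
  also have "\<dots> = card (g ` Y)" using EY finE fin E(2) card_mono[OF _ EY]
    by (simp add: card_Diff_subset)
  also have "\<dots> = card Y" using emb' card_image by blast
  finally have inj: "inj_on g' Y" using fin eq_card_imp_inj_on by blast
  have adjs: "adj (f x) (g' y)" if xy: "x \<in> X" "y \<in> Y" "h x y" for x y
  proof -
    consider "y \<in> YE" | s where "s \<in> YE" "y = z s" | "y \<notin> YE" "y \<notin> z ` YE" by blast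
    thus ?thesis
    proof cases
      case 1
      thus ?thesis using z(2)[of y] xy by (auto simp: g'_def S_def)
    next
      case 2
      thus ?thesis using z(2)[of s] xy g'z by (auto simp: S_def)
    next
      case 3
      thus ?thesis using emb' xy by (auto simp: g'_def)
    qed
  qed
  have "embeds h X Y adj A (B \<union> Q) f g'"
    using emb' inj img adjs by (auto simp: embeds_def)
  thus ?thesis using img by (rule that)
qed

text \<open>Pick a vertex, discard it together with its at most \<open>M\<close> neighbours, and
  repeat.\<close>

lemma independent_subset:
  assumes "finite Y" "\<And>y. y \<in> Y \<Longrightarrow> card {y'\<in>Y. R y y'} \<le> M" "\<And>y y'. R y y' \<Longrightarrow> R y' y"
  obtains S where "S \<subseteq> Y" "\<And>s s'. s \<in> S \<Longrightarrow> s' \<in> S \<Longrightarrow> s \<noteq> s' \<Longrightarrow> \<not> R s s'" "card Y \<le> (M + 1) * card S"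
proof -
  have "\<exists>S\<subseteq>Z. (\<forall>s\<in>S. \<forall>s'\<in>S. s \<noteq> s' \<longrightarrow> \<not> R s s') \<and> card Z \<le> (M + 1) * card S"
    if "finite Z" "Z \<subseteq> Y" for Z
    using that
  proof (induction "card Z" arbitrary: Z rule: less_induct)
    case less
    show ?case
    proof (cases "Z = {}")
      case False
      then obtain y where y: "y \<in> Z" by auto
      define Z' where "Z' = Z - insert y {y'\<in>Y. R y y'}"
      have "card Z' < card Z" using y less.prems by (intro psubset_card_mono) (auto simp: Z'_def)
      with less.hyps[of Z'] less.prems obtain S where S: "S \<subseteq> Z'" "\<forall>s\<in>S. \<forall>s'\<in>S. s \<noteq> s' \<longrightarrow> \<not> R s s'"
        "card Z' \<le> (M + 1) * card S" by (auto simp: Z'_def)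
      have "card Z \<le> card (Z' \<union> insert y {y'\<in>Y. R y y'})"
        using less.prems assms(1) by (intro card_mono) (auto simp: Z'_def)
      also have "\<dots> \<le> card Z' + card (insert y {y'\<in>Y. R y y'})" by (rule card_Un_le)
      also have "card (insert y {y'\<in>Y. R y y'}) \<le> M + 1"
        using assms(1) assms(2)[of y] y less.prems by (auto simp: card_insert_if)
      finally have "card Z \<le> (M + 1) * (card S + 1)" using S(3) by simp
      moreover have "finite S" "y \<notin> S" using S(1) less.prems finite_subset[of S Z] by (auto simp: Z'_def)
      ultimately have "card Z \<le> (M + 1) * card (insert y S)" by simp
      moreover have "insert y S \<subseteq> Z" using S(1) y by (auto simp: Z'_def)
      moreover have "\<forall>s\<in>insert y S. \<forall>s'\<in>insert y S. s \<noteq> s' \<longrightarrow> \<not> R s s'"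
      proof (intro ballI impI)
        fix s s' assume *: "s \<in> insert y S" "s' \<in> insert y S" "s \<noteq> s'"
        have "\<not> R y u" if "u \<in> S" for u using that S(1) less.prems by (auto simp: Z'_def)
        thus "\<not> R s s'" using * S(2) assms(3)[of s s'] by auto
      qed
      ultimately show ?thesis by blast
    qed auto
  qed
  from this[OF assms(1) subset_refl] that show ?thesis by blast
qed

text \<open>This is a walk \<open>s\<close>, \<open>x\<close>, \<open>y\<close>, \<open>x'\<close>,
  \<open>s'\<close> of length 4. If chosen slots are pairwise not close, no vertex of
  \<open>Y\<close> is adjacent to the neighbourhoods of two of them, and (taking
  \<open>y = s\<close>) these neighbourhoods are disjoint.\<close>

definition close where
  "close h X Y s s' \<longleftrightarrow> (\<exists>y\<in>Y. \<exists>x\<in>X. \<exists>x'\<in>X. h x y \<and> h x s \<and> h x' y \<and> h x' s')"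

lemma far_subset:
  assumes h: "bounded_bip h X Y D m"
  obtains S where "S \<subseteq> Y" "\<forall>s\<in>S. \<forall>s'\<in>S. s \<noteq> s' \<longrightarrow> \<not> close h X Y s s'"
    "m \<le> (D ^ 4 + 1) * card S"
proof -
  note h' = h[unfolded bounded_bip_def]
  define nx where "nx = (\<lambda>y. {x\<in>X. h x y})"
  define ny where "ny = (\<lambda>x. {y\<in>Y. h x y})"
  have fin: "finite X" "finite Y" using h' by auto
  have fnx: "finite (nx y)" and fny: "finite (ny x)" for x y using fin by (auto simp: nx_def ny_def)
  have two: "card (\<Union>x\<in>nx s. ny x) \<le> D * D" if "s \<in> Y" for s
  proof -
    have "card (\<Union>x\<in>nx s. ny x) \<le> (\<Sum>x\<in>nx s. card (ny x))" by (rule card_UN_le[OF fnx])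
    also have "\<dots> \<le> (\<Sum>x\<in>nx s. D)" using h' by (intro sum_mono) (auto simp: ny_def nx_def)
    also have "\<dots> \<le> D * D" using h' that by (auto simp: nx_def)
    finally show ?thesis .
  qed
  have few: "card {s'\<in>Y. close h X Y s s'} \<le> D ^ 4" if "s \<in> Y" for s
  proof -
    have "{s'\<in>Y. close h X Y s s'} \<subseteq> (\<Union>y\<in>(\<Union>x\<in>nx s. ny x). \<Union>x\<in>nx y. ny x)"
      by (auto simp: close_def nx_def ny_def)
    hence "card {s'\<in>Y. close h X Y s s'} \<le> card (\<Union>y\<in>(\<Union>x\<in>nx s. ny x). \<Union>x\<in>nx y. ny x)"
      by (intro card_mono) (auto simp: fnx fny)
    also have "\<dots> \<le> (\<Sum>y\<in>(\<Union>x\<in>nx s. ny x). card (\<Union>x\<in>nx y. ny x))"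
      by (rule card_UN_le) (auto simp: fnx fny)
    also have "\<dots> \<le> (\<Sum>y\<in>(\<Union>x\<in>nx s. ny x). D * D)"
      by (intro sum_mono two) (auto simp: ny_def)
    also have "\<dots> \<le> (D * D) * (D * D)" using two[OF that] by simp
    finally show ?thesis by (simp add: numeral_eq_Suc mult.assoc)
  qed
  have sym: "close h X Y s s' \<Longrightarrow> close h X Y s' s" for s s' by (auto simp: close_def)
  show ?thesis
  proof (rule independent_subset[of Y "close h X Y" "D ^ 4", OF fin(2) few sym])
    fix S assume "S \<subseteq> Y" "\<And>s s'. s \<in> S \<Longrightarrow> s' \<in> S \<Longrightarrow> s \<noteq> s' \<Longrightarrow> \<not> close h X Y s s'"
      "card Y \<le> (D ^ 4 + 1) * card S"
    thus ?thesis by (intro that[of S]) (use h' in auto)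
  qed
qed

section \<open>Typical tuples and stars\<close>

context rich_host
begin

text \<open>A vertex that is not high is a common neighbour of less than a share
  \<open>2 ^ (- (2 * \<delta> + 4) * D)\<close> of all \<open>D\<close>-tuples. This is so far below
  the threshold \<open>2 ^ (- (2 * \<delta> + 1) * D)\<close> in \<open>badset\<close> that such
  vertices cannot make up most of the common neighbourhoods.\<close>

definition high :: "'b \<Rightarrow> bool" where
  "high b \<longleftrightarrow> card A \<le> 2 ^ (2 * \<delta> + 4) * card {a \<in> A. adj a b}"

text \<open>The tuple is to carry the neighbourhood of a slot: distinct entries permit an injective
  placement, and rarity of bad completions is needed both for extending the map greedily and for
  combining the tuple with a second one in an exchange.\<close>

definition typical :: "'a list \<Rightarrow> bool" where
  "typical a \<longleftrightarrow> a \<in> lsts A D \<and> distinct a \<and> 2 ^ ((2 * \<delta> + 8) * D * D) * NB D (set a) \<le> card A ^ D"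

definition avail :: "'a set \<Rightarrow> 'a list set" where
  "avail U = {a. typical a \<and> set a \<inter> U = {}}"

lemma finite_avail: "finite (avail U)"
  by (rule finite_subset[of _ "lsts A D"]) (use finA in \<open>auto simp: avail_def typical_def finite_lsts\<close>)

lemma avail_subset: "avail U \<subseteq> lsts A D"
  by (auto simp: avail_def typical_def)

text \<open>Appending arbitrary vertices keeps a bad completion bad, so the share of bad completions
  of length \<open>L\<close> is at most that of length \<open>D\<close>, and enlarging
  \<open>S\<close> to \<open>set a\<close> can only raise it. The bound in \<open>typical\<close>
  has room for the factor \<open>2 * (4 * D) ^ L\<close> by \<open>four_D_power\<close>.\<close>

lemma typical_good_subset:
  assumes "typical a" "S \<subseteq> set a"
  shows "good (D - card S) S"
proof -
  have cS: "card S \<le> D"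
    using card_mono[OF finite_set assms(2)] card_length[of a] assms(1) by (simp add: typical_def lsts_def)
  define L where "L = D - card S"
  have inj: "NB L S * card A ^ card S \<le> NB D S"
  proof -
    have i2: "(\<lambda>(q, p). q @ p) ` ({q \<in> lsts A L. badset (S \<union> set q)} \<times> lsts A (card S))
        \<subseteq> {q \<in> lsts A D. badset (S \<union> set q)}"
      using cS by (auto simp: lsts_def L_def intro: badset_mono[rotated])
    have i1: "inj_on (\<lambda>(q, p). q @ p) ({q \<in> lsts A L. badset (S \<union> set q)} \<times> lsts A (card S))"
      by (auto simp: inj_on_def lsts_def)
    have "card ({q \<in> lsts A L. badset (S \<union> set q)} \<times> lsts A (card S)) \<le> NB D S"
      unfolding NB_def by (rule card_inj_on_le[OF i1 i2]) (simp add: finA)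
    thus ?thesis using finA by (simp add: card_cartesian_product card_lsts NB_def)
  qed
  have "2 * (4 * D) ^ L \<le> 2 * (4 * D) ^ D"
    using D_pos by (intro mult_le_mono2 power_increasing) (auto simp: L_def)
  also have "\<dots> \<le> 2 ^ (4 * D * D)" by (rule four_D_power)
  also have "\<dots> \<le> 2 ^ ((2 * \<delta> + 8) * D * D)" by (intro power_increasing mult_le_mono) auto
  finally have "2 * (4 * D) ^ L * (NB L S * card A ^ card S) \<le> 2 ^ ((2 * \<delta> + 8) * D * D) * NB D (set a)"
    using inj NB_mono[OF assms(2), of D] by (intro mult_le_mono) auto
  also have "\<dots> \<le> card A ^ D" using assms(1) by (simp add: typical_def)
  also have "\<dots> = card A ^ L * card A ^ card S" using cS by (simp add: L_def power_add[symmetric])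
  finally have "(2 * (4 * D) ^ L * NB L S) * card A ^ card S \<le> card A ^ L * card A ^ card S"
    by (simp only: mult.assoc)
  thus ?thesis using cardA_pos by (simp add: good_def L_def)
qed

lemma typical_not_bad: "typical a \<Longrightarrow> \<not> badset (set a)"
  using typical_good_subset[of a "set a"] good_not_bad by blast

text \<open>Markov's inequality over the first halves of \<open>2 * D\<close>-tuples.\<close>

lemma few_atypical:
  "2 ^ ((2 * \<delta> + 8) * D * D) * card {a \<in> lsts A D. \<not> 2 ^ ((2 * \<delta> + 8) * D * D) * NB D (set a) \<le> card A ^ D} \<le> card A ^ D"
proof -
  define X where "X = (2::nat) ^ ((2 * \<delta> + 8) * D * D)"
  define U where "U = {a \<in> lsts A D. \<not> X * NB D (set a) \<le> card A ^ D}"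
  have "card U * card A ^ D = (\<Sum>a\<in>U. card A ^ D)" by simp
  also have "\<dots> \<le> (\<Sum>a\<in>U. X * NB D (set a))" by (intro sum_mono) (auto simp: U_def)
  also have "\<dots> \<le> (\<Sum>a\<in>lsts A D. X * NB D (set a))"
    by (intro sum_mono2) (auto simp: U_def finA finite_lsts)
  also have "\<dots> = X * card {as \<in> lsts A (2 * D). badset (set as)}"
    by (simp only: sum_distrib_left[symmetric] NB_D_sum)
  finally have "X * (card U * card A ^ D) \<le> X * X * card {as \<in> lsts A (2 * D). badset (set as)}"
    by (simp add: mult.assoc mult_le_mono2)
  also have "X * X = 2 ^ ((4 * \<delta> + 16) * D * D)"
    by (simp add: X_def power_add[symmetric] algebra_simps)
  also note bad2
  finally have "(X * card U) * card A ^ D \<le> card A ^ D * card A ^ D"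
    by (simp add: mult_2 power_add mult.assoc)
  thus ?thesis using cardA_pos by (simp add: X_def U_def)
qed

text \<open>The admissible tuples are counted by a falling factorial whose factors are all at least
  \<open>card A - (card U + D)\<close>; by Bernoulli's inequality the lost share is at most
  \<open>D * (card U + D) / card A\<close>.\<close>

lemma few_colliding:
  assumes U: "U \<subseteq> A" and size: "(card U + D) * D * 2 ^ c \<le> card A"
  shows "2 ^ c * card {a \<in> lsts A D. \<not> (distinct a \<and> set a \<inter> U = {})} \<le> card A ^ D"
proof -
  let ?V = "{a \<in> lsts A D. \<not> (distinct a \<and> set a \<inter> U = {})}"
  define n where "n = card A"
  define w where "w = card U + D"
  have n: "n > 0" using cardA_pos by (simp add: n_def)
  have "w \<le> w * (D * 2 ^ c)" using D_pos by simp
  also have "\<dots> = (card U + D) * D * 2 ^ c" by (simp only: w_def mult.assoc)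
  also note size
  finally have wn: "w \<le> n" by (simp add: n_def)
  have finU: "finite U" using U finA finite_subset by blast
  define G where "G = {a. length a = D \<and> distinct a \<and> set a \<subseteq> A - U}"
  have cAU: "card (A - U) = n - card U" using U finU by (simp add: card_Diff_subset n_def)
  have "card G = \<Prod>{n - card U - D + 1..n - card U}"
    unfolding G_def cAU[symmetric] by (rule card_lists_distinct_length_eq) (use finA cAU wn in \<open>auto simp: w_def\<close>)
  moreover have "(\<Prod>i\<in>{n - card U - D + 1..n - card U}. n - w) \<le> \<Prod>{n - card U - D + 1..n - card U}"
    by (rule prod_mono) (auto simp: w_def)
  moreover have "card {n - card U - D + 1..n - card U} = D" using wn by (auto simp: w_def)
  ultimately have G: "(n - w) ^ D \<le> card G" by simp
  have "real n ^ D * (1 - real D * (w / n)) \<le> real n ^ D * (1 + (- (w / n))) ^ D"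
    using Bernoulli_inequality[of "- (w / n)" D] wn n by (intro mult_left_mono) (auto simp: field_simps)
  also have "\<dots> = (real n * (1 + (- (w / n)))) ^ D" by (simp only: power_mult_distrib)
  also have "real n * (1 + (- (w / n))) = real (n - w)" using n wn by (simp add: of_nat_diff field_simps)
  finally have "real n ^ D * (1 - real D * (w / n)) \<le> card G"
    using of_nat_mono[OF G, where 'a = real] unfolding of_nat_power by linarith
  moreover have "real (w * D * 2 ^ c) \<le> real n" using size unfolding of_nat_le_iff by (simp add: w_def n_def)
  hence "real D * (w / n) \<le> 1 / 2 ^ c" using n by (simp add: field_simps)
  hence "real n ^ D * (1 - 1 / 2 ^ c) \<le> real n ^ D * (1 - real D * (w / n))" by (intro mult_left_mono) auto
  ultimately have G2: "real n ^ D * (1 - 1 / 2 ^ c) \<le> card G" by linarith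
  have "?V = lsts A D - G" by (auto simp: lsts_def G_def)
  moreover have "G \<subseteq> lsts A D" by (auto simp: lsts_def G_def)
  ultimately have cnt: "card ?V + card G = n ^ D"
    using finA card_mono[of "lsts A D" G] finite_subset[of G "lsts A D"]
    by (simp add: card_Diff_subset finite_lsts card_lsts n_def)
  hence "real (card ?V) = real n ^ D - card G"
    using arg_cong[OF cnt, of real] unfolding of_nat_add of_nat_power by linarith
  hence "real (card ?V) \<le> real n ^ D / 2 ^ c"
    using G2 by (simp add: right_diff_distrib)
  hence "real (2 ^ c * card ?V) \<le> real (n ^ D)"
    by (simp add: le_divide_eq mult.commute)
  thus ?thesis unfolding of_nat_le_iff n_def .
qed

lemma few_unavailable:
  assumes U: "U \<subseteq> A" and size: "(card U + D) * D * 2 ^ ((2 * \<delta> + 4) * D + 3) \<le> card A"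
  shows "2 ^ ((2 * \<delta> + 4) * D + 2) * card (lsts A D - avail U) \<le> card A ^ D"
proof -
  define c where "c = (2 * \<delta> + 4) * D + 2"
  define V1 where "V1 = {a \<in> lsts A D. \<not> 2 ^ ((2 * \<delta> + 8) * D * D) * NB D (set a) \<le> card A ^ D}"
  define V2 where "V2 = {a \<in> lsts A D. \<not> (distinct a \<and> set a \<inter> U = {})}"
  have c1: "2 * 2 ^ c * card V2 \<le> card A ^ D"
    using few_colliding[OF U, of "Suc c"] size by (simp add: V2_def c_def eval_nat_numeral)
  have "c + 1 \<le> (2 * \<delta> + 8) * D * D"
  proof -
    have "(2 * \<delta> + 8) * D * 1 \<le> (2 * \<delta> + 8) * D * D" using D_pos by (intro mult_le_mono2)
    moreover have "(2 * \<delta> + 8) * D = (2 * \<delta> + 4) * D + 4 * D" by (simp add: algebra_simps)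
    ultimately show ?thesis using D_pos unfolding c_def by linarith
  qed
  hence "2 ^ (c + 1) * card V1 \<le> 2 ^ ((2 * \<delta> + 8) * D * D) * card V1"
    by (intro mult_le_mono1 power_increasing) auto
  also have "\<dots> \<le> card A ^ D" using few_atypical by (simp add: V1_def)
  finally have c2: "2 * 2 ^ c * card V1 \<le> card A ^ D" by simp
  have "lsts A D - avail U \<subseteq> V1 \<union> V2" by (auto simp: avail_def typical_def V1_def V2_def)
  hence "card (lsts A D - avail U) \<le> card (V1 \<union> V2)"
    by (intro card_mono) (auto simp: V1_def V2_def finA finite_lsts)
  also have "\<dots> \<le> card V1 + card V2" by (rule card_Un_le)
  finally have "2 ^ c * card (lsts A D - avail U) \<le> 2 ^ c * (card V1 + card V2)" by (rule mult_le_mono2)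
  also have "\<dots> \<le> card A ^ D" using c1 c2 by (simp add: algebra_simps)
  finally show ?thesis by (simp add: c_def)
qed

text \<open>Double counting: a vertex with \<open>d\<close> neighbours in \<open>A\<close> is a
  common neighbour of exactly \<open>d ^ D\<close> tuples.\<close>

lemma low_degree_sum:
  "2 ^ ((2 * \<delta> + 4) * D) * (\<Sum>a\<in>lsts A D. card {b\<in>cnb adj B (set a). \<not> high b}) \<le> card B * card A ^ D"
proof -
  have "(\<Sum>a\<in>lsts A D. card {b\<in>cnb adj B (set a). \<not> high b})
     = (\<Sum>a\<in>lsts A D. card {b\<in>{b\<in>B. \<not> high b}. \<forall>x\<in>set a. adj x b})"
    by (intro sum.cong arg_cong[of _ _ card]) (auto simp: cnb_def)
  also have "\<dots> = (\<Sum>b\<in>{b\<in>B. \<not> high b}. card {a\<in>lsts A D. \<forall>x\<in>set a. adj x b})"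
    by (rule sum_card_swap) (use finA finB finite_lsts in auto)
  also have "\<dots> = (\<Sum>b\<in>{b\<in>B. \<not> high b}. card {a\<in>A. adj a b} ^ D)"
  proof (rule sum.cong)
    fix b
    have "{a\<in>lsts A D. \<forall>x\<in>set a. adj x b} = lsts {a\<in>A. adj a b} D" by (auto simp: lsts_def)
    thus "card {a\<in>lsts A D. \<forall>x\<in>set a. adj x b} = card {a\<in>A. adj a b} ^ D"
      using finA by (simp add: card_lsts)
  qed simp
  also have "2 ^ ((2 * \<delta> + 4) * D) * \<dots> = (\<Sum>b\<in>{b\<in>B. \<not> high b}. (2 ^ (2 * \<delta> + 4) * card {a\<in>A. adj a b}) ^ D)"
    by (simp only: sum_distrib_left power_mult_distrib power_mult)
  also have "\<dots> \<le> (\<Sum>b\<in>{b\<in>B. \<not> high b}. card A ^ D)"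
    by (intro sum_mono power_mono) (auto simp: high_def)
  also have "\<dots> \<le> card B * card A ^ D" using finB by (auto intro!: mult_le_mono1 card_mono)
  finally show ?thesis .
qed

text \<open>A typical tuple has many common neighbours, at most half of them in \<open>W\<close>. If
  none of the others were high, \<open>low_degree_sum\<close> would limit the available tuples to a
  quarter of all tuples, but \<open>few_unavailable\<close> leaves at least three quarters.\<close>

lemma exists_high_star:
  assumes U: "U \<subseteq> A" and size: "(card U + D) * D * 2 ^ ((2 * \<delta> + 4) * D + 3) \<le> card A"
    and W: "finite W" "2 ^ ((2 * \<delta> + 1) * D + 1) * card W \<le> card B" and B: "B \<noteq> {}"
  obtains a b where "a \<in> avail U" "b \<in> cnb adj B (set a)" "b \<notin> W" "high b"
proof -
  let ?S = "(\<Sum>a\<in>lsts A D. card {b\<in>cnb adj B (set a). \<not> high b})"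
  have "\<exists>a\<in>avail U. \<exists>b\<in>cnb adj B (set a). b \<notin> W \<and> high b"
  proof (rule ccontr)
    assume neg: "\<not> ?thesis"
    define e where "e = (2 * \<delta> + 1) * D"
    define N where "N = card A ^ D"
    have cB: "card B > 0" and N: "N > 0" using B finB cardA_pos by (auto simp: card_gt_0_iff N_def)
    have le: "card B \<le> 2 ^ (e + 1) * card {b\<in>cnb adj B (set a). \<not> high b}" if "a \<in> avail U" for a
    proof -
      have "cnb adj B (set a) \<subseteq> W \<union> {b\<in>cnb adj B (set a). \<not> high b}" using neg that by auto
      hence "card (cnb adj B (set a)) \<le> card (W \<union> {b\<in>cnb adj B (set a). \<not> high b})"
        using W finB by (intro card_mono) auto
      also have "\<dots> \<le> card W + card {b\<in>cnb adj B (set a). \<not> high b}" by (rule card_Un_le)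
      finally have "2 ^ e * card (cnb adj B (set a)) \<le> 2 ^ e * card W + 2 ^ e * card {b\<in>cnb adj B (set a). \<not> high b}"
        by (metis add_mult_distrib2 mult_le_mono2)
      moreover have "card B \<le> 2 ^ e * card (cnb adj B (set a))"
        using typical_not_bad[of a] that by (simp add: avail_def badset_def e_def)
      moreover have "2 * (2 ^ e * card W) \<le> card B" using W by (simp add: e_def mult.assoc)
      ultimately show ?thesis by (simp add: mult.assoc)
    qed
    have "card (avail U) * card B \<le> (\<Sum>a\<in>avail U. 2 ^ (e + 1) * card {b\<in>cnb adj B (set a). \<not> high b})"
      using sum_mono[of "avail U" "\<lambda>_. card B", OF le] by simp
    also have "\<dots> \<le> (\<Sum>a\<in>lsts A D. 2 ^ (e + 1) * card {b\<in>cnb adj B (set a). \<not> high b})"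
      using avail_subset finA finite_lsts by (intro sum_mono2) auto
    also have "\<dots> = 2 ^ (e + 1) * ?S"
      by (rule sum_distrib_left[symmetric])
    finally have "2 ^ ((2 * \<delta> + 4) * D) * (card (avail U) * card B)
      \<le> 2 ^ ((2 * \<delta> + 4) * D) * (2 ^ (e + 1) * ?S)"
      by (rule mult_le_mono2)
    also have "\<dots> = 2 ^ (e + 1) * (2 ^ ((2 * \<delta> + 4) * D) * ?S)"
      by (simp only: mult.left_commute)
    also have "\<dots> \<le> 2 ^ (e + 1) * (card B * N)"
      using low_degree_sum by (intro mult_le_mono2) (simp add: N_def)
    finally have "(2 ^ ((2 * \<delta> + 4) * D) * card (avail U)) * card B \<le> (2 ^ (e + 1) * N) * card B"
      by (simp add: mult_ac)
    hence 1: "2 ^ ((2 * \<delta> + 4) * D) * card (avail U) \<le> 2 ^ (e + 1) * N" using cB by simp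
    have "e + 3 \<le> (2 * \<delta> + 4) * D" using D_pos by (simp add: e_def algebra_simps)
    hence "(2::nat) ^ (e + 3) \<le> 2 ^ ((2 * \<delta> + 4) * D)" by (rule power_increasing) simp
    hence "2 ^ (e + 3) * card (avail U) \<le> 2 ^ ((2 * \<delta> + 4) * D) * card (avail U)" by (rule mult_le_mono1)
    with 1 have "2 ^ (e + 3) * card (avail U) \<le> 2 ^ (e + 1) * N" by linarith
    hence 2: "4 * card (avail U) \<le> N" by (simp add: power_add)
    have "card (lsts A D - avail U) + card (avail U) = N"
      using avail_subset finite_avail finA card_mono[of "lsts A D" "avail U"]
      by (simp add: card_Diff_subset N_def card_lsts)
    moreover have "4 * card (lsts A D - avail U) \<le> N"
    proof -
      have "4 * card (lsts A D - avail U) \<le> 2 ^ ((2 * \<delta> + 4) * D + 2) * card (lsts A D - avail U)" by simp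
      also have "\<dots> \<le> N" using few_unavailable[OF U size] by (simp add: N_def)
      finally show ?thesis .
    qed
    ultimately show False using 2 N by linarith
  qed
  thus ?thesis using that by blast
qed

lemma many_hits:
  assumes U: "U \<subseteq> A" and size: "(card U + D) * D * 2 ^ ((2 * \<delta> + 4) * D + 3) \<le> card A"
    and W: "finite W" "2 ^ ((2 * \<delta> + 1) * D + 1) * card W \<le> card B"
    and v: "high v" and a': "typical a'"
  shows "card (SIGMA a:avail U. cnb adj B (set a) - W) \<le> 2 ^ ((4 * \<delta> + 5) * D + 2) *
    card {(a, b) \<in> (SIGMA a:avail U. cnb adj B (set a) - W). (\<forall>x\<in>set a. adj x v) \<and> b \<in> cnb adj B (set a')}"
proof -
  let ?H = "{(a, b) \<in> (SIGMA a:avail U. cnb adj B (set a) - W). (\<forall>x\<in>set a. adj x v) \<and> b \<in> cnb adj B (set a')}"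
  define N where "N = card A ^ D"
  define c where "c = (2 * \<delta> + 4) * D"
  define e where "e = (2 * \<delta> + 1) * D"
  define T where "T = {a \<in> avail U. (\<forall>x\<in>set a. adj x v) \<and> \<not> badset (set a' \<union> set a)}"
  have T: "N \<le> 2 ^ (c + 1) * card T"
  proof -
    define P where "P = {a\<in>lsts A D. \<forall>x\<in>set a. adj x v}"
    define Q where "Q = {a\<in>lsts A D. badset (set a' \<union> set a)}"
    have "P = lsts {a\<in>A. adj a v} D" by (auto simp: lsts_def P_def)
    hence "card P = card {a\<in>A. adj a v} ^ D" using finA by (simp add: card_lsts)
    moreover have "N \<le> (2 ^ (2 * \<delta> + 4) * card {a\<in>A. adj a v}) ^ D"
      unfolding N_def by (rule power_mono) (use v in \<open>auto simp: high_def\<close>)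
    ultimately have 1: "N \<le> 2 ^ c * card P" by (simp only: power_mult_distrib c_def power_mult)
    have "2 ^ (c + 2) * card Q \<le> 2 ^ ((2 * \<delta> + 8) * D * D) * card Q"
    proof (intro mult_le_mono1 power_increasing)
      have "(2 * \<delta> + 8) * D * 1 \<le> (2 * \<delta> + 8) * D * D" using D_pos by (intro mult_le_mono2)
      moreover have "(2 * \<delta> + 8) * D = (2 * \<delta> + 4) * D + 4 * D" by (simp add: algebra_simps)
      ultimately show "c + 2 \<le> (2 * \<delta> + 8) * D * D" using D_pos unfolding c_def by linarith
    qed simp
    also have "\<dots> \<le> N" using a' by (simp add: typical_def NB_def Q_def N_def)
    finally have 2: "4 * (2 ^ c * card Q) \<le> N" by (simp add: power_add mult_ac)
    have 3: "4 * (2 ^ c * card (lsts A D - avail U)) \<le> N"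
      using few_unavailable[OF U size] by (simp add: N_def c_def power_add mult_ac)
    have "P \<subseteq> T \<union> Q \<union> (lsts A D - avail U)" by (auto simp: P_def T_def Q_def)
    hence "card P \<le> card (T \<union> Q \<union> (lsts A D - avail U))"
      using finA finite_avail by (intro card_mono) (auto simp: T_def Q_def)
    also have "\<dots> \<le> card T + card Q + card (lsts A D - avail U)"
      by (meson add_le_mono1 card_Un_le le_trans)
    finally have "2 ^ c * card P \<le> 2 ^ c * card T + 2 ^ c * card Q + 2 ^ c * card (lsts A D - avail U)"
      by (metis add_mult_distrib2 mult_le_mono2)
    with 1 2 3 show ?thesis by simp
  qed
  have fib: "card B \<le> 2 ^ (e + 1) * card (cnb adj B (set a' \<union> set a) - W)" if "a \<in> T" for a
  proof -
    have "card B \<le> 2 ^ e * card (cnb adj B (set a' \<union> set a))"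
      using that by (simp add: T_def badset_def e_def)
    also have "card (cnb adj B (set a' \<union> set a)) \<le> card (cnb adj B (set a' \<union> set a) - W) + card W"
      using diff_card_le_card_Diff[OF W(1), of "cnb adj B (set a' \<union> set a)"] by linarith
    finally have "card B \<le> 2 ^ e * card (cnb adj B (set a' \<union> set a) - W) + 2 ^ e * card W"
      by (simp add: add_mult_distrib2)
    moreover have "2 * (2 ^ e * card W) \<le> card B" using W by (simp add: e_def mult.assoc)
    ultimately show ?thesis by (simp add: mult.assoc)
  qed
  have "card (SIGMA a:avail U. cnb adj B (set a) - W) \<le> card (lsts A D \<times> B)"
    using avail_subset finA finB cnb_subset[of adj B] by (intro card_mono) auto
  also have "\<dots> = N * card B" by (simp add: card_cartesian_product card_lsts finA N_def)
  also have "\<dots> \<le> 2 ^ (c + 1) * card T * card B" using T by (rule mult_le_mono1)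
  also have "\<dots> = 2 ^ (c + 1) * (\<Sum>a\<in>T. card B)" by simp
  also have "\<dots> \<le> 2 ^ (c + 1) * (\<Sum>a\<in>T. 2 ^ (e + 1) * card (cnb adj B (set a' \<union> set a) - W))"
    by (intro mult_le_mono2 sum_mono fib)
  also have "\<dots> = 2 ^ (c + 1) * 2 ^ (e + 1) * card (SIGMA a:T. cnb adj B (set a' \<union> set a) - W)"
    using finB finite_avail by (simp add: sum_distrib_left[symmetric] T_def)
  also have "(2::nat) ^ (c + 1) * 2 ^ (e + 1) = 2 ^ ((4 * \<delta> + 5) * D + 2)"
    by (simp add: power_add[symmetric] c_def e_def algebra_simps)
  also have "card (SIGMA a:T. cnb adj B (set a' \<union> set a) - W) \<le>
    card ?H"
  proof (rule card_mono)
    show "finite ?H"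
      by (rule finite_subset[of _ "SIGMA a:avail U. cnb adj B (set a) - W"]) (use finB finite_avail in auto)
  qed (auto simp: T_def cnb_def)
  finally show ?thesis by simp
qed

text \<open>The set \<open>U\<close> in \<open>potential_choice\<close> is arbitrary and may contain
  ill-formed pairs; discarding these keeps the union inside \<open>A\<close> and its size under
  control.\<close>

definition used :: "('a list \<times> 'b) set \<Rightarrow> 'a set" where
  "used U = (\<Union>s\<in>{s\<in>U. fst s \<in> lsts A D}. set (fst s))"

lemma used_subset: "used U \<subseteq> A"
  by (auto simp: used_def lsts_def)

lemma card_used: "finite U \<Longrightarrow> card (used U) \<le> card U * D"
proof -
  assume "finite U"
  have "card (used U) \<le> (\<Sum>s\<in>{s\<in>U. fst s \<in> lsts A D}. card (set (fst s)))"
    unfolding used_def using \<open>finite U\<close> by (intro card_UN_le) auto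
  also have "\<dots> \<le> (\<Sum>s\<in>{s\<in>U. fst s \<in> lsts A D}. D)"
    by (intro sum_mono) (auto simp: lsts_def intro: order_trans[OF card_length])
  also have "\<dots> \<le> card U * D" using \<open>finite U\<close> by (auto intro!: card_mono mult_le_mono1)
  finally show ?thesis .
qed

definition star :: "('a list \<times> 'b) set \<Rightarrow> 'a list \<times> 'b \<Rightarrow> bool" where
  "star U s \<longleftrightarrow> s \<in> (SIGMA a:avail (used U). cnb adj B (set a) - snd ` U)"

lemma star_disjoint:
  assumes "star U s" "t \<in> U" "typical (fst t)"
  shows "set (fst t) \<inter> set (fst s) = {}" "snd t \<noteq> snd s"
proof -
  have "set (fst t) \<subseteq> used U" using assms(2,3) by (auto simp: used_def typical_def)
  thus "set (fst t) \<inter> set (fst s) = {}" using assms(1) by (auto simp: star_def avail_def)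
  show "snd t \<noteq> snd s" using assms(1,2) by (auto simp: star_def)
qed

lemma finite_stars: "finite {s. star U s}"
  using finite_avail finB by (auto simp: star_def)

text \<open>A star is a tuple for the neighbourhood of a slot together with an occupant of the slot.
  The first \<open>K\<close> stars have high centres and are for slots that may be vacated; the
  other \<open>K\<close> are for intermediate slots. The latter are chosen by
  \<open>potential_choice\<close>, indexed by all pairs of a high vertex of \<open>VV\<close> and
  one of the first \<open>K\<close> stars. The numerical hypothesis compares the resulting potential
  with \<open>(1/2) ^ M\<close>, so every pair is hit at least \<open>M\<close> times.\<close>

lemma star_sequence:
  fixes m K M :: nat
  assumes K: "2 * K \<le> m"
    and sA: "(m * D + D) * D * 2 ^ ((2 * \<delta> + 4) * D + 3) \<le> card A"
    and sB: "2 ^ ((2 * \<delta> + 1) * D + 1) * m \<le> card B" "B \<noteq> {}"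
    and VV: "finite VV" "card VV * K * (1 - 1 / 2 ^ ((4 * \<delta> + 5) * D + 3)) ^ K \<le> (1 / 2 :: real) ^ M"
  obtains a b where "\<forall>j<2 * K. typical (a j)" "\<forall>j<2 * K. b j \<in> cnb adj B (set (a j))"
    "\<forall>j<2 * K. \<forall>i<j. set (a i) \<inter> set (a j) = {} \<and> b i \<noteq> b j" "\<forall>j<K. high (b j)"
    "\<forall>v\<in>VV. \<forall>i<K. high v \<longrightarrow>
       M \<le> card {j\<in>{..<K}. (\<forall>x\<in>set (a (K + j)). adj x v) \<and> b (K + j) \<in> cnb adj B (set (a i))}"
proof -
  have sU: "(card (used U) + D) * D * 2 ^ ((2 * \<delta> + 4) * D + 3) \<le> card A" if "finite U" "card U \<le> m" for U
  proof -
    have "card (used U) \<le> m * D" using card_used[OF that(1)] that(2) by (meson le_trans mult_le_mono1)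
    hence "(card (used U) + D) * D * 2 ^ ((2 * \<delta> + 4) * D + 3) \<le> (m * D + D) * D * 2 ^ ((2 * \<delta> + 4) * D + 3)"
      by (intro mult_le_mono1 add_le_mono1)
    with sA show ?thesis by (rule le_trans[rotated])
  qed
  have sW: "2 ^ ((2 * \<delta> + 1) * D + 1) * card (snd ` U) \<le> card B" if "finite U" "card U \<le> m" for U :: "('a list \<times> 'b) set"
    using that card_image_le[of U snd] sB(1) by (meson le_trans mult_le_mono2)
  have ex: "\<exists>s. star U s \<and> high (snd s)" if U: "finite U" "card U \<le> m" for U
  proof -
    obtain a b where "a \<in> avail (used U)" "b \<in> cnb adj B (set a)" "b \<notin> snd ` U" "high b"
      by (rule exists_high_star[OF used_subset sU[OF U] finite_imageI[OF U(1)] sW[OF U] sB(2)])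
    thus ?thesis by (intro exI[of _ "(a, b)"]) (simp add: star_def)
  qed
  define S1 where "S1 = (\<lambda>U. {s. star U s \<and> high (snd s)})"
  obtain s1 where s1: "\<And>j. j < K \<Longrightarrow> s1 j \<in> S1 (s1 ` {..<j})"
  \<comment> \<open>With an empty index set nothing has to be hit; this only collects disjoint stars
    with high centres.\<close>
  proof (rule potential_choice[of "{}::unit set" 0 K S1 "\<lambda>_ _. True"])
    fix U :: "('a list \<times> 'b) set" assume U: "finite U" "card U < K"
    show "finite (S1 U)" by (rule finite_subset[OF _ finite_stars[of U]]) (auto simp: S1_def)
    show "S1 U \<noteq> {}" using ex[of U] U K by (auto simp: S1_def)
  qed auto
  define U1 where "U1 = s1 ` {..<K}"
  have U1: "finite U1" "card U1 \<le> K" using card_image_le[of "{..<K}" s1] by (auto simp: U1_def)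
  have t1: "typical (fst (s1 j))" if "j < K" for j
    using s1[OF that] by (auto simp: S1_def star_def avail_def)
  define S2 where "S2 = (\<lambda>U. {s. star (U \<union> U1) s})"
  define VH where "VH = {v \<in> VV. high v}"
  define hit where "hit = (\<lambda>(v, i) s. (\<forall>x\<in>set (fst s). adj x v) \<and> snd s \<in> cnb adj B (set (fst (s1 i))))"
  have p1: "(1::real) / 2 ^ n \<le> 1" for n by (simp add: divide_le_eq)
  define p :: real where "p = 1 / 2 ^ ((4 * \<delta> + 5) * D + 2)"
  have UU1: "finite (U \<union> U1)" "card (U \<union> U1) \<le> m" if "finite U" "card U < K" for U
    using that U1 K card_Un_le[of U U1] by auto
  obtain s2 where s2: "\<And>j. j < K \<Longrightarrow> s2 j \<in> S2 (s2 ` {..<j})"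
    "\<And>i. i \<in> VH \<times> {..<K} \<Longrightarrow> (1/2) ^ card {j\<in>{..<K}. hit i (s2 j)} \<le> card (VH \<times> {..<K}) * (1 - p / 2) ^ K"
  proof (rule potential_choice[of "VH \<times> {..<K}" p K S2 hit])
    show "finite (VH \<times> {..<K})" using VV by (simp add: VH_def)
    show "p \<le> 1" unfolding p_def by (rule p1)
  next
    fix U :: "('a list \<times> 'b) set" assume U: "finite U" "card U < K"
    show "finite (S2 U)" using finite_stars by (simp add: S2_def)
    show "S2 U \<noteq> {}" using ex[OF UU1[OF U]] by (auto simp: S2_def)
  next
    fix U :: "('a list \<times> 'b) set" and vi assume U: "finite U" "card U < K" and vi: "vi \<in> VH \<times> {..<K}"
    obtain v i where vi': "vi = (v, i)" "v \<in> VH" "i < K" using vi by auto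
    have S2: "S2 U = (SIGMA a:avail (used (U \<union> U1)). cnb adj B (set a) - snd ` (U \<union> U1))"
      by (simp add: S2_def star_def)
    have "card (S2 U) \<le> 2 ^ ((4 * \<delta> + 5) * D + 2) * card {(a, b) \<in> S2 U. (\<forall>x\<in>set a. adj x v) \<and> b \<in> cnb adj B (set (fst (s1 i)))}"
      unfolding S2 using many_hits[OF used_subset sU[OF UU1[OF U]] _ sW[OF UU1[OF U]] _ t1[OF vi'(3)], of v]
        vi'(2) UU1[OF U] by (simp add: VH_def)
    also have "{(a, b) \<in> S2 U. (\<forall>x\<in>set a. adj x v) \<and> b \<in> cnb adj B (set (fst (s1 i)))} = {s \<in> S2 U. hit vi s}"
      by (auto simp: hit_def vi'(1))
    finally have "real (card (S2 U)) \<le> real (2 ^ ((4 * \<delta> + 5) * D + 2) * card {s \<in> S2 U. hit vi s})"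
      by (rule of_nat_mono)
    thus "p * card (S2 U) \<le> card {s \<in> S2 U. hit vi s}"
      by (simp add: p_def divide_le_eq mult.commute)
  qed blast
  define st where "st = (\<lambda>j. if j < K then s1 j else s2 (j - K))"
  have st: "star (st ` {..<j}) (st j)" if "j < 2 * K" for j
  proof (cases "j < K")
    case True
    hence "st ` {..<j} = s1 ` {..<j}" by (auto simp: st_def)
    thus ?thesis using s1[OF True] True by (simp add: S1_def st_def)
  next
    case False
    have "{..<j} = {..<K} \<union> (\<lambda>i. K + i) ` {..<j - K}"
    proof (intro equalityI subsetI)
      fix i assume "i \<in> {..<j}"
      thus "i \<in> {..<K} \<union> (\<lambda>i. K + i) ` {..<j - K}"
        using False by (cases "i < K") (auto intro!: image_eqI[of _ _ "i - K"])
    qed (use False in auto)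
    hence "st ` {..<j} = st ` {..<K} \<union> (\<lambda>i. st (K + i)) ` {..<j - K}" by (simp add: image_Un image_image)
    also have "\<dots> = s2 ` {..<j - K} \<union> U1" by (auto simp: st_def U1_def)
    finally show ?thesis using s2(1)[of "j - K"] that False by (simp add: S2_def st_def)
  qed
  have tp: "typical (fst (st j))" and cn: "snd (st j) \<in> cnb adj B (set (fst (st j)))" if "j < 2 * K" for j
    using st[OF that] by (auto simp: star_def avail_def)
  show ?thesis
  proof (rule that[of "\<lambda>j. fst (st j)" "\<lambda>j. snd (st j)"]; intro allI impI ballI)
    fix j i assume ij: "j < 2 * K" "i < j"
    have "st i \<in> st ` {..<j}" using ij by auto
    from star_disjoint[OF st[OF ij(1)] this tp] ij
    show "set (fst (st i)) \<inter> set (fst (st j)) = {} \<and> snd (st i) \<noteq> snd (st j)" by simp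
  next
    fix j assume "j < K"
    thus "high (snd (st j))" using s1 by (auto simp: st_def S1_def)
  next
    fix v i assume v: "v \<in> VV" and i: "i < K" and v': "high v"
    have "(1/2::real) ^ card {j\<in>{..<K}. hit (v, i) (s2 j)} \<le> card (VH \<times> {..<K}) * (1 - p / 2) ^ K"
      by (rule s2(2)) (use v v' i in \<open>auto simp: VH_def\<close>)
    also have "\<dots> \<le> card VV * K * (1 - p / 2) ^ K"
    proof (intro mult_right_mono)
      have "card VH \<le> card VV" using VV by (intro card_mono) (auto simp: VH_def)
      thus "real (card (VH \<times> {..<K})) \<le> real (card VV * K)" by (simp add: card_cartesian_product mult_right_mono)
      have "p \<le> 1" unfolding p_def by (rule p1)
      thus "0 \<le> (1 - p / 2) ^ K" by simp
    qed
    also have "1 - p / 2 = 1 - 1 / 2 ^ ((4 * \<delta> + 5) * D + 3)" by (simp add: p_def eval_nat_numeral)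
    also note VV(2)
    finally have "M \<le> card {j\<in>{..<K}. hit (v, i) (s2 j)}" by simp
    also have "{j\<in>{..<K}. hit (v, i) (s2 j)} = {j\<in>{..<K}. (\<forall>x\<in>set (fst (st (K + j))). adj x v)
        \<and> snd (st (K + j)) \<in> cnb adj B (set (fst (st i)))}"
      using i by (auto simp: hit_def st_def)
    finally show "M \<le> card {j\<in>{..<K}. (\<forall>x\<in>set (fst (st (K + j))). adj x v)
        \<and> snd (st (K + j)) \<in> cnb adj B (set (fst (st i)))}" .
  qed (use tp cn in auto)
qed

text \<open>In the exchange, a new vertex \<open>q\<close> takes a slot \<open>z\<close> of the second kind and the vertex \<open>g z\<close> moves
  to the slot of the first kind that has become vacant.\<close>

lemma template:
  fixes h :: "'x \<Rightarrow> 'y \<Rightarrow> bool" and m K M :: nat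
  assumes h: "bounded_bip h X Y D m" and K: "2 * K * (D ^ 4 + 1) \<le> m"
    and sA: "(m * D + D) * D * 2 ^ ((2 * \<delta> + 4) * D + 3) \<le> card A"
    and sB: "2 ^ ((2 * \<delta> + 1) * D + 1) * m \<le> card B" "B \<noteq> {}"
    and VV: "finite VV" "card VV * K * (1 - 1 / 2 ^ ((4 * \<delta> + 5) * D + 3)) ^ K \<le> (1 / 2 :: real) ^ M"
  obtains f g Z where "embeds h X Y adj A B f g" "Z \<subseteq> g ` Y" "card Z = K" "\<forall>b\<in>Z. high b"
    "\<forall>E Q. E \<subseteq> Z \<and> Q \<subseteq> VV \<and> card Q = card E \<and> card E \<le> M \<and> Q \<inter> g ` Y = {} \<and> (\<forall>q\<in>Q. high q) \<longrightarrow>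
       (\<exists>g'. embeds h X Y adj A (B \<union> Q) f g' \<and> g' ` Y = (g ` Y - E) \<union> Q)"
proof -
  note h' = h[unfolded bounded_bip_def]
  have fin: "finite X" "finite Y" using h' by auto
  have "2 * K * 1 \<le> 2 * K * (D ^ 4 + 1)" by (intro mult_le_mono2) simp
  hence Km: "2 * K \<le> m" using K by linarith
  obtain a b where ab: "\<forall>j<2 * K. typical (a j)" "\<forall>j<2 * K. b j \<in> cnb adj B (set (a j))"
    "\<forall>j<2 * K. \<forall>i<j. set (a i) \<inter> set (a j) = {} \<and> b i \<noteq> b j" "\<forall>j<K. high (b j)"
    "\<forall>v\<in>VV. \<forall>i<K. high v \<longrightarrow>
       M \<le> card {j\<in>{..<K}. (\<forall>x\<in>set (a (K + j)). adj x v) \<and> b (K + j) \<in> cnb adj B (set (a i))}"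
    by (rule star_sequence[OF Km sA sB VV])
  have abne: "set (a i) \<inter> set (a j) = {}" "b i \<noteq> b j" if "i \<noteq> j" "i < 2 * K" "j < 2 * K" for i j
    using ab(3)[rule_format, of i j] ab(3)[rule_format, of j i] that
    by (cases i j rule: linorder_cases; auto)+
  obtain S where S: "S \<subseteq> Y" "\<forall>s\<in>S. \<forall>s'\<in>S. s \<noteq> s' \<longrightarrow> \<not> close h X Y s s'"
    "m \<le> (D ^ 4 + 1) * card S"
    by (rule far_subset[OF h])
  have "(D ^ 4 + 1) * (2 * K) \<le> (D ^ 4 + 1) * card S" using K S(3) by (simp only: mult.commute)
  hence KS: "2 * K \<le> card S" by (rule mult_left_le_imp_le) simp
  have finS: "finite S" using S(1) fin finite_subset by blast
  obtain y where "bij_betw y {0..<card S} S" using ex_bij_betw_nat_finite[OF finS] by blast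
  hence y: "inj_on y {..<2 * K}" "y ` {..<2 * K} \<subseteq> S"
    using KS by (auto simp: bij_betw_def inj_on_def)
  have yY: "y j \<in> Y" if "j < 2 * K" for j using y S that by auto
  have far: "\<not> close h X Y (y i) (y j)" if "i \<noteq> j" "i < 2 * K" "j < 2 * K" for i j
  proof -
    have "y i \<in> S" "y j \<in> S" "y i \<noteq> y j" using y that by (auto simp: inj_on_def)
    thus ?thesis using S(2) by blast
  qed
  define nx where "nx = (\<lambda>u. {x\<in>X. h x u})"
  \<comment> \<open>A neighbourhood with fewer than \<open>D\<close> vertices occupies only part of
    its tuple.\<close>
  have "\<exists>\<iota>. inj_on \<iota> (nx (y j)) \<and> \<iota> ` nx (y j) \<subseteq> set (a j)" if j: "j < 2 * K" for j
  proof -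
    have "card (nx (y j)) \<le> D" using h' yY[OF j] by (simp add: nx_def)
    also have "D = card (set (a j))" using ab(1)[rule_format, OF j] by (simp add: typical_def lsts_def distinct_card)
    finally obtain z where "inj_on z (nx (y j))" "\<And>x. x \<in> nx (y j) \<Longrightarrow> z x \<in> set (a j)"
      using system_of_distinct_representatives[of "nx (y j)" "\<lambda>_. set (a j)"] fin by (auto simp: nx_def)
    thus ?thesis by blast
  qed
  then obtain \<iota> where \<iota>: "\<And>j. j < 2 * K \<Longrightarrow> inj_on (\<iota> j) (nx (y j)) \<and> \<iota> j ` nx (y j) \<subseteq> set (a j)"
    by metis
  define X0 where "X0 = (\<Union>j<2 * K. nx (y j))"
  define slot where "slot = (\<lambda>x. SOME j. j < 2 * K \<and> x \<in> nx (y j))"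
  have slot: "slot x < 2 * K" "x \<in> nx (y (slot x))" if "x \<in> X0" for x
    using someI_ex[of "\<lambda>j. j < 2 * K \<and> x \<in> nx (y j)"] that unfolding slot_def X0_def by auto
  have same: "slot x = slot x'" if "x \<in> X0" "x' \<in> X0" "h x u" "h x' u" "u \<in> Y" for x x' u
    using far[of "slot x" "slot x'"] slot[of x] slot[of x'] that by (force simp: close_def nx_def)
  have slot_eq: "slot x = j" if "x \<in> nx (y j)" "j < 2 * K" for x j
  proof (rule ccontr)
    assume "slot x \<noteq> j"
    moreover have "x \<in> X0" using that by (auto simp: X0_def)
    ultimately show False using far[of "slot x" j] slot[of x] that yY[OF that(2)]
      by (auto simp: close_def nx_def)
  qed
  define f0 where "f0 = (\<lambda>x. \<iota> (slot x) x)"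
  have f0a: "f0 x \<in> set (a (slot x))" if "x \<in> X0" for x
    using \<iota>[OF slot(1)[OF that]] slot(2)[OF that] by (auto simp: f0_def)
  have f0inj: "inj_on f0 X0"
  proof (rule inj_onI)
    fix x x' assume *: "x \<in> X0" "x' \<in> X0" "f0 x = f0 x'"
    have eq: "slot x = slot x'"
      using abne(1)[of "slot x" "slot x'"] f0a[OF *(1)] f0a[OF *(2)] slot(1)[OF *(1)] slot(1)[OF *(2)] *(3) by auto
    show "x = x'" using \<iota>[OF slot(1)[OF *(1)]] slot(2)[OF *(1)] slot(2)[OF *(2)] *(3) eq
      by (auto simp: f0_def inj_on_def)
  qed
  have aA: "set (a j) \<subseteq> A" if "j < 2 * K" for j using ab(1)[rule_format, OF that] by (auto simp: typical_def lsts_def)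
  \<comment> \<open>As the slots are far apart, the neighbours of \<open>u\<close> that have been
    placed belong to a single slot, so their images lie in one typical tuple.\<close>
  have f0good: "good (D - card {x\<in>X0. h x u}) (f0 ` {x\<in>X0. h x u})" if u: "u \<in> Y" for u
  proof (cases "{x\<in>X0. h x u} = {}")
    case True
    show ?thesis unfolding True using good_empty by simp
  next
    case False
    then obtain x where x: "x \<in> X0" "h x u" by blast
    have "f0 ` {x\<in>X0. h x u} \<subseteq> set (a (slot x))"
      using f0a same[OF _ x(1) _ x(2) u] by fastforce
    from typical_good_subset[OF ab(1)[rule_format, OF slot(1)[OF x(1)]] this]
    show ?thesis using card_image[OF inj_on_subset[OF f0inj, of "{x\<in>X0. h x u}"]] by auto
  qed
  have "4 * m \<le> m * D * D * 8"
    using D_pos by (simp add: mult.assoc)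
  also have "\<dots> \<le> (m * D + D) * D * 2 ^ ((2 * \<delta> + 4) * D + 3)"
    by (intro mult_le_mono) (auto simp: power_add)
  also note sA
  finally have s4: "4 * card X \<le> card A" using h' by simp
  have f0A: "f0 ` X0 \<subseteq> A" using f0a slot(1) aA by blast
  have X0X: "X0 \<subseteq> X" by (auto simp: X0_def nx_def)
  obtain f where f: "\<And>x. x \<in> X0 \<Longrightarrow> f x = f0 x" "inj_on f X" "f ` X \<subseteq> A"
    "\<And>u. u \<in> Y \<Longrightarrow> good (D - card {x\<in>X. h x u}) (f ` {x\<in>X. h x u})"
    by (rule extend_map[of X Y X0 h f0])
      (use fin h' f0inj f0good s4 f0A X0X in auto)
  have fa: "f ` {x\<in>X. h x (y j)} \<subseteq> set (a j)" if "j < 2 * K" for j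
  proof
    fix w assume "w \<in> f ` {x\<in>X. h x (y j)}"
    then obtain x where x: "x \<in> nx (y j)" "w = f x" by (auto simp: nx_def)
    hence "x \<in> X0" "slot x = j" using that slot_eq by (auto simp: X0_def)
    thus "w \<in> set (a j)" using f(1) f0a x(2) by auto
  qed
  define g1 where "g1 = (\<lambda>u. b (the_inv_into {..<2 * K} y u))"
  have g1y: "g1 (y j) = b j" if "j < 2 * K" for j
    using the_inv_into_f_f[OF y(1)] that by (simp add: g1_def)
  obtain g where g: "\<And>u. u \<in> y ` {..<2 * K} \<Longrightarrow> g u = g1 u" "embeds h X Y adj A B f g"
    "\<And>u. u \<in> Y \<Longrightarrow> g u \<in> cnb adj B (f ` {x\<in>X. h x u})"
  proof (rule extend_embedding[of X Y "y ` {..<2 * K}" f h g1])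
    show "\<not> badset (f ` {x\<in>X. h x u})" if "u \<in> Y" for u using good_not_bad[OF f(4)[OF that]] .
    show "inj_on g1 (y ` {..<2 * K})"
    proof (rule inj_onI)
      fix u u' assume "u \<in> y ` {..<2 * K}" "u' \<in> y ` {..<2 * K}" "g1 u = g1 u'"
      then obtain i j where "i < 2 * K" "u = y i" "j < 2 * K" "u' = y j" "b i = b j"
        using g1y by auto
      thus "u = u'" using abne(2)[of i j] by auto
    qed
    show "g1 u \<in> cnb adj B (f ` {x\<in>X. h x u})" if u: "u \<in> y ` {..<2 * K}" for u
    proof -
      obtain j where j: "j < 2 * K" "u = y j" using u by auto
      show ?thesis using ab(2)[rule_format, OF j(1)] cnb_antimono[OF fa[OF j(1)], of adj B] j g1y by auto
    qed
    show "2 ^ ((2 * \<delta> + 1) * D) * card Y \<le> card B" using sB(1) h' by simp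
  qed (use fin f yY in auto)
  have gy: "g (y j) = b j" if "j < 2 * K" for j using g(1) g1y that by simp
  define Z where "Z = b ` {..<K}"
  have ZY: "Z = g ` y ` {..<K}" using gy by (auto simp: Z_def image_image)
  have "inj_on b {..<K}"
  proof (rule inj_onI)
    fix i j assume "i \<in> {..<K}" "j \<in> {..<K}" "b i = b j"
    thus "i = j" using abne(2)[of i j] by auto
  qed
  hence cZ: "card Z = K" by (simp add: Z_def card_image)
  have exch: "\<exists>g'. embeds h X Y adj A (B \<union> Q) f g' \<and> g' ` Y = (g ` Y - E) \<union> Q"
    if EQ: "E \<subseteq> Z" "Q \<subseteq> VV" "card Q = card E" "card E \<le> M" "Q \<inter> g ` Y = {}" "\<And>q. q \<in> Q \<Longrightarrow> high q" for E Q
  proof -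
    have hits: "card E \<le> card {z\<in>y ` {K..<2 * K}. (\<forall>x\<in>X. h x z \<longrightarrow> adj (f x) q) \<and> (\<forall>x\<in>X. h x s \<longrightarrow> adj (f x) (g z))}"
      if q: "q \<in> Q" and s: "s \<in> y ` {..<K}" for q s
    proof -
      obtain i where i: "i < K" "s = y i" using s by auto
      define J where "J = {j\<in>{..<K}. (\<forall>x\<in>set (a (K + j)). adj x q) \<and> b (K + j) \<in> cnb adj B (set (a i))}"
      have "M \<le> card J" unfolding J_def by (rule ab(5)[rule_format]) (use q EQ i in auto)
      also have "card J = card ((\<lambda>j. y (K + j)) ` J)"
      proof (rule card_image[symmetric], rule inj_onI)
        fix j j' assume "j \<in> J" "j' \<in> J" "y (K + j) = y (K + j')"
        thus "j = j'" using inj_onD[OF y(1), of "K + j" "K + j'"] by (auto simp: J_def)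
      qed
      also have "\<dots> \<le> card {z\<in>y ` {K..<2 * K}. (\<forall>x\<in>X. h x z \<longrightarrow> adj (f x) q) \<and> (\<forall>x\<in>X. h x s \<longrightarrow> adj (f x) (g z))}"
      proof (rule card_mono)
        show "(\<lambda>j. y (K + j)) ` J \<subseteq> {z\<in>y ` {K..<2 * K}. (\<forall>x\<in>X. h x z \<longrightarrow> adj (f x) q) \<and> (\<forall>x\<in>X. h x s \<longrightarrow> adj (f x) (g z))}"
        proof
          fix z assume "z \<in> (\<lambda>j. y (K + j)) ` J"
          then obtain j where j: "j < K" "z = y (K + j)" "\<forall>x\<in>set (a (K + j)). adj x q"
            "b (K + j) \<in> cnb adj B (set (a i))" by (auto simp: J_def)
          have "adj (f x) q" if "x \<in> X" "h x z" for x using fa[of "K + j"] j that by auto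
          moreover have "adj (f x) (g z)" if "x \<in> X" "h x s" for x
            using fa[of i] j gy[of "K + j"] i that by (auto simp: cnb_def)
          ultimately show "z \<in> {z\<in>y ` {K..<2 * K}. (\<forall>x\<in>X. h x z \<longrightarrow> adj (f x) q) \<and> (\<forall>x\<in>X. h x s \<longrightarrow> adj (f x) (g z))}"
            using j by auto
        qed
      qed simp
      finally show ?thesis using EQ(4) by linarith
    qed
    have "y ` {..<K} \<inter> y ` {K..<2 * K} = y ` ({..<K} \<inter> {K..<2 * K})"
      by (rule inj_on_image_Int[OF y(1), symmetric]) auto
    hence disj: "y ` {..<K} \<inter> y ` {K..<2 * K} = {}" by auto
    have sub: "y ` {..<K} \<subseteq> Y" "y ` {K..<2 * K} \<subseteq> Y" using yY by auto
    have EZ: "E \<subseteq> g ` y ` {..<K}" using EQ(1) by (simp only: ZY)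
    obtain g' where "embeds h X Y adj A (B \<union> Q) f g'" "g' ` Y = (g ` Y - E) \<union> Q"
      by (rule exchange[OF g(2) fin(2) finite_subset[OF EQ(2) VV(1)] sub disj EZ EQ(3) EQ(5) hits])
    thus ?thesis by blast
  qed
  have "Z \<subseteq> g ` Y" using yY by (auto simp: ZY)
  moreover have "\<forall>c\<in>Z. high c" using ab(4) by (auto simp: Z_def)
  moreover have "\<forall>E Q. E \<subseteq> Z \<and> Q \<subseteq> VV \<and> card Q = card E \<and> card E \<le> M \<and> Q \<inter> g ` Y = {} \<and> (\<forall>q\<in>Q. high q) \<longrightarrow>
       (\<exists>g'. embeds h X Y adj A (B \<union> Q) f g' \<and> g' ` Y = (g ` Y - E) \<union> Q)"
    by (intro allI impI, elim conjE, rule exch) auto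
  ultimately show ?thesis by (rule that[OF g(2) _ cZ])
qed

end

text \<open>With \<open>x = K / 2 ^ (q + 1)\<close> the power is at most
  \<open>exp (- 2 * x)\<close>. One half of the exponent yields
  \<open>(1/2) ^ (K div 2 ^ (q + 1))\<close>; the other pays for \<open>n * K\<close>, which is at
  most quadratic in \<open>K\<close> and hence below \<open>x ^ 3 / 27 \<le> exp x\<close>. In the
  bound on \<open>K\<close>, the 8 consists of 3 from \<open>2 ^ (3 * (q + 1))\<close> and 5 from
  \<open>27 \<le> 2 ^ 5\<close>.\<close>

lemma exp_dominates:
  fixes K c q n :: nat
  assumes "n \<le> K * 2 ^ c" "2 ^ (c + 3 * q + 8) \<le> K"
  shows "real (n * K) * (1 - 1 / 2 ^ q) ^ K \<le> (1 / 2) ^ (K div 2 ^ (q + 1))"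
proof -
  let ?k = "K div 2 ^ (q + 1)"
  define x :: real where "x = K / 2 ^ (q + 1)"
  have K: "real K > 0" using assms(2) by (auto intro!: Nat.gr0I)
  have x: "x > 0" using K by (simp add: x_def)
  have two: "(1/2 :: real) \<ge> exp (- 1)" using exp_ge_add_one_self[of "1::real"] by (simp add: exp_minus field_simps)
  have q1: "(1::real) / 2 ^ q \<le> 1" by (simp add: divide_le_eq)
  have "(1 - 1 / (2::real) ^ q) ^ K \<le> exp (- (1 / 2 ^ q)) ^ K"
    using exp_ge_add_one_self[of "- (1 / 2 ^ q) :: real"] q1 by (intro power_mono) auto
  also have "\<dots> = exp (- 2 * x)" by (simp add: exp_of_nat_mult[symmetric] x_def)
  finally have 1: "(1 - 1 / (2::real) ^ q) ^ K \<le> exp (- 2 * x)" .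
  have "real (?k) \<le> x"
  proof -
    have "?k * 2 ^ (q + 1) \<le> K" by (rule div_times_less_eq_dividend)
    hence "real (?k * 2 ^ (q + 1)) \<le> real K" by (simp only: of_nat_le_iff)
    thus ?thesis by (simp only: x_def of_nat_mult of_nat_power of_nat_numeral) (simp add: le_divide_eq)
  qed
  hence "exp (- x) \<le> exp (real (?k) * (- 1))" by simp
  also have "\<dots> = exp (- 1) ^ (?k)" by (simp only: exp_of_nat_mult)
  also have "\<dots> \<le> (1/2) ^ (?k)" using two by (intro power_mono) auto
  finally have 2: "exp (- x) \<le> (1/2) ^ (?k)" .
  have "x ^ 3 / 27 \<le> exp x"
  proof -
    have "x / 3 \<le> exp (x / 3)" using exp_ge_add_one_self[of "x / 3"] by linarith
    hence "(x / 3) ^ 3 \<le> exp (x / 3) ^ 3" using x by (intro power_mono) auto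
    also have "exp (x / 3) ^ 3 = exp (of_nat 3 * (x / 3))" by (rule exp_of_nat_mult[symmetric])
    finally show ?thesis by (simp add: power_divide)
  qed
  moreover have "real (n * K) \<le> x ^ 3 / 27"
  proof -
    have "real n \<le> real (K * 2 ^ c)" using assms(1) by (simp only: of_nat_le_iff)
    hence "real n * real K \<le> real (K * 2 ^ c) * real K" by (rule mult_right_mono) simp
    hence "real (n * K) \<le> real K ^ 2 * 2 ^ c" by (simp add: power2_eq_square mult_ac)
    hence "real (n * K) * (27 * 2 ^ (3 * q + 3)) \<le> (real K ^ 2 * 2 ^ c) * (32 * 2 ^ (3 * q + 3))"
      by (intro mult_mono) auto
    also have "\<dots> = real K ^ 2 * real (2 ^ (c + 3 * q + 8))" by (simp add: power_add)
    also have "\<dots> \<le> real K ^ 2 * real K"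
      by (rule mult_left_mono) (use assms(2) in \<open>simp_all only: of_nat_le_iff zero_le_power2\<close>)
    also have "\<dots> = (x * 2 ^ (q + 1)) ^ 3" by (simp add: x_def power2_eq_square power3_eq_cube)
    also have "\<dots> = x ^ 3 * 2 ^ ((q + 1) * 3)" by (simp only: power_mult_distrib power_mult)
    also have "(q + 1) * 3 = 3 * q + 3" by simp
    finally have "(real (n * K) * 27) * 2 ^ (3 * q + 3) \<le> x ^ 3 * 2 ^ (3 * q + 3)" by (simp only: mult.assoc)
    hence "real (n * K) * 27 \<le> x ^ 3" by (rule mult_right_le_imp_le) simp
    thus ?thesis by simp
  qed
  ultimately have "real (n * K) \<le> exp x" by linarith
  hence "real (n * K) * (1 - 1 / 2 ^ q) ^ K \<le> exp x * exp (- 2 * x)"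
    using 1 q1 by (intro mult_mono) auto
  also have "\<dots> = exp (- x)" by (simp add: exp_add[symmetric])
  finally show ?thesis using 2 by linarith
qed

text \<open>All losses are factors \<open>2 ^ (k * D)\<close> in which \<open>k\<close> depends only on the exponent \<open>\<delta>\<close> of the
  density \<open>2 ^ (- \<delta>)\<close>.\<close>

definition tconst :: "nat \<Rightarrow> nat" where
  "tconst \<delta> = \<delta> * (4 * \<delta> + 17) + 4 * \<delta> + 20"

definition high_deg :: "('a \<Rightarrow> 'b \<Rightarrow> bool) \<Rightarrow> 'a set \<Rightarrow> nat \<Rightarrow> 'b \<Rightarrow> bool" where
  "high_deg adj A \<delta> b \<longleftrightarrow> card A \<le> 2 ^ \<delta> * card {a \<in> A. adj a b}"

lemma embedding_exists_tconst:
  fixes adj :: "'a \<Rightarrow> 'b \<Rightarrow> bool" and h :: "'x \<Rightarrow> 'y \<Rightarrow> bool"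
  assumes fin: "finite A0" "finite B0" and D: "D \<ge> 1" and m: "m \<ge> 1"
    and deg: "\<And>b. b \<in> B0 \<Longrightarrow> high_deg adj A0 \<delta> b"
    and h: "bounded_bip h X Y D m"
    and size: "m * 2 ^ (tconst \<delta> * D) \<le> card A0" "m * 2 ^ (tconst \<delta> * D) \<le> card B0"
  obtains f g where "embeds h X Y adj A0 B0 f g"
proof -
  have "m * 2 ^ ((\<delta> * (4 * \<delta> + 17) + 2 * \<delta> + 4) * D) \<le> m * 2 ^ (tconst \<delta> * D)"
    by (intro mult_le_mono2 power_increasing mult_le_mono1) (auto simp: tconst_def)
  with size show ?thesis
    using embedding_exists[OF fin D m deg[unfolded high_deg_def] h] that by (meson le_trans)
qed

text \<open>The pool \<open>VV\<close> of vertices that may be exchanged in can exceed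
  \<open>m\<close> by a factor \<open>2 ^ (c * D)\<close>: the union bound over \<open>VV\<close> is
  beaten by a term exponential in \<open>m / 2 ^ (k * D)\<close>, so \<open>c\<close> only raises
  the lower bound on \<open>m\<close>. The bound on high vertices of \<open>B0\<close> guarantees a
  supply of vertices for later exchanges.\<close>

lemma template_exists:
  fixes adj :: "'a \<Rightarrow> 'b \<Rightarrow> bool" and h :: "'x \<Rightarrow> 'y \<Rightarrow> bool"
  assumes fin: "finite A0" "finite B0" "finite VV" and D: "D \<ge> 1"
    and deg: "\<And>b. b \<in> B0 \<Longrightarrow> high_deg adj A0 \<delta> b"
    and h: "bounded_bip h X Y D m"
    and size: "m * 2 ^ (tconst \<delta> * D) \<le> card A0" "m * 2 ^ (tconst \<delta> * D) \<le> card B0"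
    and VV: "card VV \<le> m * 2 ^ (c * D)" and m: "2 ^ ((c + 12 * \<delta> + 44) * D) \<le> m"
  obtains A f g Z where "A \<subseteq> A0" "card A0 \<le> 2 ^ (tconst \<delta> * D) * card A"
    "card B0 \<le> 2 ^ (tconst \<delta> * D) * card {b\<in>B0. high_deg adj A (2 * \<delta> + 4) b}"
    "embeds h X Y adj A B0 f g" "Z \<subseteq> g ` Y" "m \<le> 2 ^ (tconst \<delta> * D) * card Z"
    "\<forall>b\<in>Z. high_deg adj A (2 * \<delta> + 4) b"
    "\<forall>E Q. E \<subseteq> Z \<and> Q \<subseteq> VV \<and> card Q = card E \<and> card E * 2 ^ (tconst \<delta> * D) \<le> m \<and> Q \<inter> g ` Y = {}
        \<and> (\<forall>q\<in>Q. high_deg adj A (2 * \<delta> + 4) q) \<longrightarrow>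
       (\<exists>g'. embeds h X Y adj A (B0 \<union> Q) f g' \<and> g' ` Y = (g ` Y - E) \<union> Q)"
proof -
  have m1: "m \<ge> 1" using m by (meson le_trans one_le_numeral one_le_power)
  have ne: "A0 \<noteq> {}" "B0 \<noteq> {}" using size m1 by auto
  obtain A where A: "A \<subseteq> A0" "rich_host adj A B0 \<delta> D"
      "card A0 \<le> 2 ^ (\<delta> * (4 * \<delta> + 17) * D + 1) * card A"
    using rich_host_exists[OF fin(1,2) ne D deg[unfolded high_deg_def]] .
  interpret rich_host adj A B0 \<delta> D by fact
  have high: "high_deg adj A (2 * \<delta> + 4) = high" by (auto simp: high_deg_def high_def fun_eq_iff)
  have D2: "D < 2 ^ D" by simp
  have D4: "D ^ 4 + 1 \<le> 2 ^ (4 * D)"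
  proof -
    have "D ^ 4 < (2 ^ D) ^ 4" using D2 by (intro power_strict_mono) auto
    thus ?thesis by (simp add: power_mult[symmetric] mult.commute)
  qed
  define q where "q = (4 * \<delta> + 5) * D + 3"
  \<comment> \<open>By \<open>far_subset\<close> at least \<open>m / (D ^ 4 + 1)\<close> slots are
    pairwise far apart; \<open>2 * K\<close> of them are needed.\<close>
  define K where "K = m div (2 * (D ^ 4 + 1))"
  define M where "M = K div 2 ^ (q + 1)"
  have "2 * K * (D ^ 4 + 1) = 2 * (D ^ 4 + 1) * K" by (simp only: mult_ac)
  also have "\<dots> \<le> m" unfolding K_def by (rule times_div_less_eq_dividend)
  finally have K: "2 * K * (D ^ 4 + 1) \<le> m" .
  have exps: "4 * D + 2 + (c * D + (4 * D + 2) + 3 * q + 8) \<le> (c + 12 * \<delta> + 44) * D"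
  proof -
    have "4 * D + 2 + (c * D + (4 * D + 2) + 3 * q + 8) = (c + 12 * \<delta> + 23) * D + 21"
      by (simp add: q_def algebra_simps)
    also have "\<dots> \<le> (c + 12 * \<delta> + 23) * D + 21 * D" using D by simp
    also have "\<dots> = (c + 12 * \<delta> + 44) * D" by (simp add: algebra_simps)
    finally show ?thesis .
  qed
  have mK: "m \<le> K * 2 ^ (4 * D + 2)"
  proof -
    have "2 * (D ^ 4 + 1) \<le> 2 * 2 ^ (4 * D)" using D4 by simp
    also have "\<dots> = 2 ^ (4 * D + 1)" by simp
    also have "\<dots> \<le> 2 ^ ((c + 12 * \<delta> + 44) * D)" using exps by (intro power_increasing) auto
    finally have "2 * (D ^ 4 + 1) \<le> m" using m by linarith
    hence "K \<ge> 1" unfolding K_def by (simp add: less_eq_div_iff_mult_less_eq)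
    have "m < 2 * (D ^ 4 + 1) * K + 2 * (D ^ 4 + 1)"
      unfolding K_def using dividend_less_times_div[of "2 * (D ^ 4 + 1)" m] by simp
    also have "\<dots> \<le> 2 * (D ^ 4 + 1) * K + 2 * (D ^ 4 + 1) * K" using mult_le_mono2[OF \<open>K \<ge> 1\<close>, of "2 * (D ^ 4 + 1)"] by linarith
    also have "\<dots> = (D ^ 4 + 1) * (4 * K)" by simp
    also have "\<dots> \<le> 2 ^ (4 * D) * (4 * K)" using D4 by (rule mult_le_mono1)
    finally show ?thesis by (simp add: power_add mult_ac)
  qed
  have cA: "m * 2 ^ ((2 * \<delta> + 10) * D) \<le> card A"
  proof -
    have "2 ^ (\<delta> * (4 * \<delta> + 17) * D + 1) * (m * 2 ^ ((2 * \<delta> + 10) * D)) = m * 2 ^ (\<delta> * (4 * \<delta> + 17) * D + 1 + (2 * \<delta> + 10) * D)"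
      by (simp add: power_add mult_ac)
    also have "\<dots> \<le> m * 2 ^ (tconst \<delta> * D)"
    proof (intro mult_le_mono2 power_increasing)
      have "\<delta> * (4 * \<delta> + 17) * D + 1 + (2 * \<delta> + 10) * D \<le> \<delta> * (4 * \<delta> + 17) * D + D + (2 * \<delta> + 10) * D" using D by simp
      also have "\<dots> = (\<delta> * (4 * \<delta> + 17) + 2 * \<delta> + 11) * D" by (simp add: algebra_simps)
      also have "\<dots> \<le> tconst \<delta> * D" by (intro mult_le_mono1) (simp add: tconst_def)
      finally show "\<delta> * (4 * \<delta> + 17) * D + 1 + (2 * \<delta> + 10) * D \<le> tconst \<delta> * D" .
    qed simp
    also have "\<dots> \<le> 2 ^ (\<delta> * (4 * \<delta> + 17) * D + 1) * card A" using size(1) A(3) by linarith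
    finally show ?thesis by (rule mult_left_le_imp_le) simp
  qed
  have sA: "(m * D + D) * D * 2 ^ ((2 * \<delta> + 4) * D + 3) \<le> card A"
  proof -
    have "m * D + D \<le> m * D * 2" using m1 by simp
    hence "(m * D + D) * D * 2 ^ ((2 * \<delta> + 4) * D + 3) \<le> (m * D * 2) * D * 2 ^ ((2 * \<delta> + 4) * D + 3)"
      by (intro mult_le_mono1)
    also have "\<dots> = m * (D * D * 2 ^ ((2 * \<delta> + 4) * D + 4))" by (simp add: power_add)
    also have "\<dots> \<le> m * (2 ^ D * 2 ^ D * 2 ^ ((2 * \<delta> + 4) * D + 4))"
      using D2 by (intro mult_le_mono) auto
    also have "\<dots> = m * 2 ^ (D + D + (2 * \<delta> + 4) * D + 4)" by (simp only: power_add mult.assoc)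
    also have "\<dots> \<le> m * 2 ^ ((2 * \<delta> + 10) * D)"
      using D by (intro mult_le_mono2 power_increasing) (auto simp: algebra_simps)
    also note cA
    finally show ?thesis .
  qed
  have "2 ^ ((2 * \<delta> + 1) * D + 1) * m \<le> m * 2 ^ (tconst \<delta> * D)"
  proof -
    have "(2 * \<delta> + 1) * D + 1 \<le> (2 * \<delta> + 1) * D + 1 * D" using D by simp
    also have "\<dots> = (2 * \<delta> + 2) * D" by (simp add: algebra_simps)
    also have "\<dots> \<le> tconst \<delta> * D" by (intro mult_le_mono1) (simp add: tconst_def)
    finally have "2 ^ ((2 * \<delta> + 1) * D + 1) \<le> (2::nat) ^ (tconst \<delta> * D)" by (rule power_increasing) simp
    thus ?thesis by (simp add: mult.commute)
  qed
  with size(2) have sB: "2 ^ ((2 * \<delta> + 1) * D + 1) * m \<le> card B0" by linarith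
  have "card VV * K * (1 - 1 / 2 ^ q) ^ K \<le> (1 / 2 :: real) ^ (K div 2 ^ (q + 1))"
  proof (rule exp_dominates)
    have "card VV \<le> K * 2 ^ (4 * D + 2) * 2 ^ (c * D)" using VV mK by (meson le_trans mult_le_mono1)
    thus "card VV \<le> K * 2 ^ (c * D + (4 * D + 2))" by (simp add: power_add mult_ac)
    have "(2::nat) ^ (4 * D + 2 + (c * D + (4 * D + 2) + 3 * q + 8)) \<le> 2 ^ ((c + 12 * \<delta> + 44) * D)"
      using exps by (rule power_increasing) simp
    also note m also note mK
    finally have "2 ^ (4 * D + 2) * 2 ^ (c * D + (4 * D + 2) + 3 * q + 8) \<le> K * 2 ^ (4 * D + 2)"
      unfolding power_add[of 2 "4 * D + 2" "c * D + (4 * D + 2) + 3 * q + 8"] .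
    hence "2 ^ (4 * D + 2) * 2 ^ (c * D + (4 * D + 2) + 3 * q + 8) \<le> 2 ^ (4 * D + 2) * K"
      by (subst (2) mult.commute)
    thus "2 ^ (c * D + (4 * D + 2) + 3 * q + 8) \<le> K" by (rule mult_left_le_imp_le) simp
  qed
  hence VVK: "card VV * K * (1 - 1 / 2 ^ ((4 * \<delta> + 5) * D + 3)) ^ K \<le> (1 / 2 :: real) ^ M"
    by (simp add: q_def M_def)
  obtain f g Z where fg: "embeds h X Y adj A B0 f g" "Z \<subseteq> g ` Y" "card Z = K" "\<forall>b\<in>Z. high b"
    "\<forall>E Q. E \<subseteq> Z \<and> Q \<subseteq> VV \<and> card Q = card E \<and> card E \<le> M \<and> Q \<inter> g ` Y = {} \<and> (\<forall>q\<in>Q. high q) \<longrightarrow>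
       (\<exists>g'. embeds h X Y adj A (B0 \<union> Q) f g' \<and> g' ` Y = (g ` Y - E) \<union> Q)"
    by (rule template[OF h K sA sB ne(2) fin(3) VVK])
  have EM: "e \<le> M" if "e * 2 ^ (tconst \<delta> * D) \<le> m" for e
  proof -
    have "4 * D + 2 + (q + 1) \<le> tconst \<delta> * D"
    proof -
      have "4 * D + 2 + (q + 1) = (4 * \<delta> + 9) * D + 6" by (simp add: q_def algebra_simps)
      also have "\<dots> \<le> (4 * \<delta> + 9) * D + 6 * D" using D by simp
      also have "\<dots> = (4 * \<delta> + 15) * D" by (simp add: algebra_simps)
      also have "\<dots> \<le> tconst \<delta> * D" by (intro mult_le_mono1) (simp add: tconst_def)
      finally show ?thesis .
    qed
    hence "(2::nat) ^ (4 * D + 2 + (q + 1)) \<le> 2 ^ (tconst \<delta> * D)" by (rule power_increasing) simp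
    hence "e * 2 ^ (4 * D + 2 + (q + 1)) \<le> e * 2 ^ (tconst \<delta> * D)" by (rule mult_le_mono2)
    also note that also note mK
    finally have "2 ^ (4 * D + 2) * (e * 2 ^ (q + 1)) \<le> 2 ^ (4 * D + 2) * K" by (simp only: power_add mult_ac)
    hence "e * 2 ^ (q + 1) \<le> K" by (rule mult_left_le_imp_le) simp
    thus ?thesis by (simp add: M_def less_eq_div_iff_mult_less_eq)
  qed
  \<comment> \<open>If high vertices were few, all of them could be forbidden as the set
    \<open>W\<close> in \<open>exists_high_star\<close>, which would still produce one.\<close>
  have hB: "card B0 \<le> 2 ^ (tconst \<delta> * D) * card {b\<in>B0. high b}"
  proof (rule ccontr)
    assume neg: "\<not> ?thesis"
    have "(2 * \<delta> + 1) * D + 1 \<le> (2 * \<delta> + 1) * D + 1 * D" using D by simp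
    also have "\<dots> = (2 * \<delta> + 2) * D" by (simp add: algebra_simps)
    also have "\<dots> \<le> tconst \<delta> * D" by (intro mult_le_mono1) (simp add: tconst_def)
    finally have "2 ^ ((2 * \<delta> + 1) * D + 1) \<le> (2::nat) ^ (tconst \<delta> * D)" by (rule power_increasing) simp
    hence "2 ^ ((2 * \<delta> + 1) * D + 1) * card {b\<in>B0. high b} \<le> 2 ^ (tconst \<delta> * D) * card {b\<in>B0. high b}"
      by (rule mult_le_mono1)
    also have "\<dots> \<le> card B0" using neg by linarith
    finally have W: "2 ^ ((2 * \<delta> + 1) * D + 1) * card {b\<in>B0. high b} \<le> card B0" .
    have "D * 1 \<le> m * D + D" by simp
    hence "(card ({}::'a set) + D) * D * 2 ^ ((2 * \<delta> + 4) * D + 3) \<le> (m * D + D) * D * 2 ^ ((2 * \<delta> + 4) * D + 3)"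
      by (intro mult_le_mono1) simp
    with sA have s0: "(card ({}::'a set) + D) * D * 2 ^ ((2 * \<delta> + 4) * D + 3) \<le> card A" by linarith
    obtain a b where "a \<in> avail {}" "b \<in> cnb adj B0 (set a)" "b \<notin> {b\<in>B0. high b}" "high b"
      by (rule exists_high_star[OF empty_subsetI s0 _ W ne(2)]) (use fin in auto)
    thus False using cnb_subset[of adj B0 "set a"] by auto
  qed
  have mZ: "m \<le> 2 ^ (tconst \<delta> * D) * card Z"
  proof -
    have "4 * D + 2 \<le> tconst \<delta> * D"
    proof -
      have "4 * D + 2 \<le> 6 * D" using D by simp
      also have "\<dots> \<le> tconst \<delta> * D" by (intro mult_le_mono1) (simp add: tconst_def)
      finally show ?thesis .
    qed
    hence "(2::nat) ^ (4 * D + 2) \<le> 2 ^ (tconst \<delta> * D)" by (rule power_increasing) simp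
    hence "K * 2 ^ (4 * D + 2) \<le> K * 2 ^ (tconst \<delta> * D)" by (rule mult_le_mono2)
    with mK have "m \<le> K * 2 ^ (tconst \<delta> * D)" by (rule le_trans)
    thus ?thesis by (simp only: fg(3) mult.commute)
  qed
  have cA0: "card A0 \<le> 2 ^ (tconst \<delta> * D) * card A"
  proof -
    have "\<delta> * (4 * \<delta> + 17) * D + 1 \<le> \<delta> * (4 * \<delta> + 17) * D + 1 * D" using D by simp
    also have "\<dots> = (\<delta> * (4 * \<delta> + 17) + 1) * D" by (simp add: algebra_simps)
    also have "\<dots> \<le> tconst \<delta> * D" by (intro mult_le_mono1) (simp add: tconst_def)
    finally have "(2::nat) ^ (\<delta> * (4 * \<delta> + 17) * D + 1) \<le> 2 ^ (tconst \<delta> * D)" by (rule power_increasing) simp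
    thus ?thesis using A(3) by (meson le_trans mult_le_mono1)
  qed
  show ?thesis
    by (rule that[of A f g Z]) (use A(1) cA0 hB fg mZ EM high in auto)
qed

subsection \<open>Tilings\<close>

definition tileable :: "(nat set \<Rightarrow> nat) \<Rightarrow> (nat \<Rightarrow> graph) \<Rightarrow> nat set \<Rightarrow> nat \<Rightarrow> bool" where
  "tileable c F U k \<longleftrightarrow> (\<exists>T. mono_tiling F (complete_graph U) c T \<and> card T \<le> k)"

lemma subgraph_complete_iff: "subgraph H (complete_graph U) \<longleftrightarrow> simple_graph H \<and> verts H \<subseteq> U"
  by (auto simp: subgraph_def complete_graph_def simple_graph_def nsets_def)

lemma verts_complete_graph: "verts (complete_graph U) = U"
  by (simp add: complete_graph_def)

lemma tileable_mono: "tileable c F U k \<Longrightarrow> k \<le> l \<Longrightarrow> tileable c F U l"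
  by (auto simp: tileable_def intro: le_trans)

lemma tileable_empty: "tileable c F {} 0"
  unfolding tileable_def by (rule exI[of _ "{}"]) (auto simp: mono_tiling_def complete_graph_def disjoint_family_on_def)

lemma tileable_Un:
  assumes "tileable c F U k" "tileable c F W l" "U \<inter> W = {}"
  shows "tileable c F (U \<union> W) (k + l)"
proof -
  obtain T where T: "mono_tiling F (complete_graph U) c T" "card T \<le> k" using assms by (auto simp: tileable_def)
  obtain S where S: "mono_tiling F (complete_graph W) c S" "card S \<le> l" using assms by (auto simp: tileable_def)
  have TU: "verts H \<subseteq> U" if "H \<in> T" for H using T that by (auto simp: mono_tiling_def subgraph_complete_iff)
  have SW: "verts H \<subseteq> W" if "H \<in> S" for H using S that by (auto simp: mono_tiling_def subgraph_complete_iff)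
  have "disjoint_family_on verts (T \<union> S)"
    unfolding disjoint_family_on_def
  proof (intro ballI impI)
    fix H H' assume *: "H \<in> T \<union> S" "H' \<in> T \<union> S" "H \<noteq> H'"
    consider "H \<in> T" "H' \<in> T" | "H \<in> S" "H' \<in> S" | "H \<in> T" "H' \<in> S" | "H \<in> S" "H' \<in> T" using * by blast
    thus "verts H \<inter> verts H' = {}"
    proof cases
      case 1 thus ?thesis using T *(3) by (auto simp: mono_tiling_def disjoint_family_on_def)
    next
      case 2 thus ?thesis using S *(3) by (auto simp: mono_tiling_def disjoint_family_on_def)
    next
      case 3 thus ?thesis using TU[of H] SW[of H'] assms(3) by blast
    next
      case 4 thus ?thesis using TU[of H'] SW[of H] assms(3) by blast
    qed
  qed
  moreover have "(\<Union>H \<in> T \<union> S. verts H) = U \<union> W"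
    using T S by (auto simp: mono_tiling_def verts_complete_graph)
  ultimately have "mono_tiling F (complete_graph (U \<union> W)) c (T \<union> S)"
    using T S by (auto simp: mono_tiling_def subgraph_complete_iff verts_complete_graph)
  moreover have "card (T \<union> S) \<le> k + l" using card_Un_le[of T S] T S by linarith
  ultimately show ?thesis unfolding tileable_def by blast
qed

lemma tileable_image:
  assumes G: "simple_graph (F i)" "i \<ge> 1" and inj: "inj_on \<phi> (verts (F i))"
    and col: "\<And>e. e \<in> edges (F i) \<Longrightarrow> c (\<phi> ` e) = k"
  shows "tileable c F (\<phi> ` verts (F i)) 1"
proof -
  let ?V = "verts (F i)"
  define H where "H = \<lparr>verts = \<phi> ` ?V, edges = (`) \<phi> ` edges (F i)\<rparr>"
  have verts_H: "verts H = \<phi> ` ?V" by (simp add: H_def)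
  have E: "e \<subseteq> ?V" "card e = 2" "finite e" if "e \<in> edges (F i)" for e
    using that G by (auto simp: simple_graph_def nsets_def)
  have ce: "card (\<phi> ` e) = 2" if "e \<in> edges (F i)" for e
    using E[OF that] card_image[OF inj_on_subset[OF inj]] by auto
  have "simple_graph H"
    unfolding simple_graph_def
  proof
    show "finite (verts H)" using G by (simp add: H_def simple_graph_def)
    show "edges H \<subseteq> [verts H]\<^bsup>2\<^esup>" using E ce by (auto simp: H_def nsets_def)
  qed
  moreover have "monochromatic c H" using col by (auto simp: monochromatic_def H_def)
  moreover have "isomorphic (F i) H"
    unfolding isomorphic_def
  proof (intro exI[of _ \<phi>] conjI ballI)
    show "bij_betw \<phi> (?V) (verts H)" using inj by (simp add: H_def bij_betw_def)
    fix u v assume uv: "u \<in> ?V" "v \<in> ?V"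
    show "{u, v} \<in> edges (F i) \<longleftrightarrow> {\<phi> u, \<phi> v} \<in> edges H"
    proof
      assume "{u, v} \<in> edges (F i)"
      thus "{\<phi> u, \<phi> v} \<in> edges H" by (auto simp: H_def intro!: image_eqI[of _ _ "{u, v}"])
    next
      assume "{\<phi> u, \<phi> v} \<in> edges H"
      then obtain e where e: "e \<in> edges (F i)" "\<phi> ` {u, v} = \<phi> ` e" by (auto simp: H_def)
      hence "{u, v} = e" using inj_on_image_eq_iff[OF inj, of "{u, v}" e] E uv by auto
      thus "{u, v} \<in> edges (F i)" using e by simp
    qed
  qed
  ultimately have "mono_tiling F (complete_graph (\<phi> ` ?V)) c {H}"
    using G(2) unfolding mono_tiling_def
    by (auto simp: subgraph_complete_iff disjoint_family_on_def verts_complete_graph verts_H)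
  thus ?thesis unfolding tileable_def by (intro exI[of _ "{H}"]) simp
qed

text \<open>Every single vertex is a copy of \<open>F 1\<close>. This disposes of all leftovers
  whose number is exponential in \<open>D\<close>.\<close>

lemma tileable_card:
  assumes F: "bipartite_bounded_seq \<Delta> F" and "finite U"
  shows "tileable c F U (card U)"
  using \<open>finite U\<close>
proof (induction U)
  case empty
  show ?case using tileable_empty by simp
next
  case (insert v U)
  have F1: "simple_graph (F 1)" "card (verts (F 1)) = 1" using F by (auto simp: bipartite_bounded_seq_def)
  then obtain w where w: "verts (F 1) = {w}" by (auto simp: card_1_singleton_iff)
  have noedge: "e \<notin> edges (F 1)" for e
  proof
    assume "e \<in> edges (F 1)"
    hence "e \<subseteq> {w}" "card e = 2" using F1 w by (auto simp: simple_graph_def nsets_def)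
    thus False using card_mono[of "{w}" e] by simp
  qed
  have "tileable c F ((\<lambda>_. v) ` verts (F 1)) 1"
    by (rule tileable_image[of F 1]) (use F1(1) noedge w in auto)
  hence "tileable c F {v} 1" unfolding w by simp
  from tileable_Un[OF this insert.IH] insert.hyps show ?case by simp
qed

text \<open>A copy of \<open>F m\<close> with parts \<open>P\<close>, \<open>Q\<close> together with a copy with the parts interchanged is a
  bipartite graph with \<open>m\<close> vertices on either side, whatever the sizes of \<open>P\<close> and \<open>Q\<close> are.\<close>

lemma balanced_double:
  assumes F: "bipartite_bounded_seq \<Delta> F" and m: "m \<ge> 1"
  obtains h and X Y :: "(bool \<times> nat) set" where "bounded_bip h X Y \<Delta> m"
    "\<forall>c k A B f g. embeds h X Y (\<lambda>a b. c {a, b} = k) A B f g \<and> A \<inter> B = {} \<longrightarrow> tileable c F (f ` X \<union> g ` Y) 2"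
proof -
  define G where "G = F m"
  have G: "simple_graph G" "bipartite G" "card (verts G) = m" "max_degree G \<le> \<Delta>"
    using F m by (auto simp: bipartite_bounded_seq_def G_def)
  obtain P Q where PQ: "P \<union> Q = verts G" "P \<inter> Q = {}" "\<forall>e \<in> edges G. \<exists>a \<in> P. \<exists>b \<in> Q. e = {a, b}"
    using G(2) by (auto simp: bipartite_def)
  have fin: "finite (verts G)" "finite P" "finite Q" "finite (edges G)"
  proof -
    show f: "finite (verts G)" using G(1) by (simp add: simple_graph_def)
    thus "finite P" "finite Q" using PQ(1) by (metis finite_Un)+
    have "edges G \<subseteq> Pow (verts G)" using G(1) by (auto simp: simple_graph_def nsets_def)
    thus "finite (edges G)" using f finite_subset by blast
  qed
  define h where "h = (\<lambda>(s::bool, u) (s', v). s = s' \<and> {u, v} \<in> edges G)"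
  define X where "X = {False} \<times> P \<union> {True} \<times> Q"
  define Y where "Y = {False} \<times> Q \<union> {True} \<times> P"
  have deg: "card {v. {u, v} \<in> edges G} \<le> \<Delta>" if "u \<in> verts G" for u
  proof -
    have "(\<lambda>v. {u, v}) ` {v. {u, v} \<in> edges G} \<subseteq> {e \<in> edges G. u \<in> e}" by auto
    moreover have "inj_on (\<lambda>v. {u, v}) {v. {u, v} \<in> edges G}" by (auto simp: inj_on_def doubleton_eq_iff)
    ultimately have "card {v. {u, v} \<in> edges G} \<le> degree G u"
      unfolding degree_def using fin by (intro card_inj_on_le) auto
    also have "\<dots> \<le> max_degree G" unfolding max_degree_def using that fin by (intro Max_ge) auto
    finally show ?thesis using G(4) by simp
  qed
  have nb: "finite {v. {u, v} \<in> edges G}" for u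
  proof (rule finite_subset[OF _ fin(1)])
    show "{v. {u, v} \<in> edges G} \<subseteq> verts G" using G(1) by (auto simp: simple_graph_def nsets_def)
  qed
  have degX: "card {y\<in>Y. h x y} \<le> \<Delta>" if "x \<in> X" for x
  proof -
    have "{y\<in>Y. h x y} \<subseteq> (\<lambda>v. (fst x, v)) ` {v. {snd x, v} \<in> edges G}" by (auto simp: h_def)
    hence "card {y\<in>Y. h x y} \<le> card ((\<lambda>v. (fst x, v)) ` {v. {snd x, v} \<in> edges G})"
      using nb by (intro card_mono) auto
    also have "\<dots> \<le> card {v. {snd x, v} \<in> edges G}" by (rule card_image_le[OF nb])
    also have "\<dots> \<le> \<Delta>" using that PQ by (intro deg) (auto simp: X_def)
    finally show ?thesis .
  qed
  have degY: "card {x\<in>X. h x y} \<le> \<Delta>" if "y \<in> Y" for y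
  proof -
    have "{x\<in>X. h x y} \<subseteq> (\<lambda>v. (fst y, v)) ` {v. {snd y, v} \<in> edges G}"
      by (auto simp: h_def insert_commute)
    hence "card {x\<in>X. h x y} \<le> card ((\<lambda>v. (fst y, v)) ` {v. {snd y, v} \<in> edges G})"
      using nb by (intro card_mono) auto
    also have "\<dots> \<le> card {v. {snd y, v} \<in> edges G}" by (rule card_image_le[OF nb])
    also have "\<dots> \<le> \<Delta>" using that PQ by (intro deg) (auto simp: Y_def)
    finally show ?thesis .
  qed
  have cPQ: "card P + card Q = m" using G(3) PQ card_Un_disjoint[OF fin(2,3)] by simp
  have "card X = m" "card Y = m"
    unfolding X_def Y_def using fin cPQ by (subst card_Un_disjoint; auto simp: card_cartesian_product)+
  hence bip: "bounded_bip h X Y \<Delta> m" using fin degX degY by (auto simp: bounded_bip_def X_def Y_def)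
  have tile: "tileable c F (f ` X \<union> g ` Y) 2"
    if emb: "embeds h X Y (\<lambda>a b. c {a, b} = k) A B f g" and AB: "A \<inter> B = {}" for c k A B f g
  proof -
    note emb' = emb[unfolded embeds_def]
    define \<phi> where "\<phi> = (\<lambda>s u. if u \<in> (if s then Q else P) then f (s, u) else g (s, u))"
    have one: "tileable c F (\<phi> s ` verts (F m)) 1" for s
    proof (rule tileable_image[OF _ m])
      show "simple_graph (F m)" using G by (simp add: G_def)
      show "inj_on (\<phi> s) (verts (F m))"
      proof (rule inj_onI)
        fix u v assume uv: "u \<in> verts (F m)" "v \<in> verts (F m)" "\<phi> s u = \<phi> s v"
        have mem: "(s, w) \<in> X" if "w \<in> (if s then Q else P)" for w using that by (auto simp: X_def split: if_splits)
        have mem': "(s, w) \<in> Y" if "w \<in> verts (F m)" "w \<notin> (if s then Q else P)" for w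
          using that PQ by (auto simp: Y_def G_def split: if_splits)
        have "f ` X \<subseteq> A" "g ` Y \<subseteq> B" using emb' by auto
        hence fg: "f x \<noteq> g y" if "x \<in> X" "y \<in> Y" for x y using AB that by blast
        show "u = v"
          using uv mem[of u] mem[of v] mem'[of u] mem'[of v] fg[of "(s, u)" "(s, v)"] fg[of "(s, v)" "(s, u)"]
            emb' unfolding \<phi>_def by (auto split: if_splits dest: inj_onD)
      qed
      fix e assume "e \<in> edges (F m)"
      then obtain a b where ab: "a \<in> P" "b \<in> Q" "e = {a, b}" using PQ(3) by (auto simp: G_def)
      have e: "{a, b} \<in> edges G" "{b, a} \<in> edges G"
        using ab(3) \<open>e \<in> edges (F m)\<close> by (auto simp: G_def insert_commute)
      have nin: "a \<notin> Q" "b \<notin> P" using ab PQ(2) by auto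
      show "c (\<phi> s ` e) = k"
      proof (cases s)
        case True
        have "c {f (True, b), g (True, a)} = k"
          using emb' ab e by (auto simp: X_def Y_def h_def)
        thus ?thesis using True ab nin by (simp add: \<phi>_def insert_commute)
      next
        case False
        have "c {f (False, a), g (False, b)} = k"
          using emb' ab e by (auto simp: X_def Y_def h_def)
        thus ?thesis using False ab nin by (simp add: \<phi>_def insert_commute)
      qed
    qed
    have im: "\<phi> False ` verts (F m) = f ` ({False} \<times> P) \<union> g ` ({False} \<times> Q)"
      "\<phi> True ` verts (F m) = f ` ({True} \<times> Q) \<union> g ` ({True} \<times> P)"
      using PQ(1,2) unfolding \<phi>_def G_def by (auto simp: image_iff)
    have "\<phi> False ` verts (F m) \<inter> \<phi> True ` verts (F m) = {}"
    proof -
      have "f ` ({False} \<times> P) \<inter> f ` ({True} \<times> Q) = f ` (({False} \<times> P) \<inter> ({True} \<times> Q))"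
        by (rule inj_on_image_Int[symmetric, of f X]) (use emb' in \<open>auto simp: X_def\<close>)
      hence 1: "f ` ({False} \<times> P) \<inter> f ` ({True} \<times> Q) = {}" by auto
      have "g ` ({False} \<times> Q) \<inter> g ` ({True} \<times> P) = g ` (({False} \<times> Q) \<inter> ({True} \<times> P))"
        by (rule inj_on_image_Int[symmetric, of g Y]) (use emb' in \<open>auto simp: Y_def\<close>)
      hence 2: "g ` ({False} \<times> Q) \<inter> g ` ({True} \<times> P) = {}" by auto
      have "f ` X \<subseteq> A" "g ` Y \<subseteq> B" using emb' by auto
      hence "f ` X \<inter> g ` Y = {}" using AB by blast
      hence 3: "(f ` ({False} \<times> P) \<union> f ` ({True} \<times> Q)) \<inter> (g ` ({False} \<times> Q) \<union> g ` ({True} \<times> P)) = {}"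
        by (simp only: X_def Y_def image_Un)
      have "(S1 \<union> T1) \<inter> (S2 \<union> T2) = {}"
        if "S1 \<inter> S2 = {}" "T1 \<inter> T2 = {}" "(S1 \<union> S2) \<inter> (T1 \<union> T2) = {}" for S1 S2 T1 T2 :: "nat set"
        using that by blast
      from this[OF 1 2 3] show ?thesis unfolding im .
    qed
    from tileable_Un[OF one one this] have "tileable c F (\<phi> False ` verts (F m) \<union> \<phi> True ` verts (F m)) 2"
      by (simp only: one_add_one)
    also have "\<phi> False ` verts (F m) \<union> \<phi> True ` verts (F m) = f ` X \<union> g ` Y"
      unfolding im X_def Y_def by (simp only: image_Un Un_ac)
    finally show ?thesis .
  qed
  show ?thesis by (rule that[of h X Y]) (use bip tile in blast)+
qed

text \<open>Doubled tiles take equally many vertices from both sides, so \<open>A'\<close> is as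
  large as \<open>R\<close> except for vertices tiled singly. Knowing \<open>card A'\<close> up to
  \<open>T\<close> allows the vertices taken from a template to be replaced, and
  \<open>card A' \<le> card R\<close> keeps successive coverings from exhausting
  \<open>A\<close>.\<close>

definition covers where
  "covers c F R A T \<longleftrightarrow> (\<exists>A'\<subseteq>A. card A' \<le> card R \<and> card R \<le> card A' + T \<and> tileable c F (R \<union> A') T)"

lemma covers_empty: "covers c F {} A 0"
  unfolding covers_def by (rule exI[of _ "{}"]) (use tileable_empty in auto)

lemma covers_card:
  assumes "bipartite_bounded_seq \<Delta> F" "finite R" "card R \<le> T"
  shows "covers c F R A T"
  unfolding covers_def
  by (rule exI[of _ "{}"]) (use assms tileable_mono[OF tileable_card[OF assms(1,2)]] in auto)

subsection \<open>Covering a small set with the help of a large one\<close>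

text \<open>After \<open>n\<close> steps that each keep at most a share \<open>1 - 1 / n\<close>, at
  most half remains; this is Bernoulli's inequality for \<open>1 + 1 / (n - 1)\<close>.\<close>

lemma twice_pred_power_le: "2 * (n - 1) ^ n \<le> (n::nat) ^ n" if "n \<ge> 1"
proof (cases "n = 1")
  case False
  define k where "k = n - 1"
  have k: "k \<ge> 1" "n = k + 1" using that False by (auto simp: k_def)
  have "2 \<le> 1 + real n * (1 / k)" using k by (simp add: field_simps)
  also have "\<dots> \<le> (1 + 1 / k) ^ n" by (rule Bernoulli_inequality) (simp add: divide_nonneg_nonneg order_trans[of _ 0])
  finally have "2 * real k ^ n \<le> (1 + 1 / k) ^ n * real k ^ n" by (intro mult_right_mono) auto
  also have "\<dots> = ((1 + 1 / k) * k) ^ n" by (rule power_mult_distrib[symmetric])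
  also have "(1 + 1 / real k) * k = n" using k by (simp add: field_simps)
  finally have "real (2 * k ^ n) \<le> real (n ^ n)" by simp
  thus ?thesis unfolding of_nat_le_iff k_def .
qed simp

text \<open>Each block of \<open>N\<close> steps halves the uncovered set, so \<open>N * b\<close>
  steps of two tiles each suffice. A step is possible only while at least \<open>M\<close> elements
  remain; if it fails earlier, \<open>large\<close> already gives the conclusion.\<close>

lemma iterated_covering:
  fixes \<Phi> :: "'s set \<Rightarrow> nat \<Rightarrow> bool"
  assumes start: "\<Phi> {} 0" and N: "N \<ge> 1" and R: "finite R"
    and step: "\<And>S k. S \<subseteq> R \<Longrightarrow> \<Phi> S k \<Longrightarrow> M \<le> card (R - S) \<Longrightarrow>
       \<exists>S'. S' \<subseteq> R \<and> \<Phi> S' (k + 2) \<and> N * card (R - S') \<le> (N - 1) * card (R - S)"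
    and large: "M * 2 ^ b \<le> card R"
  obtains S k where "S \<subseteq> R" "k \<le> 2 * (N * b)" "\<Phi> S k" "card (R - S) * 2 ^ b \<le> card R"
proof -
  have "\<exists>S k. S \<subseteq> R \<and> k \<le> 2 * s \<and> \<Phi> S k \<and> (card (R - S) < M \<or> N ^ s * card (R - S) \<le> (N - 1) ^ s * card R)" for s
  proof (induction s)
    case 0
    show ?case by (rule exI[of _ "{}"], rule exI[of _ 0]) (use start in simp)
  next
    case (Suc s)
    then obtain S k where S: "S \<subseteq> R" "k \<le> 2 * s" "\<Phi> S k"
      "card (R - S) < M \<or> N ^ s * card (R - S) \<le> (N - 1) ^ s * card R" by blast
    show ?case
    proof (cases "card (R - S) < M")
      case True
      thus ?thesis using S by (intro exI[of _ S] exI[of _ k]) simp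
    next
      case False
      with step[OF S(1,3)] obtain S' where S': "S' \<subseteq> R" "\<Phi> S' (k + 2)"
        "N * card (R - S') \<le> (N - 1) * card (R - S)" by auto
      have "N ^ Suc s * card (R - S') = N ^ s * (N * card (R - S'))" by simp
      also have "\<dots> \<le> N ^ s * ((N - 1) * card (R - S))" using S'(3) by (rule mult_le_mono2)
      also have "\<dots> = (N - 1) * (N ^ s * card (R - S))" by simp
      also have "\<dots> \<le> (N - 1) * ((N - 1) ^ s * card R)" using S(4) False by (intro mult_le_mono2) simp
      finally have "N ^ Suc s * card (R - S') \<le> (N - 1) ^ Suc s * card R" by simp
      thus ?thesis using S' S(2) by (intro exI[of _ S'] exI[of _ "k + 2"]) simp
    qed
  qed
  from this[of "N * b"] obtain S k where S: "S \<subseteq> R" "k \<le> 2 * (N * b)" "\<Phi> S k"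
    "card (R - S) < M \<or> N ^ (N * b) * card (R - S) \<le> (N - 1) ^ (N * b) * card R" by blast
  have "card (R - S) * 2 ^ b \<le> card R"
  proof (cases "card (R - S) < M")
    case True
    hence "card (R - S) * 2 ^ b \<le> M * 2 ^ b" by simp
    with large show ?thesis by linarith
  next
    case False
    have "(2 * (N - 1) ^ N) ^ b \<le> (N ^ N) ^ b" using twice_pred_power_le[OF N] by (intro power_mono) auto
    hence pw: "2 ^ b * (N - 1) ^ (N * b) \<le> N ^ (N * b)" by (simp add: power_mult power_mult_distrib)
    have "N ^ (N * b) * (card (R - S) * 2 ^ b) = 2 ^ b * (N ^ (N * b) * card (R - S))" by simp
    also have "\<dots> \<le> 2 ^ b * ((N - 1) ^ (N * b) * card R)" using S(4) False by (intro mult_le_mono2) simp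
    also have "\<dots> = (2 ^ b * (N - 1) ^ (N * b)) * card R" by simp
    also have "\<dots> \<le> N ^ (N * b) * card R" using pw by (rule mult_le_mono1)
    finally show ?thesis by (rule mult_left_le_imp_le) (use N in simp)
  qed
  with S that show ?thesis by blast
qed

lemma iterated_step:
  assumes "S \<subseteq> R" "finite R" "S1 \<subseteq> R - S" "card (R - S) \<le> N * card S1"
  shows "N * card (R - (S \<union> S1)) \<le> (N - 1) * card (R - S)"
proof -
  have "card (R - (S \<union> S1)) = card (R - S) - card S1"
    using assms finite_subset[OF assms(3)] by (simp add: Diff_Diff_Int set_diff_eq card_Diff_subset[symmetric] conj_ac)
  thus ?thesis using assms(4) by (simp add: diff_mult_distrib2 diff_mult_distrib)
qed

lemma high_deg_Diff:
  assumes fin: "finite A" "finite U" and high: "high_deg adj A \<delta> b" and U: "2 ^ (\<delta> + 1) * card U \<le> card A"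
  shows "high_deg adj (A - U) (\<delta> + 1) b"
proof -
  have "{a \<in> A. adj a b} \<subseteq> {a \<in> A - U. adj a b} \<union> U" by auto
  hence "card {a \<in> A. adj a b} \<le> card ({a \<in> A - U. adj a b} \<union> U)" using fin by (intro card_mono) auto
  also have "\<dots> \<le> card {a \<in> A - U. adj a b} + card U" by (rule card_Un_le)
  finally have "2 ^ \<delta> * card {a \<in> A. adj a b} \<le> 2 ^ \<delta> * card {a \<in> A - U. adj a b} + 2 ^ \<delta> * card U"
    by (metis add_mult_distrib2 mult_le_mono2)
  moreover have "2 * (2 ^ \<delta> * card U) \<le> card A" using U by simp
  moreover have "card (A - U) \<le> card A" using fin by (intro card_mono) auto
  ultimately show ?thesis using high unfolding high_deg_def by simp
qed

abbreviation coloured :: "(nat set \<Rightarrow> nat) \<Rightarrow> nat \<Rightarrow> nat \<Rightarrow> nat \<Rightarrow> bool" where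
  "coloured c k \<equiv> (\<lambda>a b. c {a, b} = k)"

lemma tile_part:
  assumes F: "bipartite_bounded_seq D F" and D: "D \<ge> 1" and fin: "finite A" "finite B" and AB: "A \<inter> B = {}"
    and deg: "\<And>b. b \<in> B \<Longrightarrow> high_deg (coloured c k) A \<delta> b" and m: "m \<ge> 1"
    and size: "m * 2 ^ (tconst \<delta> * D) \<le> card A" "m * 2 ^ (tconst \<delta> * D) \<le> card B"
  obtains A1 B1 where "A1 \<subseteq> A" "B1 \<subseteq> B" "card A1 = m" "card B1 = m" "tileable c F (A1 \<union> B1) 2"
proof -
  obtain h and X Y :: "(bool \<times> nat) set" where h: "bounded_bip h X Y D m"
    "\<forall>c k A B f g. embeds h X Y (coloured c k) A B f g \<and> A \<inter> B = {} \<longrightarrow> tileable c F (f ` X \<union> g ` Y) 2"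
    by (rule balanced_double[OF F m])
  obtain f g where fg: "embeds h X Y (coloured c k) A B f g"
    by (rule embedding_exists_tconst[OF fin D m deg h(1) size])
  have "tileable c F (f ` X \<union> g ` Y) 2" using h(2) fg AB by blast
  moreover have "card (f ` X) = m" "card (g ` Y) = m" "f ` X \<subseteq> A" "g ` Y \<subseteq> B"
    using fg h(1) by (auto simp: embeds_def bounded_bip_def card_image)
  ultimately show ?thesis using that by blast
qed

lemma div_ge_half:
  fixes n M :: nat
  assumes "M \<ge> 1" "M \<le> n"
  shows "n \<le> 2 * M * (n div M)" "n div M \<ge> 1" "n div M * M \<le> n"
proof -
  show 1: "n div M \<ge> 1" using assms by (simp add: less_eq_div_iff_mult_less_eq)
  have "n < M * (n div M) + M" using dividend_less_times_div[of M n] assms by simp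
  moreover have "M * 1 \<le> M * (n div M)" using 1 by (rule mult_le_mono2)
  ultimately show "n \<le> 2 * M * (n div M)" by linarith
  show "n div M * M \<le> n" by (rule div_times_less_eq_dividend)
qed

text \<open>Each doubled tile covers at least a share \<open>1 / (2 * M)\<close> of what remains of
  \<open>R\<close>. Altogether at most \<open>card R\<close> vertices of \<open>A\<close> are used,
  which costs every vertex less than half of its degree to \<open>A\<close>; hence
  \<open>\<delta> + 1\<close>.\<close>

lemma greedy_cover:
  assumes F: "bipartite_bounded_seq D F" and D: "D \<ge> 1" and fin: "finite A" "finite R" and AR: "A \<inter> R = {}"
    and deg: "\<And>b. b \<in> R \<Longrightarrow> high_deg (coloured c k) A \<delta> b"
    and size: "2 ^ (\<delta> + 2) * card R \<le> card A" "2 ^ (tconst (\<delta> + 1) * D + b) \<le> card R"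
  obtains S A' where "S \<subseteq> R" "A' \<subseteq> A" "card A' = card S"
    "tileable c F (S \<union> A') (4 * 2 ^ (tconst (\<delta> + 1) * D) * b)" "card (R - S) * 2 ^ b \<le> card R"
proof -
  define M where "M = (2::nat) ^ (tconst (\<delta> + 1) * D)"
  have M: "M \<ge> 1" by (simp add: M_def)
  define \<Phi> where "\<Phi> = (\<lambda>S n. \<exists>A'\<subseteq>A. card A' = card S \<and> tileable c F (S \<union> A') n)"
  obtain S n where S: "S \<subseteq> R" "n \<le> 2 * (2 * M * b)" "\<Phi> S n" "card (R - S) * 2 ^ b \<le> card R"
  proof (rule iterated_covering[of \<Phi> "2 * M" R M b])
    show "\<Phi> {} 0" unfolding \<Phi>_def using tileable_empty by (intro exI[of _ "{}"]) auto
    show "M * 2 ^ b \<le> card R" using size(2) by (simp add: M_def power_add)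
  next
    fix S n assume S: "S \<subseteq> R" "\<Phi> S n" "M \<le> card (R - S)"
    obtain A' where A': "A' \<subseteq> A" "card A' = card S" "tileable c F (S \<union> A') n" using S(2) by (auto simp: \<Phi>_def)
    have cS: "card A' \<le> card R" using A'(2) S(1) fin by (simp add: card_mono)
    have finA': "finite A'" using A'(1) fin finite_subset by blast
    define m where "m = card (R - S) div M"
    note m = div_ge_half[OF M S(3), folded m_def]
    have "2 * 1 * (2 * card R) \<le> 2 ^ (\<delta> + 2) * card R" by simp
    hence cA: "4 * card R \<le> card A" using size(1) by linarith
    have sA: "2 ^ (\<delta> + 1) * card A' \<le> card A"
    proof -
      have "2 ^ (\<delta> + 1) * card A' \<le> 2 ^ (\<delta> + 2) * card R" using cS by (intro mult_le_mono power_increasing) auto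
      with size(1) show ?thesis by linarith
    qed
    have "card (R - S) \<le> card R" using fin by (intro card_mono) auto
    moreover have "card A - card A' \<le> card (A - A')" by (rule diff_card_le_card_Diff[OF finA'])
    ultimately have "m * 2 ^ (tconst (\<delta> + 1) * D) \<le> card (A - A')" "m * 2 ^ (tconst (\<delta> + 1) * D) \<le> card (R - S)"
      using m(3) cA cS by (auto simp: M_def)
    then obtain A1 B1 where AB1: "A1 \<subseteq> A - A'" "B1 \<subseteq> R - S" "card A1 = m" "card B1 = m" "tileable c F (A1 \<union> B1) 2"
      using tile_part[OF F D finite_Diff[OF fin(1)] finite_Diff[OF fin(2)] _ high_deg_Diff[OF fin(1) finA' deg sA] m(2), of S]
        AR by (metis (no_types, lifting) DiffD1 disjoint_iff)
    have fin1: "finite A1" "finite B1" using AB1 fin by (meson finite_Diff finite_subset)+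
    have "tileable c F ((S \<union> A') \<union> (A1 \<union> B1)) (n + 2)"
      by (rule tileable_Un[OF A'(3) AB1(5)]) (use AB1 A' S(1) AR in blast)
    also have "(S \<union> A') \<union> (A1 \<union> B1) = (S \<union> B1) \<union> (A' \<union> A1)" by blast
    finally have "tileable c F ((S \<union> B1) \<union> (A' \<union> A1)) (n + 2)" .
    moreover have "card (A' \<union> A1) = card (S \<union> B1)"
      using AB1 A' fin1 finA' finite_subset[OF S(1) fin(2)]
      by (subst (1 2) card_Un_disjoint) auto
    ultimately have "\<Phi> (S \<union> B1) (n + 2)" unfolding \<Phi>_def using A'(1) AB1(1) by (intro exI[of _ "A' \<union> A1"]) auto
    moreover have "2 * M * card (R - (S \<union> B1)) \<le> (2 * M - 1) * card (R - S)"
      by (rule iterated_step[OF S(1) fin(2) AB1(2)]) (use m(1) AB1(4) in simp)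
    ultimately show "\<exists>S'. S' \<subseteq> R \<and> \<Phi> S' (n + 2) \<and> 2 * M * card (R - S') \<le> (2 * M - 1) * card (R - S)"
      using S(1) AB1(2) by (intro exI[of _ "S \<union> B1"]) auto
  qed (use M fin in auto)
  obtain A' where A': "A' \<subseteq> A" "card A' = card S" "tileable c F (S \<union> A') n" using S(3) by (auto simp: \<Phi>_def)
  have "tileable c F (S \<union> A') (4 * M * b)" by (rule tileable_mono[OF A'(3)]) (use S(2) in simp)
  thus ?thesis using that[OF S(1) A'(1,2) _ S(4)] by (simp add: M_def)
qed

text \<open>The arguments of \<open>tconst\<close> are the density exponents in
  \<open>cover_round\<close>: \<open>\<delta>\<close> for the template, \<open>\<delta> + 2\<close>
  for the greedy step once the template and earlier tiles are removed from \<open>A\<close>, and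
  \<open>2 * \<delta> + 5\<close> for the tile between \<open>Z\<close> and the rest of
  \<open>A1\<close>.\<close>

definition rconst :: "nat \<Rightarrow> nat" where
  "rconst \<delta> = 4 * tconst \<delta> + tconst (\<delta> + 2) + tconst (2 * \<delta> + 5) + 12 * \<delta> + 48"

lemma card_Un_disjoint3:
  assumes "finite A" "finite B" "finite C" "A \<inter> B = {}" "A \<inter> C = {}" "B \<inter> C = {}"
  shows "card (A \<union> B \<union> C) = card A + card B + card C"
  using assms by (simp add: card_Un_disjoint Int_Un_distrib2)

text \<open>Most of \<open>R\<close> is covered by a template and greedily chosen tiles. Remaining vertices of high
  degree to \<open>A1\<close> are exchanged for vertices of the template, which form a further tile.\<close>

lemma cover_round:
  assumes F: "bipartite_bounded_seq D F" and D: "D \<ge> 1" and fin: "finite A" "finite R" and AR: "A \<inter> R = {}"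
    and deg: "\<And>b. b \<in> R \<Longrightarrow> high_deg (coloured c k) A \<delta> b"
    and size: "card R * 2 ^ (rconst \<delta> * D) \<le> card A"
  obtains R' A1 A' where "R' \<subseteq> R" "A1 \<subseteq> A" "A' \<subseteq> A" "card A \<le> 2 ^ (rconst \<delta> * D) * card A1"
    "\<forall>v\<in>R'. \<not> high_deg (coloured c k) A1 (2 * \<delta> + 4) v" "card A' \<le> card (R - R')"
    "card (R - R') \<le> card A' + 2 ^ (rconst \<delta> * D)" "tileable c F ((R - R') \<union> A') (2 ^ (rconst \<delta> * D))"
proof (cases "card R < 2 ^ (rconst \<delta> * D)")
  case True
  have "tileable c F R (2 ^ (rconst \<delta> * D))"
    by (rule tileable_mono[OF tileable_card[OF F fin(2)]]) (use True in simp)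
  thus ?thesis using True that[of "{}" A "{}"] by simp
next
  case False
  define T where "T = tconst \<delta> * D"
  \<comment> \<open>The greedy step leaves at most \<open>card R / 2 ^ b\<close> vertices. Since
    \<open>card R \<le> 2 ^ (2 * T + 1) * card Z\<close>, the set \<open>Q\<close> becomes smaller
    than \<open>Z\<close> by the factor \<open>2 ^ (tconst (2 * \<delta> + 5) * D)\<close> required
    by \<open>tile_part\<close>.\<close>
  define b where "b = (2 * tconst \<delta> + 1 + tconst (2 * \<delta> + 5)) * D"
  define m where "m = card R div 2 ^ T"
  have rcD: "rconst \<delta> * D = 4 * T + tconst (\<delta> + 2) * D + tconst (2 * \<delta> + 5) * D + (12 * \<delta> + 48) * D"
    by (simp add: rconst_def T_def algebra_simps)
  have bD: "b = 2 * T + D + tconst (2 * \<delta> + 5) * D" by (simp add: b_def T_def algebra_simps)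
  have cD: "(12 * \<delta> + 48) * D = 12 * (\<delta> * D) + 48 * D" by (simp add: algebra_simps)
  have \<delta>D: "\<delta> \<le> \<delta> * D" using D by simp
  have TD: "T \<ge> 20 * D" by (simp add: T_def tconst_def)
  have large: "2 ^ e \<le> card R" if "e \<le> rconst \<delta> * D" for e
    using False power_increasing[OF that, of "2::nat"] by linarith
  have RT: "2 ^ T \<le> card R" by (rule large) (simp add: rcD)
  note m = div_ge_half[OF _ RT, folded m_def]
  have m1: "m \<ge> 1" "card R \<le> 2 * 2 ^ T * m" "m * 2 ^ T \<le> card R" using m by auto
  have RA: "card R * 2 ^ e \<le> card A" if "e \<le> rconst \<delta> * D" for e
    using size power_increasing[OF that, of "2::nat"] by (meson le_trans mult_le_mono2 one_le_numeral)
  obtain h and X Y :: "(bool \<times> nat) set" where h: "bounded_bip h X Y D m"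
    "\<forall>c k A B f g. embeds h X Y (coloured c k) A B f g \<and> A \<inter> B = {} \<longrightarrow> tileable c F (f ` X \<union> g ` Y) 2"
    by (rule balanced_double[OF F m1(1)])
  have sA: "m * 2 ^ (tconst \<delta> * D) \<le> card A" and sB: "m * 2 ^ (tconst \<delta> * D) \<le> card R"
    using m1(3) RA[of 0] by (auto simp: T_def)
  have VV: "card R \<le> m * 2 ^ ((tconst \<delta> + 1) * D)"
  proof -
    have "2 * 2 ^ T * m = m * 2 ^ (T + 1)" by simp
    also have "\<dots> \<le> m * 2 ^ ((tconst \<delta> + 1) * D)"
      using D by (intro mult_le_mono2 power_increasing) (auto simp: T_def algebra_simps)
    finally show ?thesis using m1(2) by linarith
  qed
  have mbig: "2 ^ (((tconst \<delta> + 1) + 12 * \<delta> + 44) * D) \<le> m"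
  proof -
    have "((tconst \<delta> + 1) + 12 * \<delta> + 44) * D = T + 12 * (\<delta> * D) + 45 * D" by (simp add: T_def algebra_simps)
    hence "(2::nat) ^ (T + 1 + ((tconst \<delta> + 1) + 12 * \<delta> + 44) * D) \<le> card R"
      by (intro large) (use D in \<open>simp add: rcD cD\<close>)
    also note m1(2)
    finally have "2 ^ (T + 1) * 2 ^ (((tconst \<delta> + 1) + 12 * \<delta> + 44) * D) \<le> 2 ^ (T + 1) * m"
      unfolding power_add[of 2 "T + 1"] by simp
    thus ?thesis by (rule mult_left_le_imp_le) simp
  qed
  obtain A1 f g Z where A1: "A1 \<subseteq> A" "card A \<le> 2 ^ (tconst \<delta> * D) * card A1"
    "embeds h X Y (coloured c k) A1 R f g" "Z \<subseteq> g ` Y" "m \<le> 2 ^ (tconst \<delta> * D) * card Z"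
    "\<forall>b\<in>Z. high_deg (coloured c k) A1 (2 * \<delta> + 4) b"
    "\<forall>E Q. E \<subseteq> Z \<and> Q \<subseteq> R \<and> card Q = card E \<and> card E * 2 ^ (tconst \<delta> * D) \<le> m \<and> Q \<inter> g ` Y = {}
        \<and> (\<forall>q\<in>Q. high_deg (coloured c k) A1 (2 * \<delta> + 4) q) \<longrightarrow>
       (\<exists>g'. embeds h X Y (coloured c k) A1 (R \<union> Q) f g' \<and> g' ` Y = (g ` Y - E) \<union> Q)"
    by (rule template_exists[OF fin fin(2) D deg h(1) sA sB VV mbig])
  define X1 where "X1 = f ` X"
  define R1 where "R1 = g ` Y"
  have XR: "X1 \<subseteq> A1" "R1 \<subseteq> R" "card X1 = m" "card R1 = m"
    using A1(3) h(1) by (auto simp: embeds_def bounded_bip_def X1_def R1_def card_image)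
  have finA1: "finite A1" using A1(1) fin finite_subset by blast
  have finX1: "finite X1" "finite R1" using XR finA1 fin finite_subset by blast+
  have finZ: "finite Z" using A1(4) finX1 finite_subset by (auto simp: R1_def)
  have AA: "A1 \<inter> R = {}" using A1(1) AR by blast
  have twoT: "(2::nat) \<le> 2 ^ T" using power_increasing[of 1 T "2::nat"] TD D by simp
  have mR: "2 * m \<le> card R" using mult_le_mono2[OF twoT, of m] m1(3) by linarith
  have cR2: "card (R - R1) = card R - m" using XR finX1 by (simp add: card_Diff_subset)
  have d1: "high_deg (coloured c k) (A - X1) (\<delta> + 1) v" if "v \<in> R - R1" for v
  proof (rule high_deg_Diff[OF fin(1) finX1(1) deg])
    have "2 ^ (\<delta> + 1) * card X1 \<le> card R * 2 ^ (\<delta> + 1)" using mR XR by (simp add: mult.commute)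
    also have "\<dots> \<le> card A" by (rule RA) (use \<delta>D D rcD cD in linarith)
    finally show "2 ^ (\<delta> + 1) * card X1 \<le> card A" .
  qed (use that in simp)
  have g1: "2 ^ (\<delta> + 1 + 2) * card (R - R1) \<le> card (A - X1)"
  proof -
    have "card R * 2 ^ (\<delta> + 4) \<le> card A" by (rule RA) (use \<delta>D D rcD cD in linarith)
    moreover have "card R * 2 ^ (\<delta> + 4) = 2 ^ (\<delta> + 3) * card R + 2 ^ (\<delta> + 3) * card R" by (simp add: power_add)
    moreover have "card R \<le> 2 ^ (\<delta> + 3) * card R" by simp
    moreover have "2 ^ (\<delta> + 3) * card (R - R1) \<le> 2 ^ (\<delta> + 3) * card R"
      using fin by (intro mult_le_mono2 card_mono) auto
    moreover have "card A - card X1 \<le> card (A - X1)" by (rule diff_card_le_card_Diff[OF finX1(1)])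
    ultimately have "2 ^ (\<delta> + 3) * card (R - R1) \<le> card (A - X1)" using mR XR by linarith
    thus ?thesis by (simp add: eval_nat_numeral)
  qed
  have g2: "2 ^ (tconst (\<delta> + 1 + 1) * D + b) \<le> card (R - R1)"
  proof -
    have "(2::nat) ^ (tconst (\<delta> + 2) * D + b + 1) \<le> card R" by (rule large) (use TD D in \<open>simp add: rcD cD bD\<close>)
    thus ?thesis using cR2 mR by (simp add: eval_nat_numeral)
  qed
  have AR2: "(A - X1) \<inter> (R - R1) = {}" using AR by blast
  obtain S A2 where S: "S \<subseteq> R - R1" "A2 \<subseteq> A - X1" "card A2 = card S"
    "tileable c F (S \<union> A2) (4 * 2 ^ (tconst (\<delta> + 1 + 1) * D) * b)" "card (R - R1 - S) * 2 ^ b \<le> card (R - R1)"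
    by (rule greedy_cover[OF F D finite_Diff[OF fin(1)] finite_Diff[OF fin(2)] AR2 d1 g1 g2])
  have finS: "finite S" "finite A2" using S fin by (meson finite_Diff finite_subset)+
  define Q where "Q = {v \<in> R - R1 - S. high_deg (coloured c k) A1 (2 * \<delta> + 4) v}"
  define R' where "R' = {v \<in> R - R1 - S. \<not> high_deg (coloured c k) A1 (2 * \<delta> + 4) v}"
  have finQ: "finite Q" using fin by (simp add: Q_def)
  have QR: "Q \<subseteq> R" "Q \<inter> R1 = {}" "Q \<inter> S = {}" by (auto simp: Q_def)
  have parts: "R - R' = R1 \<union> S \<union> Q" using XR(2) S(1) by (auto simp: Q_def R'_def)
  have cQ: "card Q * 2 ^ b \<le> card R"
  proof -
    have "card Q * 2 ^ b \<le> card (R - R1 - S) * 2 ^ b" using fin by (intro mult_le_mono1 card_mono) (auto simp: Q_def)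
    with S(5) cR2 show ?thesis by linarith
  qed
  have cSR: "m + card S \<le> card R"
  proof -
    have "card S \<le> card (R - R1)" using S(1) fin by (intro card_mono) auto
    thus ?thesis using cR2 mR by linarith
  qed
  \<comment> \<open>For nonempty \<open>Q\<close>, some \<open>E\<close> in \<open>Z\<close> with
    \<open>card Q\<close> elements is tiled together with fresh vertices \<open>X2\<close>; then the
    template is embedded anew with \<open>Q\<close> in place of \<open>E\<close>.\<close>
  have "\<exists>X2\<subseteq>A1 - (X1 \<union> A2). card X2 = card Q \<and> tileable c F (X1 \<union> R1 \<union> Q \<union> X2) 4"
  proof (cases "Q = {}")
    case True
    have "tileable c F (X1 \<union> R1) 2" using h(2) A1(3) AA by (auto simp: X1_def R1_def)
    hence "tileable c F (X1 \<union> R1) 4" by (rule tileable_mono) simp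
    thus ?thesis using True by (intro exI[of _ "{}"]) simp
  next
    case False
    hence q1: "card Q \<ge> 1" using finQ by (simp add: Suc_le_eq card_gt_0_iff)
    define U where "U = X1 \<union> A2"
    have finU: "finite U" using finX1 finS by (simp add: U_def)
    have cU: "card U \<le> card R" using card_Un_le[of X1 A2] S(3) XR(3) cSR by (simp add: U_def)
    have cA1: "card R * 2 ^ (2 * \<delta> + 5) \<le> card A1"
    proof -
      have "card R * 2 ^ (T + (2 * \<delta> + 5)) \<le> card A" by (rule RA) (use \<delta>D D rcD cD in linarith)
      also have "\<dots> \<le> 2 ^ T * card A1" using A1(2) by (simp add: T_def)
      finally have "2 ^ T * (card R * 2 ^ (2 * \<delta> + 5)) \<le> 2 ^ T * card A1" by (simp add: power_add mult_ac)
      thus ?thesis by (rule mult_left_le_imp_le) simp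
    qed
    have d2: "high_deg (coloured c k) (A1 - U) (2 * \<delta> + 5) v" if "v \<in> Z" for v
    proof -
      have "2 ^ (2 * \<delta> + 4 + 1) * card U \<le> card R * 2 ^ (2 * \<delta> + 5)" using cU by (simp add: mult.commute add.commute)
      with cA1 have "2 ^ (2 * \<delta> + 4 + 1) * card U \<le> card A1" by linarith
      from high_deg_Diff[OF finA1 finU _ this, of "coloured c k" v] A1(6) that
      show ?thesis by (simp add: eval_nat_numeral)
    qed
    have sZ: "card Q * 2 ^ (tconst (2 * \<delta> + 5) * D) \<le> card Z"
    proof -
      have "card Q * 2 ^ (tconst (2 * \<delta> + 5) * D) * 2 ^ (2 * T + 1) = card Q * 2 ^ (tconst (2 * \<delta> + 5) * D + 2 * T + 1)"
        by (simp add: power_add)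
      also have "\<dots> \<le> card Q * 2 ^ b" using D by (intro mult_le_mono2 power_increasing) (auto simp: bD)
      also note cQ also note m1(2)
      also have "2 * 2 ^ T * m \<le> 2 * 2 ^ T * (2 ^ T * card Z)" using A1(5) by (intro mult_le_mono2) (simp add: T_def)
      also have "\<dots> = card Z * 2 ^ (2 * T + 1)" unfolding mult_2[of T] power_add power_one_right by (simp only: mult_ac)
      finally show ?thesis by (rule mult_right_le_imp_le) simp
    qed
    have sZ': "card Q * 2 ^ (tconst (2 * \<delta> + 5) * D) \<le> card (A1 - U)"
    proof -
      have "card Z \<le> card R" using A1(4) XR fin finX1 card_mono[of R1 Z] mR by (auto simp: R1_def)
      moreover have "card A1 - card U \<le> card (A1 - U)" by (rule diff_card_le_card_Diff[OF finU])
      moreover have "card R * 2 \<le> card R * 2 ^ (2 * \<delta> + 5)"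
        using power_increasing[of 1 "2 * \<delta> + 5" "2::nat"] by (intro mult_le_mono2) simp
      ultimately show ?thesis using sZ cA1 cU by linarith
    qed
    have UZ: "(A1 - U) \<inter> Z = {}" using AA A1(4) XR(2) by (auto simp: R1_def)
    obtain X2 E where E: "X2 \<subseteq> A1 - U" "E \<subseteq> Z" "card X2 = card Q" "card E = card Q" "tileable c F (X2 \<union> E) 2"
      by (rule tile_part[OF F D finite_Diff[OF finA1] finZ UZ d2 q1 sZ' sZ])
    have "card E * 2 ^ (tconst \<delta> * D) \<le> m"
    proof -
      have "card Q * 2 ^ T * 2 ^ (T + 1) = card Q * 2 ^ (T + (T + 1))"
        by (simp only: power_add mult.assoc)
      also have "\<dots> \<le> card Q * 2 ^ b"
        using D by (intro mult_le_mono2 power_increasing) (auto simp: bD)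
      also note cQ also note m1(2)
      finally have "card Q * 2 ^ T * 2 ^ (T + 1) \<le> m * 2 ^ (T + 1)" by (simp add: mult_ac)
      hence "card Q * 2 ^ T \<le> m" by (rule mult_right_le_imp_le) simp
      thus ?thesis by (simp add: E(4) T_def)
    qed
    moreover have "\<forall>q\<in>Q. high_deg (coloured c k) A1 (2 * \<delta> + 4) q" by (simp add: Q_def)
    ultimately obtain g' where g': "embeds h X Y (coloured c k) A1 (R \<union> Q) f g'" "g' ` Y = (R1 - E) \<union> Q"
      using A1(7)[rule_format, of E Q] E(2,4) QR by (auto simp: R1_def)
    have "tileable c F (X1 \<union> ((R1 - E) \<union> Q)) 2"
      using h(2)[rule_format, of c k A1 "R \<union> Q" f g'] g' AA QR(1) by (auto simp: X1_def)
    moreover have ER: "E \<subseteq> R1" using E(2) A1(4) by (auto simp: R1_def)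
    moreover have "(X1 \<union> ((R1 - E) \<union> Q)) \<inter> (X2 \<union> E) = {}"
      using E(1) ER XR(1,2) AA QR unfolding U_def by blast
    ultimately have "tileable c F ((X1 \<union> ((R1 - E) \<union> Q)) \<union> (X2 \<union> E)) (2 + 2)"
      using tileable_Un[OF _ E(5)] by blast
    moreover have "(X1 \<union> ((R1 - E) \<union> Q)) \<union> (X2 \<union> E) = X1 \<union> R1 \<union> Q \<union> X2" using ER by blast
    ultimately have "tileable c F (X1 \<union> R1 \<union> Q \<union> X2) 4" by simp
    thus ?thesis using E by (intro exI[of _ X2]) (simp add: U_def)
  qed
  then obtain X2 where X2: "X2 \<subseteq> A1 - (X1 \<union> A2)" "card X2 = card Q" "tileable c F (X1 \<union> R1 \<union> Q \<union> X2) 4"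
    by blast
  have finX2: "finite X2" using X2(1) finA1 by (meson finite_Diff finite_subset)
  define A' where "A' = X1 \<union> A2 \<union> X2"
  have "card A' = card X1 + card A2 + card X2"
    unfolding A'_def by (rule card_Un_disjoint3) (use finX1 finS finX2 S(2) X2(1) in auto)
  also have "\<dots> = card R1 + card S + card Q" using S(3) X2(2) XR by simp
  also have "\<dots> = card (R1 \<union> S \<union> Q)"
    by (rule card_Un_disjoint3[symmetric]) (use finX1 finS finQ S(1) QR in auto)
  finally have cA': "card A' = card (R - R')" by (simp add: parts)
  have tiles: "4 * 2 ^ (tconst (\<delta> + 1 + 1) * D) * b + 4 \<le> 2 ^ (rconst \<delta> * D)"
  proof -
    have "b < 2 ^ b" by simp
    hence "b \<le> 2 ^ b" by (rule less_imp_le)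
    hence "4 * 2 ^ (tconst (\<delta> + 2) * D) * b \<le> 4 * 2 ^ (tconst (\<delta> + 2) * D) * 2 ^ b" by (rule mult_le_mono2)
    also have "\<dots> = 2 ^ (tconst (\<delta> + 2) * D + b + 2)" by (simp add: power_add)
    finally have "4 * 2 ^ (tconst (\<delta> + 2) * D) * b + 4 \<le> 2 ^ (tconst (\<delta> + 2) * D + b + 2) + 2 ^ (tconst (\<delta> + 2) * D + b + 2)"
      by (intro add_mono) (auto simp: power_add)
    also have "\<dots> = 2 ^ (tconst (\<delta> + 2) * D + b + 3)" by (simp add: power_add)
    also have "\<dots> \<le> 2 ^ (rconst \<delta> * D)" by (intro power_increasing) (use D in \<open>auto simp: rcD cD bD\<close>)
    finally show ?thesis by (simp add: eval_nat_numeral)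
  qed
  have dis: "(S \<union> A2) \<inter> (X1 \<union> R1 \<union> Q \<union> X2) = {}"
  proof -
    have "S \<inter> X1 = {}" "S \<inter> X2 = {}" using S(1) XR(1) X2(1) AA by auto
    moreover have "A2 \<inter> R1 = {}" "A2 \<inter> Q = {}" using S(2) XR(2) QR(1) AR by auto
    ultimately show ?thesis using S(1,2) X2(1) QR(3) by blast
  qed
  have "tileable c F ((S \<union> A2) \<union> (X1 \<union> R1 \<union> Q \<union> X2)) (2 ^ (rconst \<delta> * D))"
    by (rule tileable_mono[OF tileable_Un[OF S(4) X2(3) dis] tiles])
  also have "(S \<union> A2) \<union> (X1 \<union> R1 \<union> Q \<union> X2) = (R - R') \<union> A'" by (auto simp: parts A'_def)
  finally have til: "tileable c F ((R - R') \<union> A') (2 ^ (rconst \<delta> * D))" .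
  have cA: "card A \<le> 2 ^ (rconst \<delta> * D) * card A1"
  proof -
    have "(2::nat) ^ (tconst \<delta> * D) \<le> 2 ^ (rconst \<delta> * D)" by (intro power_increasing) (auto simp: rcD T_def)
    hence "2 ^ (tconst \<delta> * D) * card A1 \<le> 2 ^ (rconst \<delta> * D) * card A1" by (rule mult_le_mono1)
    with A1(2) show ?thesis by linarith
  qed
  show ?thesis
  proof (rule that[of R' A1 A'])
    show "A' \<subseteq> A" using XR(1) S(2) X2(1) A1(1) by (auto simp: A'_def)
  qed (use A1(1) cA cA' til in \<open>auto simp: R'_def\<close>)
qed

lemma covers_mono: "covers c F R A T \<Longrightarrow> T \<le> T' \<Longrightarrow> covers c F R A T'"
  unfolding covers_def by (meson add_left_mono le_trans tileable_mono)

lemma covers_Un: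
  assumes fin: "finite A" "finite R" "finite R2" and A': "A' \<subseteq> A" "card A' \<le> card R" "card R \<le> card A' + T"
    and til: "tileable c F (R \<union> A') T" and cov: "covers c F R2 A2 T2" and A2: "A2 \<subseteq> A - A'"
    and dis: "R \<inter> R2 = {}" "A \<inter> (R \<union> R2) = {}"
  shows "covers c F (R \<union> R2) A (T + T2)"
proof -
  obtain A'' where A'': "A'' \<subseteq> A2" "card A'' \<le> card R2" "card R2 \<le> card A'' + T2" "tileable c F (R2 \<union> A'') T2"
    using cov by (auto simp: covers_def)
  have finA: "finite A'" "finite A''" using A' A'' A2 fin by (meson finite_Diff finite_subset)+
  have "A' \<inter> A'' = {}" using A''(1) A2 by blast
  hence c1: "card (A' \<union> A'') = card A' + card A''" using finA by (simp add: card_Un_disjoint)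
  have c2: "card (R \<union> R2) = card R + card R2" using fin dis by (simp add: card_Un_disjoint)
  have "(R \<union> A') \<inter> (R2 \<union> A'') = {}" using dis A'(1) A''(1) A2 by blast
  from tileable_Un[OF til A''(4) this] have "tileable c F ((R \<union> A') \<union> (R2 \<union> A'')) (T + T2)" .
  also have "(R \<union> A') \<union> (R2 \<union> A'') = (R \<union> R2) \<union> (A' \<union> A'')" by blast
  finally show ?thesis unfolding covers_def
    using c1 c2 A' A'' A2 by (intro exI[of _ "A' \<union> A''"]) auto
qed

text \<open>In each round, the vertices that remain have low degree to the set \<open>A1\<close> that is removed, so
  their relative degree to the rest of \<open>A\<close> goes up. The invariant on the degrees bounds the number
  of rounds, because \<open>A1\<close> is a fixed fraction of \<open>A\<close>.\<close>

lemma single_colour_cover: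
  assumes F: "bipartite_bounded_seq D F" and D: "D \<ge> 1" and y: "y \<ge> 1"
    and fin: "finite A" "finite R" and AR: "A \<inter> R = {}"
    and Ry: "card R * 2 ^ (rconst \<delta> * D) \<le> y"
    and deg: "\<And>v. v \<in> R \<Longrightarrow> card A + 2 ^ \<delta> * (y + card R) \<le> 2 ^ \<delta> * card {a \<in> A. c {a, v} = k}"
    and A: "2 ^ (rconst \<delta> * D) * card A \<le> n * y"
  shows "covers c F R A (n * 2 ^ (rconst \<delta> * D))"
  using fin AR Ry deg A
proof (induction n arbitrary: A R)
  case 0
  hence "A = {}" by simp
  have "R = {}"
  proof (rule ccontr)
    assume "R \<noteq> {}"
    then obtain v where "v \<in> R" by blast
    from "0.prems"(5)[OF this] \<open>A = {}\<close> y show False by simp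
  qed
  thus ?case using covers_empty by simp
next
  case (Suc n)
  define C where "C = (2::nat) ^ (rconst \<delta> * D)"
  show ?case
  proof (cases "R = {}")
    case True
    thus ?thesis using covers_mono[OF covers_empty] by simp
  next
    case False
    then obtain v0 where v0: "v0 \<in> R" by blast
    have high: "high_deg (coloured c k) A \<delta> v" if "v \<in> R" for v
      using Suc.prems(5)[OF that] by (simp add: high_deg_def)
    \<comment> \<open>While \<open>R\<close> is nonempty, the degree condition forces
      \<open>A\<close> to be large. So \<open>A1\<close> has at least \<open>y / C\<close> elements,
      and each round lowers \<open>C * card A\<close> by at least \<open>y\<close>; this bounds the
      number of rounds by \<open>n\<close>.\<close>
    have yA: "y \<le> card A"
    proof -
      have "card {a \<in> A. c {a, v0} = k} \<le> card A" using Suc.prems(1) by (intro card_mono) auto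
      hence "2 ^ \<delta> * card {a \<in> A. c {a, v0} = k} \<le> 2 ^ \<delta> * card A" by (rule mult_le_mono2)
      moreover have "2 ^ \<delta> * y \<le> card A + 2 ^ \<delta> * (y + card R)" by (simp add: add_mult_distrib2)
      ultimately have "2 ^ \<delta> * y \<le> 2 ^ \<delta> * card A" using Suc.prems(5)[OF v0] by linarith
      thus ?thesis by (rule mult_left_le_imp_le) simp
    qed
    have RA: "card R * 2 ^ (rconst \<delta> * D) \<le> card A" using Suc.prems(4) yA by linarith
    obtain R' A1 A' where R: "R' \<subseteq> R" "A1 \<subseteq> A" "A' \<subseteq> A" "card A \<le> 2 ^ (rconst \<delta> * D) * card A1"
      "\<forall>v\<in>R'. \<not> high_deg (coloured c k) A1 (2 * \<delta> + 4) v" "card A' \<le> card (R - R')"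
      "card (R - R') \<le> card A' + 2 ^ (rconst \<delta> * D)" "tileable c F ((R - R') \<union> A') (2 ^ (rconst \<delta> * D))"
      by (rule cover_round[OF F D Suc.prems(1,2,3) high RA])
    have finR: "finite A1" "finite A'" "finite R'" using R(1-3) Suc.prems(1,2) finite_subset by blast+
    define A2 where "A2 = A - A1 - A'"
    have cR: "card (R - R') = card R - card R'" "card R' \<le> card R"
      using R(1) finR Suc.prems(2) by (simp_all add: card_Diff_subset card_mono)
    have cA2: "card A2 + card A1 \<le> card A"
    proof -
      have "card A2 + card A1 = card (A2 \<union> A1)"
        using Suc.prems(1) finR by (subst card_Un_disjoint) (auto simp: A2_def)
      also have "\<dots> \<le> card A" using Suc.prems(1) R(2) by (intro card_mono) (auto simp: A2_def)
      finally show ?thesis .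
    qed
    have "covers c F R' A2 (n * 2 ^ (rconst \<delta> * D))"
    proof (rule Suc.IH)
      show "finite A2" using Suc.prems(1) by (simp add: A2_def)
      show "A2 \<inter> R' = {}" using Suc.prems(3) R(1) by (auto simp: A2_def)
      have "card R' * 2 ^ (rconst \<delta> * D) \<le> card R * 2 ^ (rconst \<delta> * D)" using cR(2) by (rule mult_le_mono1)
      thus "card R' * 2 ^ (rconst \<delta> * D) \<le> y" using Suc.prems(4) by linarith
    next
      fix v assume v: "v \<in> R'"
      define d d1 d2 where "d = card {a \<in> A. c {a, v} = k}" and "d1 = card {a \<in> A1. c {a, v} = k}"
        and "d2 = card {a \<in> A2. c {a, v} = k}"
      have "{a \<in> A. c {a, v} = k} \<subseteq> {a \<in> A2. c {a, v} = k} \<union> {a \<in> A1. c {a, v} = k} \<union> A'"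
        by (auto simp: A2_def)
      hence "d \<le> card ({a \<in> A2. c {a, v} = k} \<union> {a \<in> A1. c {a, v} = k} \<union> A')"
        unfolding d_def using finR Suc.prems(1) by (intro card_mono) (auto simp: A2_def)
      also have "\<dots> \<le> d2 + d1 + card A'"
        unfolding d1_def d2_def by (meson add_le_mono1 card_Un_le le_trans)
      finally have "2 ^ \<delta> * d \<le> 2 ^ \<delta> * (d2 + d1 + card A')" by (rule mult_le_mono2)
      hence dd: "2 ^ \<delta> * d \<le> 2 ^ \<delta> * d2 + 2 ^ \<delta> * d1 + 2 ^ \<delta> * card A'" by (simp add: add_mult_distrib2)
      \<comment> \<open>Deleting \<open>A1\<close> lowers the left side of the degree condition by
        \<open>card A1\<close> and the right side by no more, as \<open>v\<close> has low degree to
        \<open>A1\<close>. The loss to \<open>A'\<close> is paid for by the decrease from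
        \<open>card R\<close> to \<open>card R'\<close>.\<close>
      have "2 ^ \<delta> * d1 \<le> 2 ^ (2 * \<delta> + 4) * d1" by (intro mult_le_mono1 power_increasing) auto
      moreover have "2 ^ (2 * \<delta> + 4) * d1 < card A1" using R(5) v by (auto simp: high_deg_def d1_def not_le)
      ultimately have low: "2 ^ \<delta> * d1 \<le> card A1" by linarith
      have "card A' + card R' \<le> card R" using R(6) cR by linarith
      hence "2 ^ \<delta> * (card A' + card R') \<le> 2 ^ \<delta> * card R" by (rule mult_le_mono2)
      hence cc: "2 ^ \<delta> * card A' + 2 ^ \<delta> * card R' \<le> 2 ^ \<delta> * card R" by (simp add: add_mult_distrib2)
      have "card A + (2 ^ \<delta> * y + 2 ^ \<delta> * card R) \<le> 2 ^ \<delta> * d"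
        using Suc.prems(5)[of v] v R(1) by (auto simp: d_def add_mult_distrib2)
      with dd low cc cA2 have "card A2 + (2 ^ \<delta> * y + 2 ^ \<delta> * card R') \<le> 2 ^ \<delta> * d2" by linarith
      thus "card A2 + 2 ^ \<delta> * (y + card R') \<le> 2 ^ \<delta> * card {a \<in> A2. c {a, v} = k}"
        by (simp add: d2_def add_mult_distrib2)
    next
      have "C * (card A2 + card A1) \<le> C * card A" using cA2 by (rule mult_le_mono2)
      hence "C * card A2 + C * card A1 \<le> C * card A" by (simp add: add_mult_distrib2)
      moreover have "C * card A \<le> n * y + y" using Suc.prems(6) by (simp add: C_def)
      moreover have "y \<le> C * card A1" using R(4) yA by (simp add: C_def)
      ultimately show "2 ^ (rconst \<delta> * D) * card A2 \<le> n * y" by (simp add: C_def)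
    qed (use finR in auto)
    from covers_Un[OF Suc.prems(1) _ finR(3) R(3,6,7,8) this] Suc.prems(2,3) R(1)
    have "covers c F ((R - R') \<union> R') A (2 ^ (rconst \<delta> * D) + n * 2 ^ (rconst \<delta> * D))"
      by (auto simp: A2_def Un_absorb2)
    moreover have "(R - R') \<union> R' = R" using R(1) by blast
    ultimately show ?thesis by simp
  qed
qed

section \<open>Handling all colours\<close>

lemma exists_colour:
  assumes "finite A" "\<And>a. a \<in> A \<Longrightarrow> c {a, b} < r" "r \<ge> 1"
  shows "\<exists>k<r. high_deg (coloured c k) A r b"
proof (rule ccontr)
  assume neg: "\<not> ?thesis"
  hence lt: "2 ^ r * card {a \<in> A. c {a, b} = k} < card A" if "k < r" for k
    using that by (auto simp: high_deg_def not_le)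
  have pos: "card A > 0" using lt[of 0] assms(3) by simp
  have "A = (\<Union>k\<in>{..<r}. {a \<in> A. c {a, b} = k})" using assms(2) by auto
  hence "card A \<le> (\<Sum>k<r. card {a \<in> A. c {a, b} = k})"
    using card_UN_le[of "{..<r}" "\<lambda>k. {a \<in> A. c {a, b} = k}"] by simp
  hence "2 ^ r * card A \<le> (\<Sum>k<r. 2 ^ r * card {a \<in> A. c {a, b} = k})"
    by (simp add: sum_distrib_left[symmetric])
  also have "\<dots> \<le> (\<Sum>k<r. card A)" using lt by (intro sum_mono) (auto intro: less_imp_le)
  also have "\<dots> = r * card A" by simp
  \<comment> \<open>The density \<open>1 / r\<close> of the pigeonhole principle is weakened to
    \<open>2 ^ (- r)\<close>, the form that \<open>high_deg\<close> takes.\<close>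
  also have "\<dots> < 2 ^ r * card A" using pos by simp
  finally show False by simp
qed

definition cconst :: "nat \<Rightarrow> nat" where
  "cconst r = 2 * rconst (r + 2) + 2 * r + 4"

text \<open>Each vertex of \<open>R\<close> is assigned a colour in which it has large degree to
  \<open>Z\<close>, and the colour classes are covered one after another. Earlier classes consume at
  most \<open>card R\<close> vertices of \<open>Z\<close>, a negligible part.\<close>

lemma cover_all_colours:
  assumes F: "bipartite_bounded_seq D F" and D: "D \<ge> 1" and r: "r \<ge> 1"
    and fin: "finite Z" "finite R" and ZR: "Z \<inter> R = {}"
    and col: "\<And>a v. a \<in> Z \<Longrightarrow> v \<in> R \<Longrightarrow> c {a, v} < r"
    and size: "card R * 2 ^ ((rconst (r + 2) + r + 4) * D) \<le> card Z"
  shows "covers c F R Z (2 ^ (cconst r * D))"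
proof (cases "R = {}")
  case True
  thus ?thesis using covers_mono[OF covers_empty] by simp
next
  case False
  hence R1: "card R \<ge> 1" using fin by (simp add: Suc_le_eq card_gt_0_iff)
  \<comment> \<open>The two extra powers of 2 give \<open>4 * card Z\<close> on the right of the
    degree condition in \<open>single_colour_cover\<close>. One \<open>card Z\<close> each covers
    the set itself and the term with \<open>y\<close>, and a third covers the losses of order
    \<open>card R\<close>.\<close>
  define \<delta> where "\<delta> = r + 2"
  define C where "C = rconst \<delta> * D"
  have exps: "(rconst (r + 2) + r + 4) * D = C + (r + 4) * D" by (simp add: C_def \<delta>_def algebra_simps)
  have rD: "r + 4 \<le> (r + 4) * D" using D by simp
  have size': "card R * 2 ^ e \<le> card Z" if "e \<le> C + (r + 4)" for e
  proof -
    have "card R * 2 ^ e \<le> card R * 2 ^ ((rconst (r + 2) + r + 4) * D)"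
      by (intro mult_le_mono2 power_increasing) (use that rD exps in linarith, simp)
    with size show ?thesis by linarith
  qed
  define y where "y = card Z div 2 ^ \<delta>"
  have "2 ^ \<delta> \<le> card R * 2 ^ \<delta>" using R1 by simp
  also have "\<dots> \<le> card Z" by (rule size') (simp add: \<delta>_def)
  finally have dZ: "2 ^ \<delta> \<le> card Z" .
  note y = div_ge_half[OF _ dZ, folded y_def]
  have y1: "y \<ge> 1" "card Z \<le> 2 * 2 ^ \<delta> * y" "y * 2 ^ \<delta> \<le> card Z" using y by auto
  have Ry: "card R * 2 ^ C \<le> y"
  proof -
    have "card R * 2 ^ C * 2 ^ \<delta> = card R * 2 ^ (C + \<delta>)" by (simp add: power_add)
    also have "\<dots> \<le> card Z" by (rule size') (simp add: \<delta>_def)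
    finally show ?thesis by (simp add: y_def less_eq_div_iff_mult_less_eq)
  qed
  define n where "n = (2::nat) ^ (\<delta> + 1 + C)"
  have nZ: "2 ^ C * card Z \<le> n * y"
  proof -
    have "2 ^ C * card Z \<le> 2 ^ C * (2 * 2 ^ \<delta> * y)" using y1(2) by (rule mult_le_mono2)
    thus ?thesis by (simp add: n_def power_add mult_ac)
  qed
  have "\<forall>v\<in>R. \<exists>k<r. high_deg (coloured c k) Z r v"
    using exists_colour[OF fin(1) _ r] col by blast
  then obtain k where k: "\<And>v. v \<in> R \<Longrightarrow> k v < r" "\<And>v. v \<in> R \<Longrightarrow> high_deg (coloured c (k v)) Z r v"
    by metis
  have "covers c F {v \<in> R. k v < j} Z (j * (n * 2 ^ C))" if "j \<le> r" for j
    using that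
  proof (induction j)
    case 0
    thus ?case using covers_empty by simp
  next
    case (Suc j)
    then obtain A' where A': "A' \<subseteq> Z" "card A' \<le> card {v \<in> R. k v < j}"
      "card {v \<in> R. k v < j} \<le> card A' + j * (n * 2 ^ C)" "tileable c F ({v \<in> R. k v < j} \<union> A') (j * (n * 2 ^ C))"
      by (auto simp: covers_def)
    define R2 where "R2 = {v \<in> R. k v = j}"
    have finA': "finite A'" using A'(1) fin finite_subset by blast
    have cA': "card A' \<le> card R"
      using A'(2) card_mono[OF fin(2), of "{v \<in> R. k v < j}"] by auto
    have R2: "finite R2" "card R2 \<le> card R" using fin by (auto simp: R2_def intro: card_mono)
    have "covers c F R2 (Z - A') (n * 2 ^ (rconst \<delta> * D))"
    proof (rule single_colour_cover[OF F D y1(1)])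
      have "card R2 * 2 ^ C \<le> card R * 2 ^ C" using R2(2) by (rule mult_le_mono1)
      with Ry have "card R2 * 2 ^ C \<le> y" by linarith
      thus "card R2 * 2 ^ (rconst \<delta> * D) \<le> y" by (simp only: C_def)
    next
      have "2 ^ C * card (Z - A') \<le> 2 ^ C * card Z" using fin by (intro mult_le_mono2 card_mono) auto
      with nZ have "2 ^ C * card (Z - A') \<le> n * y" by linarith
      thus "2 ^ (rconst \<delta> * D) * card (Z - A') \<le> n * y" by (simp only: C_def)
    next
      fix v assume v: "v \<in> R2"
      define d d2 where "d = card {a \<in> Z. c {a, v} = j}" and "d2 = card {a \<in> Z - A'. c {a, v} = j}"
      have "{a \<in> Z. c {a, v} = j} \<subseteq> {a \<in> Z - A'. c {a, v} = j} \<union> A'" by auto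
      hence "d \<le> card ({a \<in> Z - A'. c {a, v} = j} \<union> A')"
        unfolding d_def using fin finA' by (intro card_mono) auto
      also have "\<dots> \<le> d2 + card A'" unfolding d2_def by (rule card_Un_le)
      finally have "2 ^ \<delta> * d \<le> 2 ^ \<delta> * (d2 + card A')" by (rule mult_le_mono2)
      hence dd: "2 ^ \<delta> * d \<le> 2 ^ \<delta> * d2 + 2 ^ \<delta> * card A'" by (simp add: add_mult_distrib2)
      have "card Z \<le> 2 ^ r * d" using k(2)[of v] v by (auto simp: R2_def high_deg_def d_def)
      hence "4 * card Z \<le> 2 ^ \<delta> * d" by (simp add: \<delta>_def)
      moreover have "2 ^ \<delta> * card A' \<le> 2 ^ \<delta> * card R" using cA' by (rule mult_le_mono2)
      moreover have "2 ^ \<delta> * card R2 \<le> 2 ^ \<delta> * card R" using R2(2) by (rule mult_le_mono2)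
      moreover have "card R * 2 ^ (\<delta> + 1) \<le> card Z" by (rule size') (simp add: \<delta>_def)
      hence "2 * (2 ^ \<delta> * card R) \<le> card Z" by (simp add: mult_ac)
      moreover have "2 ^ \<delta> * y \<le> card Z" using y1(3) by (simp add: mult.commute)
      moreover have "card (Z - A') \<le> card Z" using fin by (intro card_mono) auto
      ultimately have "card (Z - A') + (2 ^ \<delta> * y + 2 ^ \<delta> * card R2) \<le> 2 ^ \<delta> * d2" using dd by linarith
      thus "card (Z - A') + 2 ^ \<delta> * (y + card R2) \<le> 2 ^ \<delta> * card {a \<in> Z - A'. c {a, v} = j}"
        by (simp add: d2_def add_mult_distrib2)
    qed (use fin R2 ZR in \<open>auto simp: R2_def\<close>)
    hence cov: "covers c F R2 (Z - A') (n * 2 ^ C)" by (simp add: C_def)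
    have "covers c F ({v \<in> R. k v < j} \<union> R2) Z (j * (n * 2 ^ C) + n * 2 ^ C)"
      by (rule covers_Un[OF fin(1) _ R2(1) A' cov subset_refl]) (use fin ZR in \<open>auto simp: R2_def\<close>)
    moreover have "{v \<in> R. k v < j} \<union> R2 = {v \<in> R. k v < Suc j}" by (auto simp: R2_def)
    ultimately show ?case by (simp add: add.commute)
  qed
  from this[of r] k(1) have "covers c F R Z (r * (n * 2 ^ C))"
    by (simp add: Collect_conj_eq Int_absorb2 subset_iff)
  moreover have "r * (n * 2 ^ C) \<le> 2 ^ (cconst r * D)"
  proof -
    have "r \<le> 2 ^ r" by (simp add: less_imp_le)
    hence "r * (n * 2 ^ C) \<le> 2 ^ r * (n * 2 ^ C)" by (rule mult_le_mono1)
    also have "\<dots> = 2 ^ (r + (\<delta> + 1 + C) + C)" by (simp add: n_def power_add)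
    also have "\<dots> \<le> 2 ^ (cconst r * D)"
    proof (rule power_increasing)
      define q where "q = (2 * r + 4) * D"
      have "2 * r + 4 \<le> q" using D by (simp add: q_def)
      moreover have "cconst r * D = 2 * C + q" by (simp add: cconst_def C_def \<delta>_def q_def algebra_simps)
      ultimately show "r + (\<delta> + 1 + C) + C \<le> cconst r * D" unfolding \<delta>_def by linarith
    qed simp
    finally show ?thesis .
  qed
  ultimately show ?thesis by (rule covers_mono)
qed

lemma pigeonhole_colour:
  fixes col :: "'a \<Rightarrow> nat"
  assumes "finite B" "\<And>b. b \<in> B \<Longrightarrow> col b < r" "r \<ge> 1"
  shows "\<exists>k<r. card B \<le> r * card {b \<in> B. col b = k}"
proof (rule ccontr)
  assume neg: "\<not> ?thesis"
  hence lt: "r * card {b \<in> B. col b = k} < card B" if "k < r" for k using that by (auto simp: not_le)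
  have "B = (\<Union>k\<in>{..<r}. {b \<in> B. col b = k})" using assms(2) by auto
  hence "card B \<le> (\<Sum>k<r. card {b \<in> B. col b = k})"
    using card_UN_le[of "{..<r}" "\<lambda>k. {b \<in> B. col b = k}"] by simp
  hence "r * card B \<le> (\<Sum>k<r. r * card {b \<in> B. col b = k})" by (simp add: sum_distrib_left[symmetric])
  also have "\<dots> < (\<Sum>k<r. card B)" using lt assms(3) by (intro sum_strict_mono) (auto simp: lessThan_empty_iff)
  finally show False by simp
qed

text \<open>One half of \<open>W\<close> serves as \<open>A\<close>. Every vertex of the other half
  has a popular colour towards \<open>A\<close>, and the most frequent of these colours determines
  \<open>B\<close>.\<close>

lemma monochromatic_pair:
  assumes W: "finite W" and r: "r \<ge> 1" and col: "\<And>a b. a \<in> W \<Longrightarrow> b \<in> W \<Longrightarrow> a \<noteq> b \<Longrightarrow> c {a, b} < r"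
  obtains A B k where "A \<subseteq> W" "B \<subseteq> W" "A \<inter> B = {}" "card A = card W div 2" "card W \<le> 2 ^ (r + 1) * card B"
    "\<forall>b\<in>B. high_deg (coloured c k) A r b"
proof -
  obtain A where A: "A \<subseteq> W" "card A = card W div 2" using obtain_subset_with_card_n[of "card W div 2" W] by auto
  have finA: "finite A" using A W finite_subset by blast
  have "\<forall>b\<in>W - A. \<exists>k<r. high_deg (coloured c k) A r b"
  proof
    fix b assume b: "b \<in> W - A"
    show "\<exists>k<r. high_deg (coloured c k) A r b"
    proof (rule exists_colour[OF finA _ r])
      fix a assume "a \<in> A"
      thus "c {a, b} < r" using A(1) b by (intro col) auto
    qed
  qed
  then obtain k where k: "\<And>b. b \<in> W - A \<Longrightarrow> k b < r" "\<And>b. b \<in> W - A \<Longrightarrow> high_deg (coloured c (k b)) A r b"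
    by metis
  obtain j where j: "j < r" "card (W - A) \<le> r * card {b \<in> W - A. k b = j}"
    using pigeonhole_colour[of "W - A" k r] W k(1) r by auto
  define B where "B = {b \<in> W - A. k b = j}"
  have "card W \<le> 2 * card (W - A)" using A finA by (simp add: card_Diff_subset)
  also have "\<dots> \<le> 2 * (2 ^ r * card B)"
  proof -
    have "r \<le> 2 ^ r" by (simp add: less_imp_le)
    hence "r * card B \<le> 2 ^ r * card B" by (rule mult_le_mono1)
    with j(2) have "card (W - A) \<le> 2 ^ r * card B" unfolding B_def by linarith
    thus ?thesis by simp
  qed
  finally have "card W \<le> 2 ^ (r + 1) * card B" by simp
  thus ?thesis using k(2) by (intro that[OF A(1) _ _ A(2), of B j]) (auto simp: B_def)
qed

text \<open>As in \<open>greedy_cover\<close>, but both sides of each tile come from the uncovered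
  set itself, in which a dense pair in one colour is found anew in each round.\<close>

lemma greedy_tiling:
  assumes F: "bipartite_bounded_seq D F" and D: "D \<ge> 1" and r: "r \<ge> 1"
    and W: "finite W" and col: "\<And>a b. a \<in> W \<Longrightarrow> b \<in> W \<Longrightarrow> a \<noteq> b \<Longrightarrow> c {a, b} < r"
    and size: "2 ^ ((tconst r + r + 2) * D + b) \<le> card W"
  obtains S where "S \<subseteq> W" "tileable c F S (4 * 2 ^ ((tconst r + r + 2) * D) * b)" "card (W - S) * 2 ^ b \<le> card W"
proof -
  define M where "M = (2::nat) ^ ((tconst r + r + 2) * D)"
  have M: "M \<ge> 1" by (simp add: M_def)
  have MT: "2 ^ (tconst r * D) * 2 ^ (r + 2) \<le> M"
  proof -
    define q where "q = (r + 2) * D"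
    have "r + 2 \<le> q" unfolding q_def using mult_le_mono2[OF D, of "r + 2"] by (simp only: mult_1_right)
    moreover have "(tconst r + r + 2) * D = tconst r * D + q" by (simp add: q_def algebra_simps)
    ultimately have "tconst r * D + (r + 2) \<le> (tconst r + r + 2) * D" by simp
    hence "(2::nat) ^ (tconst r * D + (r + 2)) \<le> M" unfolding M_def by (rule power_increasing) simp
    thus ?thesis by (simp add: power_add)
  qed
  obtain S n where S: "S \<subseteq> W" "n \<le> 2 * (2 * M * b)" "tileable c F S n" "card (W - S) * 2 ^ b \<le> card W"
  proof (rule iterated_covering[of "tileable c F" "2 * M" W M b])
    show "M * 2 ^ b \<le> card W" using size by (simp add: M_def power_add)
  next
    fix S n assume S: "S \<subseteq> W" "tileable c F S n" "M \<le> card (W - S)"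
    define m where "m = card (W - S) div M"
    note m = div_ge_half[OF M S(3), folded m_def]
    have col': "c {a, b} < r" if "a \<in> W - S" "b \<in> W - S" "a \<noteq> b" for a b using col that by blast
    obtain A B k where AB: "A \<subseteq> W - S" "B \<subseteq> W - S" "A \<inter> B = {}" "card A = card (W - S) div 2"
      "card (W - S) \<le> 2 ^ (r + 1) * card B" "\<forall>b\<in>B. high_deg (coloured c k) A r b"
      by (rule monochromatic_pair[of "W - S" r c, OF finite_Diff[OF W] r col'])
    have fin: "finite A" "finite B" using AB(1,2) W by (meson finite_Diff finite_subset)+
    have "m * (2 ^ (tconst r * D) * 2 ^ (r + 2)) \<le> m * M" using MT by (rule mult_le_mono2)
    hence mW: "m * 2 ^ (tconst r * D) * 2 ^ (r + 2) \<le> card (W - S)" using m(3) unfolding mult.assoc by linarith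
    have "m * 2 ^ (tconst r * D) * 2 \<le> m * 2 ^ (tconst r * D) * 2 ^ (r + 2)"
      using power_increasing[of 1 "r + 2" "2::nat"] by (intro mult_le_mono2) simp
    with mW have "m * 2 ^ (tconst r * D) * 2 \<le> card (W - S)" by linarith
    hence sA: "m * 2 ^ (tconst r * D) \<le> card A" by (simp add: AB(4) less_eq_div_iff_mult_less_eq)
    have "m * 2 ^ (tconst r * D) * 2 ^ (r + 1) \<le> m * 2 ^ (tconst r * D) * 2 ^ (r + 2)"
      by (intro mult_le_mono2 power_increasing) auto
    also have "m * 2 ^ (tconst r * D) * 2 ^ (r + 1) = 2 ^ (r + 1) * (m * 2 ^ (tconst r * D))" by (rule mult.commute)
    finally have "2 ^ (r + 1) * (m * 2 ^ (tconst r * D)) \<le> 2 ^ (r + 1) * card B" using mW AB(5) by linarith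
    hence sB: "m * 2 ^ (tconst r * D) \<le> card B" by (rule mult_left_le_imp_le) simp
    obtain A1 B1 where AB1: "A1 \<subseteq> A" "B1 \<subseteq> B" "card A1 = m" "card B1 = m" "tileable c F (A1 \<union> B1) 2"
      by (rule tile_part[OF F D fin AB(3) AB(6)[rule_format] m(2) sA sB])
    have S1: "A1 \<union> B1 \<subseteq> W - S" using AB1 AB(1,2) by blast
    have "tileable c F (S \<union> (A1 \<union> B1)) (n + 2)" by (rule tileable_Un[OF S(2) AB1(5)]) (use S1 in blast)
    moreover have "2 * M * card (W - (S \<union> (A1 \<union> B1))) \<le> (2 * M - 1) * card (W - S)"
    proof (rule iterated_step[OF S(1) W S1])
      have "m \<le> card (A1 \<union> B1)" using AB1(1-3) fin finite_subset[of A1 A] finite_subset[of B1 B] card_mono[of "A1 \<union> B1" A1] by auto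
      hence "2 * M * m \<le> 2 * M * card (A1 \<union> B1)" by (rule mult_le_mono2)
      with m(1) show "card (W - S) \<le> 2 * M * card (A1 \<union> B1)" by linarith
    qed
    moreover have "S \<union> (A1 \<union> B1) \<subseteq> W" using S(1) S1 by blast
    ultimately show "\<exists>S'. S' \<subseteq> W \<and> tileable c F S' (n + 2) \<and> 2 * M * card (W - S') \<le> (2 * M - 1) * card (W - S)"
      by (intro exI[of _ "S \<union> (A1 \<union> B1)"]) simp
  qed (use M W tileable_empty in auto)
  have "tileable c F S (4 * M * b)" by (rule tileable_mono[OF S(3)]) (use S(2) in simp)
  thus ?thesis using that[OF S(1) _ S(4)] by (simp add: M_def)
qed

definition fconst :: "nat \<Rightarrow> nat" where
  "fconst r = 20 * (tconst r + rconst (r + 2) + r) + 200"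

subsection \<open>Covering the whole graph\<close>

text \<open>A template with vertex set \<open>X1 \<union> R1\<close> and a set \<open>Q\<close> that can be exchanged into it are set
  aside. After the greedy step, the remaining vertices and about half of \<open>Q\<close> are covered at the
  expense of some vertices of the template, which are then replaced by the other half of \<open>Q\<close>.\<close>

lemma complete_graph_tileable:
  assumes F: "bipartite_bounded_seq D F" and D: "D \<ge> 1" and r: "r \<ge> 1" and V: "finite V"
    and col: "\<And>a b. a \<in> V \<Longrightarrow> b \<in> V \<Longrightarrow> a \<noteq> b \<Longrightarrow> c {a, b} < r"
  shows "tileable c F V (2 ^ (fconst r * D))"
proof (cases "card V < 2 ^ (fconst r * D)")
  case True
  thus ?thesis by (intro tileable_mono[OF tileable_card[OF F V]]) simp
next
  case False
  define n where "n = card V"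
  define T where "T = tconst r * D"
  define u where "u = rconst (r + 2) * D"
  define s where "s = r * D"
  \<comment> \<open>The sizes descend from \<open>n\<close> to \<open>m\<close>,
    \<open>card Z\<close> and \<open>q\<close>, by factors of at most \<open>2 ^ (e0 + 1)\<close>,
    \<open>2 ^ T\<close> and \<open>2 ^ (x + 1)\<close>. Here \<open>e0\<close> lets the template
    fit into \<open>A0\<close> and \<open>B0\<close>, and \<open>x\<close> makes \<open>q\<close>
    small enough for \<open>cover_all_colours\<close> and for the exchange. The product of the three
    factors is \<open>2 ^ b\<close>, so at most \<open>q\<close> vertices survive the greedy
    tiling.\<close>
  define e0 where "e0 = T + s + 3 * D"
  define x where "x = u + s + 4 * D + T"
  define b where "b = e0 + T + x + 2"
  define t where "t = (tconst r + r + 2) * D"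
  define m where "m = n div 2 ^ e0"
  have tD: "t = T + s + 2 * D" by (simp add: t_def T_def s_def algebra_simps)
  have mcD: "fconst r * D = 20 * T + 20 * u + 20 * s + 200 * D" by (simp add: fconst_def T_def u_def s_def algebra_simps)
  have rs: "r \<le> s" using D by (simp add: s_def)
  have large: "2 ^ e \<le> n" if "e \<le> fconst r * D" for e
    using False power_increasing[OF that, of "2::nat"] unfolding n_def by linarith
  have ne0: "2 ^ e0 \<le> n" by (rule large) (use mcD e0_def in linarith)
  note m = div_ge_half[OF _ ne0, folded m_def]
  have m1: "m \<ge> 1" "n \<le> 2 * 2 ^ e0 * m" "m * 2 ^ e0 \<le> n" using m by auto
  obtain A0 B0 k where AB: "A0 \<subseteq> V" "B0 \<subseteq> V" "A0 \<inter> B0 = {}" "card A0 = card V div 2"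
      "card V \<le> 2 ^ (r + 1) * card B0" "\<forall>b\<in>B0. high_deg (coloured c k) A0 r b"
    by (rule monochromatic_pair[of V r c, OF V r col])
  have fin: "finite A0" "finite B0" using AB(1,2) V finite_subset by blast+
  have me: "m * 2 ^ e \<le> n" if "e \<le> e0" for e
  proof -
    have "m * 2 ^ e \<le> m * 2 ^ e0" using that by (intro mult_le_mono2 power_increasing) auto
    with m1(3) show ?thesis by linarith
  qed
  have B0m: "m * 2 ^ (T + 2) \<le> card B0"
  proof -
    have "m * 2 ^ (T + 2 + (r + 1)) \<le> n" by (rule me) (use rs D e0_def in linarith)
    hence "2 ^ (r + 1) * (m * 2 ^ (T + 2)) \<le> 2 ^ (r + 1) * card B0"
      using AB(5) unfolding n_def power_add[of 2 "T + 2" "r + 1"] by (simp only: mult_ac)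
    thus ?thesis by (rule mult_left_le_imp_le) simp
  qed
  have sA: "m * 2 ^ (tconst r * D) \<le> card A0"
  proof -
    have "m * 2 ^ (T + 1) \<le> n" by (rule me) (use D e0_def in linarith)
    thus ?thesis using AB(4) by (simp add: n_def T_def)
  qed
  have sB: "m * 2 ^ (tconst r * D) \<le> card B0"
  proof -
    have "m * 2 ^ T \<le> m * 2 ^ (T + 2)" by (intro mult_le_mono2 power_increasing) auto
    with B0m show ?thesis by (simp add: T_def)
  qed
  obtain h and X Y :: "(bool \<times> nat) set" where h: "bounded_bip h X Y D m"
    "\<forall>c k A B f g. embeds h X Y (coloured c k) A B f g \<and> A \<inter> B = {} \<longrightarrow> tileable c F (f ` X \<union> g ` Y) 2"
    by (rule balanced_double[OF F m1(1)])
  have VV: "card V \<le> m * 2 ^ ((tconst r + r + 4) * D)"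
  proof -
    have "2 * 2 ^ e0 * m = m * 2 ^ (e0 + 1)" by simp
    also have "\<dots> \<le> m * 2 ^ ((tconst r + r + 4) * D)"
    proof (intro mult_le_mono2 power_increasing)
      have "(tconst r + r + 4) * D = T + s + 4 * D" by (simp add: T_def s_def algebra_simps)
      thus "e0 + 1 \<le> (tconst r + r + 4) * D" using D e0_def by linarith
    qed simp
    finally show ?thesis using m1(2) unfolding n_def by linarith
  qed
  have mlarge: "2 ^ e \<le> m" if "e0 + 1 + e \<le> fconst r * D" for e
  proof -
    have "2 ^ (e0 + 1 + e) \<le> 2 * 2 ^ e0 * m" using large[OF that] m1(2) by linarith
    hence "2 ^ (e0 + 1) * 2 ^ e \<le> 2 ^ (e0 + 1) * m" by (simp add: power_add mult_ac)
    thus ?thesis by (rule mult_left_le_imp_le) simp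
  qed
  have mbig: "2 ^ ((tconst r + r + 4 + 12 * r + 44) * D) \<le> m"
  proof (rule mlarge)
    have "(tconst r + r + 4 + 12 * r + 44) * D = T + 13 * s + 48 * D" by (simp add: T_def s_def algebra_simps)
    thus "e0 + 1 + (tconst r + r + 4 + 12 * r + 44) * D \<le> fconst r * D" using mcD D e0_def by linarith
  qed
  obtain A f g Z where A: "A \<subseteq> A0" "card A0 \<le> 2 ^ (tconst r * D) * card A"
    "card B0 \<le> 2 ^ (tconst r * D) * card {b\<in>B0. high_deg (coloured c k) A (2 * r + 4) b}"
    "embeds h X Y (coloured c k) A B0 f g" "Z \<subseteq> g ` Y" "m \<le> 2 ^ (tconst r * D) * card Z"
    "\<forall>b\<in>Z. high_deg (coloured c k) A (2 * r + 4) b"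
    "\<forall>E Q. E \<subseteq> Z \<and> Q \<subseteq> V \<and> card Q = card E \<and> card E * 2 ^ (tconst r * D) \<le> m \<and> Q \<inter> g ` Y = {}
        \<and> (\<forall>q\<in>Q. high_deg (coloured c k) A (2 * r + 4) q) \<longrightarrow>
       (\<exists>g'. embeds h X Y (coloured c k) A (B0 \<union> Q) f g' \<and> g' ` Y = (g ` Y - E) \<union> Q)"
    by (rule template_exists[OF fin V D AB(6)[rule_format] h(1) sA sB VV mbig])
  define X1 where "X1 = f ` X"
  define R1 where "R1 = g ` Y"
  define Bh where "Bh = {b\<in>B0. high_deg (coloured c k) A (2 * r + 4) b}"
  have XR: "X1 \<subseteq> A" "R1 \<subseteq> B0" "card X1 = m" "card R1 = m"
    using A(4) h(1) by (auto simp: embeds_def bounded_bip_def X1_def R1_def card_image)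
  have finA: "finite A" using A(1) fin finite_subset by blast
  have finX: "finite X1" "finite R1" "finite Bh" using XR finA fin finite_subset by (auto simp: Bh_def)
  have ZR1: "Z \<subseteq> R1" using A(5) by (simp add: R1_def)
  have finZ: "finite Z" using ZR1 finX finite_subset by blast
  have Zm: "card Z \<le> m" using card_mono[OF finX(2) ZR1] XR by simp
  have zx: "2 ^ x \<le> card Z"
  proof -
    have "2 ^ (T + x) \<le> m" by (rule mlarge) (use mcD D e0_def x_def in linarith)
    with A(6) have "2 ^ T * 2 ^ x \<le> 2 ^ T * card Z" unfolding power_add T_def by linarith
    thus ?thesis by (rule mult_left_le_imp_le) simp
  qed
  define q where "q = card Z div 2 ^ x"
  note q = div_ge_half[OF _ zx, folded q_def]
  have q1: "card Z \<le> 2 * 2 ^ x * q" "q * 2 ^ x \<le> card Z" using q by auto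
  have qe: "q * 2 ^ e \<le> card Z" if "e \<le> x" for e
  proof -
    have "q * 2 ^ e \<le> q * 2 ^ x" using that by (intro mult_le_mono2 power_increasing) auto
    with q1(2) show ?thesis by linarith
  qed
  have qm: "q \<le> m" using qe[of 0] Zm by simp
  have "4 * m \<le> card Bh"
  proof -
    have "2 ^ T * (4 * m) = m * 2 ^ (T + 2)" by (simp add: power_add)
    with B0m A(3) have "2 ^ T * (4 * m) \<le> 2 ^ T * card Bh" unfolding T_def Bh_def by linarith
    thus ?thesis by (rule mult_left_le_imp_le) simp
  qed
  hence "q \<le> card (Bh - R1)"
    using diff_card_le_card_Diff[OF finX(2), of Bh] XR(4) qm by linarith
  then obtain Q where Q: "Q \<subseteq> Bh - R1" "card Q = q" using obtain_subset_with_card_n by metis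
  have finQ: "finite Q" using Q(1) finX(3) by (meson finite_Diff finite_subset)
  have AA: "A \<inter> B0 = {}" using A(1) AB(3) by blast
  have QB: "Q \<subseteq> B0" "Q \<inter> R1 = {}" "\<forall>q\<in>Q. high_deg (coloured c k) A (2 * r + 4) q"
    using Q(1) by (auto simp: Bh_def)
  have XV: "X1 \<subseteq> V" "R1 \<subseteq> V" "Q \<subseteq> V" "Z \<subseteq> V" using XR A(1) AB(1,2) QB ZR1 by auto
  have disj: "X1 \<inter> R1 = {}" "X1 \<inter> Q = {}" using XR(1,2) QB(1) AA by auto
  define W where "W = V - (X1 \<union> R1 \<union> Q)"
  have cW: "card W \<le> n" unfolding W_def n_def using V by (intro card_mono) auto
  have W2: "n \<le> 2 * card W"
  proof -
    have "card (X1 \<union> R1 \<union> Q) = 2 * m + q"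
      using XR Q(2) finX finQ disj QB(2) by (subst card_Un_disjoint3) auto
    moreover have "n - card (X1 \<union> R1 \<union> Q) \<le> card W"
      unfolding W_def n_def using finX finQ by (intro diff_card_le_card_Diff) auto
    moreover have "m * 2 ^ 3 \<le> n" by (rule me) (use D e0_def in linarith)
    ultimately show ?thesis using qm by simp
  qed
  have sW: "2 ^ ((tconst r + r + 2) * D + b) \<le> card W"
  proof -
    have "2 ^ (t + b + 1) \<le> n" by (rule large) (use mcD D e0_def x_def b_def tD in linarith)
    with W2 show ?thesis by (simp add: t_def)
  qed
  have colW: "c {a, b} < r" if "a \<in> W" "b \<in> W" "a \<noteq> b" for a b using col that by (auto simp: W_def)
  have finW: "finite W" using V by (simp add: W_def)
  obtain S where S: "S \<subseteq> W" "tileable c F S (4 * 2 ^ ((tconst r + r + 2) * D) * b)" "card (W - S) * 2 ^ b \<le> card W"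
    by (rule greedy_tiling[of D F r W c b, OF F D r finW colW sW])
  define R where "R = W - S"
  have finR: "finite R" using finW by (simp add: R_def)
  have Rq: "card R \<le> q"
  proof -
    have "card R * 2 ^ b \<le> 2 * 2 ^ e0 * m" using S(3) cW m1(2) by (simp add: R_def)
    also have "\<dots> \<le> 2 * 2 ^ e0 * (2 ^ T * (2 * 2 ^ x * q))"
    proof (rule mult_le_mono2)
      have "2 ^ T * card Z \<le> 2 ^ T * (2 * 2 ^ x * q)" using q1(1) by (rule mult_le_mono2)
      with A(6) show "m \<le> 2 ^ T * (2 * 2 ^ x * q)" unfolding T_def by linarith
    qed
    also have "\<dots> = q * 2 ^ b" by (simp add: b_def power_add mult_ac)
    finally show ?thesis by (rule mult_right_le_imp_le) simp
  qed
  \<comment> \<open>Covering \<open>R\<close> and \<open>j\<close> vertices of \<open>Q\<close>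
    takes up to \<open>card R + j\<close> vertices from the template, to be replaced by the other
    \<open>q - j\<close> vertices of \<open>Q\<close>. Equating the two numbers gives
    \<open>j\<close>; rounding down ensures enough replacements and accounts for the
    \<open>+ 1\<close> in the bound for the leftover \<open>L\<close>.\<close>
  define j where "j = (q - card R) div 2"
  have "j \<le> card Q" by (simp add: j_def Q(2))
  then obtain Q1 where Q1: "Q1 \<subseteq> Q" "card Q1 = j" using obtain_subset_with_card_n by metis
  have finQ1: "finite Q1" using Q1(1) finQ finite_subset by blast
  have RQ: "R \<inter> Q = {}" "R \<inter> R1 = {}" "R \<inter> X1 = {}" "R \<subseteq> V" by (auto simp: R_def W_def)
  have cRQ: "card (R \<union> Q1) = card R + j" using finR finQ1 RQ(1) Q1 by (subst card_Un_disjoint) auto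
  have j2: "card R + 2 * j \<le> q" "q \<le> card R + 2 * j + 1" using Rq by (auto simp: j_def)
  have "covers c F (R \<union> Q1) Z (2 ^ (cconst r * D))"
  proof (rule cover_all_colours[OF F D r finZ])
    show "finite (R \<union> Q1)" using finR finQ1 by simp
    show ZRQ: "Z \<inter> (R \<union> Q1) = {}" using ZR1 RQ(2) QB(2) Q1(1) by blast
    show "c {a, v} < r" if "a \<in> Z" "v \<in> R \<union> Q1" for a v
      using that ZRQ XV RQ(4) Q1(1) by (intro col) auto
    have "card (R \<union> Q1) \<le> q" using cRQ j2 by linarith
    hence "card (R \<union> Q1) * 2 ^ ((rconst (r + 2) + r + 4) * D) \<le> q * 2 ^ ((rconst (r + 2) + r + 4) * D)"
      by (rule mult_le_mono1)
    also have "\<dots> \<le> card Z" by (rule qe) (simp add: x_def u_def s_def algebra_simps)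
    finally show "card (R \<union> Q1) * 2 ^ ((rconst (r + 2) + r + 4) * D) \<le> card Z" .
  qed
  then obtain E where E: "E \<subseteq> Z" "card E \<le> card (R \<union> Q1)" "card (R \<union> Q1) \<le> card E + 2 ^ (cconst r * D)"
    "tileable c F ((R \<union> Q1) \<union> E) (2 ^ (cconst r * D))" by (auto simp: covers_def)
  have cQ1: "card (Q - Q1) = q - j" using Q1 finQ1 Q(2) by (simp add: card_Diff_subset)
  have "card E \<le> card (Q - Q1)" using E(2) cRQ cQ1 j2 by linarith
  then obtain Q2 where Q2: "Q2 \<subseteq> Q - Q1" "card Q2 = card E" using obtain_subset_with_card_n by metis
  have finQ2: "finite Q2" using Q2(1) finQ by (meson finite_Diff finite_subset)
  define L where "L = Q - Q1 - Q2"
  have cL: "card L \<le> 2 ^ (cconst r * D) + 1"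
  proof -
    have "card L = q - j - card E" using Q2 finQ2 cQ1 by (simp add: L_def card_Diff_subset)
    thus ?thesis using E(3) cRQ j2 by linarith
  qed
  have tL: "tileable c F L (2 ^ (cconst r * D) + 1)"
    using tileable_mono[OF tileable_card[OF F, of L] cL] finQ by (simp add: L_def)
  have "card E * 2 ^ (tconst r * D) \<le> m"
  proof -
    have "card E \<le> q" using E(2) cRQ j2 by linarith
    hence "card E * 2 ^ T \<le> q * 2 ^ T" by (rule mult_le_mono1)
    moreover have "q * 2 ^ T \<le> card Z" by (rule qe) (use x_def in linarith)
    ultimately show ?thesis using Zm unfolding T_def by linarith
  qed
  moreover have "Q2 \<inter> g ` Y = {}" "Q2 \<subseteq> V" "\<forall>q\<in>Q2. high_deg (coloured c k) A (2 * r + 4) q"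
    using Q2(1) QB XV by (auto simp: R1_def)
  ultimately obtain g' where g': "embeds h X Y (coloured c k) A (B0 \<union> Q2) f g'" "g' ` Y = (R1 - E) \<union> Q2"
    using A(8)[rule_format, of E Q2] E(1) Q2(2) by (auto simp: R1_def)
  have tT: "tileable c F (X1 \<union> ((R1 - E) \<union> Q2)) 2"
  proof -
    have "A \<inter> (B0 \<union> Q2) = {}" using AA QB(1) Q2(1) by blast
    thus ?thesis using h(2)[rule_format, of c k A "B0 \<union> Q2" f g'] g' by (simp add: X1_def)
  qed
  have EE: "E \<subseteq> R1" using E(1) ZR1 by blast
  have d1: "S \<inter> ((R \<union> Q1) \<union> E) = {}" using S(1) Q1(1) EE by (auto simp: R_def W_def)
  have d2: "(S \<union> ((R \<union> Q1) \<union> E)) \<inter> (X1 \<union> ((R1 - E) \<union> Q2)) = {}"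
    using S(1) Q1(1) Q2(1) EE disj QB(2) RQ unfolding W_def by blast
  have d3: "(S \<union> ((R \<union> Q1) \<union> E) \<union> (X1 \<union> ((R1 - E) \<union> Q2))) \<inter> L = {}"
    using S(1) EE disj QB(2) RQ unfolding W_def L_def by blast
  note til = tileable_Un[OF tileable_Un[OF tileable_Un[OF S(2) E(4) d1] tT d2] tL d3]
  have "S \<union> ((R \<union> Q1) \<union> E) \<union> (X1 \<union> ((R1 - E) \<union> Q2)) \<union> L = V"
  proof -
    have "S \<union> R = W" using S(1) by (auto simp: R_def)
    moreover have "Q1 \<union> Q2 \<union> L = Q" using Q1(1) Q2(1) by (auto simp: L_def)
    moreover have "W \<union> X1 \<union> R1 \<union> Q = V" using XV by (auto simp: W_def)
    moreover have "(R1 - E) \<union> E = R1" using EE by blast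
    ultimately show ?thesis by blast
  qed
  moreover have "4 * 2 ^ ((tconst r + r + 2) * D) * b + 2 ^ (cconst r * D) + 2 + (2 ^ (cconst r * D) + 1) \<le> 2 ^ (fconst r * D)"
  proof -
    define M where "M = fconst r * D - 3"
    have M: "fconst r * D = M + 3" using mcD D by (simp add: M_def)
    have acD: "cconst r * D = 2 * u + 2 * s + 4 * D" by (simp add: cconst_def u_def s_def algebra_simps)
    have "b < 2 ^ b" by simp
    hence "4 * 2 ^ t * b \<le> 4 * 2 ^ t * 2 ^ b" by (intro mult_le_mono2 less_imp_le)
    also have "\<dots> = 2 ^ (t + b + 2)" by (simp add: power_add)
    also have "\<dots> \<le> 2 ^ M" by (rule power_increasing) (use mcD D e0_def x_def b_def tD M in linarith, simp)
    finally have 1: "4 * 2 ^ t * b \<le> 2 ^ M" .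
    have 2: "(2::nat) ^ (cconst r * D) \<le> 2 ^ M" by (rule power_increasing) (use mcD D acD M in linarith, simp)
    have 3: "(1::nat) \<le> 2 ^ M" by simp
    have "(2::nat) ^ (fconst r * D) = 8 * 2 ^ M" by (simp add: M power_add)
    thus ?thesis using 1 2 3 unfolding t_def by linarith
  qed
  ultimately show ?thesis using tileable_mono[OF til] by simp
qed

theorem theorem1p6:
  shows "\<forall>r::nat. r \<ge> 1 \<longrightarrow> (\<exists>C::real. \<forall>(\<Delta>::nat) F. \<Delta> \<ge> 1 \<and> bipartite_bounded_seq \<Delta> F \<longrightarrow>
    ereal_of_enat (tiling_number r F) \<le> ereal (exp (C * real \<Delta>)))"
proof (intro allI impI)
  fix r :: nat assume r: "r \<ge> 1"
  show "\<exists>C::real. \<forall>(\<Delta>::nat) F. \<Delta> \<ge> 1 \<and> bipartite_bounded_seq \<Delta> F \<longrightarrow>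
    ereal_of_enat (tiling_number r F) \<le> ereal (exp (C * real \<Delta>))"
  proof (intro exI[of _ "real (fconst r)"] allI impI, elim conjE)
    fix \<Delta> :: nat and F assume \<Delta>: "\<Delta> \<ge> 1" and F: "bipartite_bounded_seq \<Delta> F"
    have "\<exists>T. mono_tiling F (complete_graph V) c T \<and> card T \<le> 2 ^ (fconst r * \<Delta>)"
      if V: "finite V" and c: "edge_colouring r (complete_graph V) c" for V c
    proof -
      have "c {a, b} < r" if "a \<in> V" "b \<in> V" "a \<noteq> b" for a b
      proof -
        have "{a, b} \<in> [V]\<^bsup>2\<^esup>" using that by (auto simp: nsets_def)
        thus ?thesis using c by (auto simp: edge_colouring_def complete_graph_def)
      qed
      from complete_graph_tileable[of \<Delta> F r V c, OF F \<Delta> r V this] show ?thesis by (simp add: tileable_def)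
    qed
    hence "tiling_number r F \<le> enat (2 ^ (fconst r * \<Delta>))"
      unfolding tiling_number_def by (intro Inf_lower) blast
    hence "ereal_of_enat (tiling_number r F) \<le> ereal_of_enat (enat (2 ^ (fconst r * \<Delta>)))"
      by (simp only: ereal_of_enat_le_iff)
    also have "\<dots> = ereal (2 ^ (fconst r * \<Delta>))" by simp
    also have "\<dots> \<le> ereal (exp (real (fconst r) * real \<Delta>))"
    proof -
      have "(2::real) \<le> exp 1" using exp_ge_add_one_self[of "1::real"] by simp
      hence "(2::real) ^ (fconst r * \<Delta>) \<le> exp 1 ^ (fconst r * \<Delta>)" by (rule power_mono) simp
      also have "\<dots> = exp (real (fconst r) * real \<Delta>)" by (simp add: exp_of_nat_mult[symmetric])
      finally show ?thesis by simp
    qed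
    finally show "ereal_of_enat (tiling_number r F) \<le> ereal (exp (real (fconst r) * real \<Delta>))" .
  qed
qed

end
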